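(* Let $\Bbbk$ be a field of characteristic $0$ and let $A^\bullet$ be a connected, graded-commutative $\Bbbk$-algebra with $\dim A^1<\infty$. Let $\mathfrak{L}(A):=\mathfrak{L}(\mathcal{M}(A,1))$ be the Lie algebra corresponding to the canonical $1$-minimal model of $A$, and let $\mathfrak{h}(A)$ be the holonomy Lie algebra of $A$. There exists then an isomorphism of complete, filtered Lie algebras between $\mathfrak{L}(A)$ and the degree completion $\widehat{\mathfrak{h}}(A)$.
   Context: $A=\bigoplus_{n\ge0}A^n$ is graded-commutative, connected means $A^0=\Bbbk$, and $A$ is viewed as a dga with $d=0$. Holonomy Lie algebra. Let $\mu\colon A^1\wedge A^1\to A^2$ be the multiplication map and $\mu^*\colon(A^2)^*\to(A^1)^*\wedge(A^1)^*$ its dual; identify $(A^1)^*\wedge(A^1)^*$ with the degree $2$ piece of the free Lie algebra $\mathfrak{lie}((A^1)^* )$ via $x\wedge y\mapsto[x,y]$ (generators in degree $1$). Then $\mathfrak{h}(A)=\mathfrak{lie}((A^1)^* )/\langle\operatorname{im}(\mu^* )\rangle$, a graded Lie algebra. Its degree completion is $\widehat{\mathfrak{h}}(A)=\prod_{i\ge1}\mathfrak{h}_i(A)$, filtered by $\prod_{i\ge k}\mathfrak{h}_i(A)$, $k\ge1$. Canonical $1$-minimal model. $\mathcal{M}=\mathcal{M}(A,1)$ is the union of dgas $\mathcal{M}_1\subset\mathcal{M}_2\subset\cdots$, built as follows (all generators in degree $1$): $V_1=A^1$ and $\mathcal{M}_1=(\bigwedge(V_1),d=0)$; $V_2=\ker(\mu)$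 and $\mathcal{M}_2=\bigwedge(V_1\oplus V_2)$ with $d|_{V_2}$ the inclusion $V_2\hookrightarrow V_1\wedge V_1$. Inductively, for $i\geq 3$, $\mathcal{M}_i=\mathcal{M}_{i-1}\otimes\bigwedge(V_i)$, where $V_i=\ker\big(H^2(\mathcal{M}_{i-1})\to A^2\big)$, the map being induced by the dga morphism $\mathcal{M}_{i-1}\to A$ which is the identity on $V_1=A^1$ and zero on $V_j$, $j\ge2$, so that there is a short exact sequence $0\to V_i\to H^2(\mathcal{M}_{i-1})\to\operatorname{im}(\mu)\to0$; the differential $d$ on $V_i$ is a linear choice of representing cocycles, homogeneous of weight $i$ with respect to the (Hirsch) weights in which $V_j$ has weight $j$. Dual Lie algebra. The finite-dimensional dual $\mathfrak{L}_i=(\mathcal{M}_i^1)^*$ is a nilpotent Lie algebra with bracket $\langle[u^*,v^*],w\rangle=\langle u^*\wedge v^*,dw\rangle$ for $u^*,v^*\in\mathfrak L_i$ and $w\in\mathcal M^1_i$; the inclusions $\mathcal{M}_{i-1}\subset\mathcal{M}_i$ dualize to surjections $\mathfrak{L}_i\twoheadrightarrow\mathfrak{L}_{i-1}$. Then $\mathfrak{L}(\mathcal{M})=\varprojlim_i\mathfrak{L}_i$, with the inverse limit filtration, whose terms are $\mathfrak{L}(\mathcal{M})$ itself and, for $i\ge1$, the kernels of $\mathfrak{L}(\mathcal{M})\to\mathfrak{L}_i$ (as $(i+1)$-st term). *)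

theory Defs
  imports Complex_Main "HOL-Library.Poly_Mapping" "HOL-Library.FuncSet"
begin

section \<open>Vector spaces and non-associative algebras with explicit carrier\<close>

record ('k, 'x) vspace =
  vcarrier :: "'x set"
  vadd :: "'x \<Rightarrow> 'x \<Rightarrow> 'x"
  vzero :: "'x"
  vsmult :: "'k \<Rightarrow> 'x \<Rightarrow> 'x"

text \<open>The product \<open>aprod\<close> is an arbitrary bilinear operation; for a Lie algebra it is the bracket.\<close>

record ('k, 'x) alg = "('k, 'x) vspace" +
  aprod :: "'x \<Rightarrow> 'x \<Rightarrow> 'x"

record ('k, 'x) filtered_alg = "('k, 'x) alg" +
  filt :: "nat \<Rightarrow> 'x set"

definition vector_space_on :: "('k::field, 'x, 'e) vspace_scheme \<Rightarrow> bool" where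
  "vector_space_on X \<longleftrightarrow>
     vzero X \<in> vcarrier X \<and>
     (\<forall>x\<in>vcarrier X. \<forall>y\<in>vcarrier X. vadd X x y \<in> vcarrier X) \<and>
     (\<forall>c. \<forall>x\<in>vcarrier X. vsmult X c x \<in> vcarrier X) \<and>
     (\<forall>x\<in>vcarrier X. \<forall>y\<in>vcarrier X. \<forall>z\<in>vcarrier X.
        vadd X (vadd X x y) z = vadd X x (vadd X y z)) \<and>
     (\<forall>x\<in>vcarrier X. \<forall>y\<in>vcarrier X. vadd X x y = vadd X y x) \<and>
     (\<forall>x\<in>vcarrier X. vadd X (vzero X) x = x) \<and>
     (\<forall>x\<in>vcarrier X. \<exists>y\<in>vcarrier X. vadd X x y = vzero X) \<and>
     (\<forall>c. \<forall>x\<in>vcarrier X. \<forall>y\<in>vcarrier X.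
        vsmult X c (vadd X x y) = vadd X (vsmult X c x) (vsmult X c y)) \<and>
     (\<forall>a b. \<forall>x\<in>vcarrier X. vsmult X (a + b) x = vadd X (vsmult X a x) (vsmult X b x)) \<and>
     (\<forall>a b. \<forall>x\<in>vcarrier X. vsmult X (a * b) x = vsmult X a (vsmult X b x)) \<and>
     (\<forall>x\<in>vcarrier X. vsmult X 1 x = x)"

definition vsubspace :: "('k, 'x, 'e) vspace_scheme \<Rightarrow> 'x set \<Rightarrow> bool" where
  "vsubspace X S \<longleftrightarrow> S \<subseteq> vcarrier X \<and> vzero X \<in> S \<and>
     (\<forall>x\<in>S. \<forall>y\<in>S. vadd X x y \<in> S) \<and> (\<forall>c. \<forall>x\<in>S. vsmult X c x \<in> S)"

definition vsum :: "('k, 'x, 'e) vspace_scheme \<Rightarrow> 'x list \<Rightarrow> 'x" where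
  "vsum X xs = foldr (vadd X) xs (vzero X)"

definition algebra_on :: "('k::field, 'x, 'e) alg_scheme \<Rightarrow> bool" where
  "algebra_on X \<longleftrightarrow> vector_space_on X \<and>
     (\<forall>x\<in>vcarrier X. \<forall>y\<in>vcarrier X. aprod X x y \<in> vcarrier X) \<and>
     (\<forall>x\<in>vcarrier X. \<forall>y\<in>vcarrier X. \<forall>z\<in>vcarrier X.
        aprod X (vadd X x y) z = vadd X (aprod X x z) (aprod X y z) \<and>
        aprod X z (vadd X x y) = vadd X (aprod X z x) (aprod X z y)) \<and>
     (\<forall>c. \<forall>x\<in>vcarrier X. \<forall>y\<in>vcarrier X.
        aprod X (vsmult X c x) y = vsmult X c (aprod X x y) \<and>
        aprod X x (vsmult X c y) = vsmult X c (aprod X x y))"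

definition jacobiator :: "('k, 'x, 'e) alg_scheme \<Rightarrow> 'x \<Rightarrow> 'x \<Rightarrow> 'x \<Rightarrow> 'x" where
  "jacobiator X x y z =
     vadd X (vadd X (aprod X (aprod X x y) z) (aprod X (aprod X y z) x)) (aprod X (aprod X z x) y)"

definition lie_algebra :: "('k::field, 'x, 'e) alg_scheme \<Rightarrow> bool" where
  "lie_algebra X \<longleftrightarrow> algebra_on X \<and>
     (\<forall>x\<in>vcarrier X. aprod X x x = vzero X) \<and>
     (\<forall>x\<in>vcarrier X. \<forall>y\<in>vcarrier X. \<forall>z\<in>vcarrier X. jacobiator X x y z = vzero X)"

definition alg_iso ::
    "('k, 'x, 'e) alg_scheme \<Rightarrow> ('k, 'y, 'f) alg_scheme \<Rightarrow> ('x \<Rightarrow> 'y) \<Rightarrow> bool" where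
  "alg_iso X Y f \<longleftrightarrow> bij_betw f (vcarrier X) (vcarrier Y) \<and>
     (\<forall>x\<in>vcarrier X. \<forall>y\<in>vcarrier X. f (vadd X x y) = vadd Y (f x) (f y)) \<and>
     (\<forall>c. \<forall>x\<in>vcarrier X. f (vsmult X c x) = vsmult Y c (f x)) \<and>
     (\<forall>x\<in>vcarrier X. \<forall>y\<in>vcarrier X. f (aprod X x y) = aprod Y (f x) (f y))"

subsection \<open>Ideals and quotients\<close>

definition alg_ideal :: "('k, 'x, 'e) alg_scheme \<Rightarrow> 'x set \<Rightarrow> bool" where
  "alg_ideal X I \<longleftrightarrow> vsubspace X I \<and>
     (\<forall>x\<in>vcarrier X. \<forall>y\<in>I. aprod X x y \<in> I \<and> aprod X y x \<in> I)"

definition ideal_gen :: "('k, 'x, 'e) alg_scheme \<Rightarrow> 'x set \<Rightarrow> 'x set" where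
  "ideal_gen X R = \<Inter>{I. alg_ideal X I \<and> R \<subseteq> I}"

definition coset :: "('k, 'x, 'e) vspace_scheme \<Rightarrow> 'x set \<Rightarrow> 'x \<Rightarrow> 'x set" where
  "coset X S x = vadd X x ` S"

text \<open>The operations on cosets are given as unions over representatives; when \<open>S\<close> is an ideal
  all the sets in such a union coincide. If \<open>S\<close> is only a subspace, the product is
  meaningless, but the vector space structure is still the right one.\<close>

definition quotient_alg :: "('k, 'x, 'e) alg_scheme \<Rightarrow> 'x set \<Rightarrow> ('k, 'x set) alg" where
  "quotient_alg X S =
     \<lparr> vcarrier = coset X S ` vcarrier X,
       vadd = (\<lambda>C D. \<Union>x\<in>C. \<Union>y\<in>D. coset X S (vadd X x y)),
       vzero = coset X S (vzero X),
       vsmult = (\<lambda>c C. \<Union>x\<in>C. coset X S (vsmult X c x)),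
       aprod = (\<lambda>C D. \<Union>x\<in>C. \<Union>y\<in>D. coset X S (aprod X x y)) \<rparr>"

subsection \<open>Inverse limits and complete filtered Lie algebras\<close>

text \<open>All towers, filtrations and gradings below are indexed by the integers \<open>\<ge> 1\<close>; sequences are
  \<open>extensional\<close> functions on \<open>{1..}\<close>, and the value of a filtration at \<open>0\<close> is irrelevant.
  The map \<open>\<pi> i\<close> goes from stage \<open>i + 1\<close> to stage \<open>i\<close>. The inverse limit filtration
  consists of the whole limit and the kernels of the projections to stage \<open>i\<close>, the latter
  being the \<open>(i + 1)\<close>-st term.\<close>

definition lim_carrier :: "(nat \<Rightarrow> 'x set) \<Rightarrow> (nat \<Rightarrow> 'x \<Rightarrow> 'x) \<Rightarrow> (nat \<Rightarrow> 'x) set" where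
  "lim_carrier C \<pi> = {x \<in> PiE {1..} C. \<forall>i\<ge>1. \<pi> i (x (Suc i)) = x i}"

definition inverse_limit ::
    "(nat \<Rightarrow> ('k, 'x, 'e) alg_scheme) \<Rightarrow> (nat \<Rightarrow> 'x \<Rightarrow> 'x) \<Rightarrow> ('k, nat \<Rightarrow> 'x) filtered_alg" where
  "inverse_limit X \<pi> =
     \<lparr> vcarrier = lim_carrier (\<lambda>i. vcarrier (X i)) \<pi>,
       vadd = (\<lambda>x y. \<lambda>i\<in>{1..}. vadd (X i) (x i) (y i)),
       vzero = (\<lambda>i\<in>{1..}. vzero (X i)),
       vsmult = (\<lambda>c x. \<lambda>i\<in>{1..}. vsmult (X i) c (x i)),
       aprod = (\<lambda>x y. \<lambda>i\<in>{1..}. aprod (X i) (x i) (y i)),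
       filt = (\<lambda>k. {x \<in> lim_carrier (\<lambda>i. vcarrier (X i)) \<pi>.
                    k \<ge> 2 \<longrightarrow> x (k - 1) = vzero (X (k - 1))}) \<rparr>"

definition filtered_lie_algebra :: "('k::field, 'x, 'e) filtered_alg_scheme \<Rightarrow> bool" where
  "filtered_lie_algebra L \<longleftrightarrow> lie_algebra L \<and> filt L 1 = vcarrier L \<and>
     (\<forall>k\<ge>1. vsubspace L (filt L k) \<and> filt L (Suc k) \<subseteq> filt L k) \<and>
     (\<forall>j\<ge>1. \<forall>k\<ge>1. \<forall>x\<in>filt L j. \<forall>y\<in>filt L k. aprod L x y \<in> filt L (j + k))"

text \<open>Completeness: the canonical map from \<open>L\<close> to the inverse limit of the quotients by the
  terms of the filtration is bijective.\<close>

definition complete_filtered_lie_algebra :: "('k::field, 'x, 'e) filtered_alg_scheme \<Rightarrow> bool" where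
  "complete_filtered_lie_algebra L \<longleftrightarrow> filtered_lie_algebra L \<and>
     bij_betw (\<lambda>x. \<lambda>k\<in>{1..}. coset L (filt L k) x) (vcarrier L)
       (lim_carrier (\<lambda>k. coset L (filt L k) ` vcarrier L)
                    (\<lambda>k C. \<Union>x\<in>C. coset L (filt L k) x))"

definition complete_filtered_lie_iso ::
    "('k::field, 'x, 'e) filtered_alg_scheme \<Rightarrow> ('k, 'y, 'f) filtered_alg_scheme \<Rightarrow>
      ('x \<Rightarrow> 'y) \<Rightarrow> bool" where
  "complete_filtered_lie_iso L L' f \<longleftrightarrow>
     complete_filtered_lie_algebra L \<and> complete_filtered_lie_algebra L' \<and>
     alg_iso L L' f \<and> (\<forall>k\<ge>1. f ` filt L k = filt L' k)"

subsection \<open>Degree completion\<close>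

text \<open>\<open>H i\<close> is the homogeneous part of degree \<open>i \<ge> 1\<close> of the graded algebra \<open>L\<close>.\<close>

definition degree_completion ::
    "('k, 'x, 'e) alg_scheme \<Rightarrow> (nat \<Rightarrow> 'x set) \<Rightarrow> ('k, nat \<Rightarrow> 'x) filtered_alg" where
  "degree_completion L H =
     \<lparr> vcarrier = PiE {1..} H,
       vadd = (\<lambda>x y. \<lambda>n\<in>{1..}. vadd L (x n) (y n)),
       vzero = (\<lambda>n\<in>{1..}. vzero L),
       vsmult = (\<lambda>c x. \<lambda>n\<in>{1..}. vsmult L c (x n)),
       aprod = (\<lambda>x y. \<lambda>n\<in>{1..}. vsum L (map (\<lambda>p. aprod L (x p) (y (n - p))) [1..<n])),
       filt = (\<lambda>k. {x \<in> PiE {1..} H. \<forall>i\<in>{1..<k}. x i = vzero L}) \<rparr>"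

section \<open>Free constructions\<close>

text \<open>The algebra with basis \<open>S\<close> whose product extends \<open>m\<close> bilinearly.\<close>

definition magma_algebra ::
    "'b set \<Rightarrow> ('b \<Rightarrow> 'b \<Rightarrow> 'b) \<Rightarrow> ('k::field, 'b \<Rightarrow>\<^sub>0 'k) alg" where
  "magma_algebra S m =
     \<lparr> vcarrier = {p. Poly_Mapping.keys p \<subseteq> S},
       vadd = (+),
       vzero = 0,
       vsmult = (\<lambda>c. Poly_Mapping.map (\<lambda>x. c * x)),
       aprod = (\<lambda>p q. \<Sum>s\<in>Poly_Mapping.keys p. \<Sum>t\<in>Poly_Mapping.keys q.
                  Poly_Mapping.single (m s t) (Poly_Mapping.lookup p s * Poly_Mapping.lookup q t)) \<rparr>"

text \<open>Relators turning a map \<open>\<iota>\<close> on the underlying set of the vector space \<open>W\<close> into a linear map.\<close>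

definition linear_relators ::
    "('k, 'v, 'e) vspace_scheme \<Rightarrow> ('v \<Rightarrow> ('b \<Rightarrow>\<^sub>0 'k::field)) \<Rightarrow> ('b \<Rightarrow>\<^sub>0 'k) set" where
  "linear_relators W \<iota> =
     {\<iota> (vadd W x y) - \<iota> x - \<iota> y | x y. x \<in> vcarrier W \<and> y \<in> vcarrier W} \<union>
     {\<iota> (vsmult W c x) - Poly_Mapping.map (\<lambda>a. c * a) (\<iota> x) | c x. x \<in> vcarrier W}"

subsection \<open>Free Lie algebra on a vector space\<close>

datatype (letters: 'v) magma = Gen 'v | Br "'v magma" "'v magma"

primrec magma_degree :: "'v magma \<Rightarrow> nat" where
  "magma_degree (Gen x) = 1"
| "magma_degree (Br s t) = magma_degree s + magma_degree t"

definition free_nonassoc ::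
    "('k::field, 'v, 'e) vspace_scheme \<Rightarrow> ('k, 'v magma \<Rightarrow>\<^sub>0 'k) alg" where
  "free_nonassoc W = magma_algebra {t. letters t \<subseteq> vcarrier W} Br"

definition lie_ideal :: "('k::field, 'v, 'e) vspace_scheme \<Rightarrow> ('v magma \<Rightarrow>\<^sub>0 'k) set" where
  "lie_ideal W =
     (let F = free_nonassoc W in
      ideal_gen F
        (linear_relators W (\<lambda>x. Poly_Mapping.single (Gen x) 1) \<union>
         {aprod F p p | p. p \<in> vcarrier F} \<union>
         {jacobiator F p q r | p q r. p \<in> vcarrier F \<and> q \<in> vcarrier F \<and> r \<in> vcarrier F}))"

definition free_lie ::
    "('k::field, 'v, 'e) vspace_scheme \<Rightarrow> ('k, ('v magma \<Rightarrow>\<^sub>0 'k) set) alg" where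
  "free_lie W = quotient_alg (free_nonassoc W) (lie_ideal W)"

definition free_lie_gen ::
    "('k::field, 'v, 'e) vspace_scheme \<Rightarrow> 'v \<Rightarrow> ('v magma \<Rightarrow>\<^sub>0 'k) set" where
  "free_lie_gen W x = coset (free_nonassoc W) (lie_ideal W) (Poly_Mapping.single (Gen x) 1)"

definition free_lie_degree ::
    "('k::field, 'v, 'e) vspace_scheme \<Rightarrow> nat \<Rightarrow> ('v magma \<Rightarrow>\<^sub>0 'k) set set" where
  "free_lie_degree W n =
     coset (free_nonassoc W) (lie_ideal W) `
       {p \<in> vcarrier (free_nonassoc W). \<forall>t\<in>Poly_Mapping.keys p. magma_degree t = n}"

subsection \<open>Exterior algebra of a vector space\<close>

definition free_assoc :: "('k::field, 'v, 'e) vspace_scheme \<Rightarrow> ('k, 'v list \<Rightarrow>\<^sub>0 'k) alg" where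
  "free_assoc W = magma_algebra (lists (vcarrier W)) (@)"

definition exterior_ideal :: "('k::field, 'v, 'e) vspace_scheme \<Rightarrow> ('v list \<Rightarrow>\<^sub>0 'k) set" where
  "exterior_ideal W =
     ideal_gen (free_assoc W)
       (linear_relators W (\<lambda>x. Poly_Mapping.single [x] 1) \<union>
        {Poly_Mapping.single [x, x] 1 | x. x \<in> vcarrier W})"

definition exterior_algebra ::
    "('k::field, 'v, 'e) vspace_scheme \<Rightarrow> ('k, ('v list \<Rightarrow>\<^sub>0 'k) set) alg" where
  "exterior_algebra W = quotient_alg (free_assoc W) (exterior_ideal W)"

definition exterior_gen ::
    "('k::field, 'v, 'e) vspace_scheme \<Rightarrow> 'v \<Rightarrow> ('v list \<Rightarrow>\<^sub>0 'k) set" where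
  "exterior_gen W x = coset (free_assoc W) (exterior_ideal W) (Poly_Mapping.single [x] 1)"

section \<open>Graded-commutative algebras and dgas\<close>

definition internal_direct_sum :: "'a::comm_monoid_add set \<Rightarrow> (nat \<Rightarrow> 'a set) \<Rightarrow> bool" where
  "internal_direct_sum S G \<longleftrightarrow> (\<forall>n. G n \<subseteq> S) \<and>
     (\<forall>x\<in>S. \<exists>!f. (\<forall>n. f n \<in> G n) \<and> finite {n. f n \<noteq> 0} \<and> x = (\<Sum>n | f n \<noteq> 0. f n))"

locale graded_commutative_algebra = vector_space scale
  for scale :: "'k::field_char_0 \<Rightarrow> 'a::ring_1 \<Rightarrow> 'a" +
  fixes G :: "nat \<Rightarrow> 'a set"
  assumes scale_mult_left: "scale c (x * y) = scale c x * y"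
    and scale_mult_right: "scale c (x * y) = x * scale c y"
    and subspace_grade: "module.subspace scale (G n)"
    and direct_sum_grade: "internal_direct_sum UNIV G"
    and one_grade: "1 \<in> G 0"
    and mult_grade: "x \<in> G m \<Longrightarrow> y \<in> G n \<Longrightarrow> x * y \<in> G (m + n)"
    and graded_commute: "x \<in> G m \<Longrightarrow> y \<in> G n \<Longrightarrow> y * x = (- 1) ^ (m * n) * (x * y)"

definition connected_grading :: "('k \<Rightarrow> 'a::one \<Rightarrow> 'a) \<Rightarrow> (nat \<Rightarrow> 'a set) \<Rightarrow> bool" where
  "connected_grading scale G \<longleftrightarrow> G 0 = range (\<lambda>c. scale c 1)"

locale dga = graded_commutative_algebra scale G
  for scale :: "'k::field_char_0 \<Rightarrow> 'a::ring_1 \<Rightarrow> 'a" and G :: "nat \<Rightarrow> 'a set" +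
  fixes d :: "'a \<Rightarrow> 'a"
  assumes linear_d: "Vector_Spaces.linear scale scale d"
    and d_grade: "x \<in> G n \<Longrightarrow> d x \<in> G (Suc n)"
    and leibniz: "x \<in> G m \<Longrightarrow> d (x * y) = d x * y + (- 1) ^ m * (x * d y)"
    and d_d: "d (d x) = 0"

locale dga_morphism =
  D1: dga s1 G1 d1 + D2: dga s2 G2 d2
  for s1 :: "'k::field_char_0 \<Rightarrow> 'a::ring_1 \<Rightarrow> 'a" and G1 d1
    and s2 :: "'k \<Rightarrow> 'b::ring_1 \<Rightarrow> 'b" and G2 d2 +
  fixes \<phi> :: "'a \<Rightarrow> 'b"
  assumes linear_morphism: "Vector_Spaces.linear s1 s2 \<phi>"
    and morphism_one: "\<phi> 1 = 1"
    and morphism_mult: "\<phi> (x * y) = \<phi> x * \<phi> y"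
    and morphism_grade: "x \<in> G1 n \<Longrightarrow> \<phi> x \<in> G2 n"
    and morphism_d: "\<phi> (d1 x) = d2 (\<phi> x)"

text \<open>A subspace or subalgebra \<open>S\<close> of the ambient type, viewed as a structure with carrier.\<close>

definition sub_alg :: "('k \<Rightarrow> 'a::ring_1 \<Rightarrow> 'a) \<Rightarrow> 'a set \<Rightarrow> ('k, 'a) alg" where
  "sub_alg scale S = \<lparr> vcarrier = S, vadd = (+), vzero = 0, vsmult = scale, aprod = (*) \<rparr>"

text \<open>The subalgebra \<open>S\<close> is the exterior algebra on its subspace \<open>W\<close>: the inclusion of \<open>W\<close>
  extends to an isomorphism from the abstract exterior algebra.\<close>

definition is_exterior_algebra :: "('k::field \<Rightarrow> 'a::ring_1 \<Rightarrow> 'a) \<Rightarrow> 'a set \<Rightarrow> 'a set \<Rightarrow> bool" where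
  "is_exterior_algebra scale W S \<longleftrightarrow>
     (\<exists>f. alg_iso (exterior_algebra (sub_alg scale W)) (sub_alg scale S) f \<and>
          (\<forall>x\<in>W. f (exterior_gen (sub_alg scale W) x) = x))"

text \<open>Dual of a subspace \<open>W\<close>; a functional on \<open>W\<close> is represented by the function which is
  extended by zero outside \<open>W\<close>.\<close>

definition dual :: "('k::field \<Rightarrow> 'a::ring_1 \<Rightarrow> 'a) \<Rightarrow> 'a set \<Rightarrow> ('k, 'a \<Rightarrow> 'k) vspace" where
  "dual scale W =
     \<lparr> vcarrier = {f. (\<forall>x\<in>W. \<forall>y\<in>W. f (x + y) = f x + f y) \<and>
                       (\<forall>c. \<forall>x\<in>W. f (scale c x) = c * f x) \<and> (\<forall>x. x \<notin> W \<longrightarrow> f x = 0)},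
       vadd = (\<lambda>f g x. f x + g x),
       vzero = (\<lambda>x. 0),
       vsmult = (\<lambda>c f x. c * f x) \<rparr>"

section \<open>Holonomy Lie algebra\<close>

text \<open>An element \<open>\<Sum> x\<^sub>j \<and> y\<^sub>j\<close> of the exterior square of the dual of \<open>A\<^sup>1\<close> is, for
  finite-dimensional \<open>A\<^sup>1\<close>, the same as the functional sending \<open>a \<and> b\<close> to
  \<open>\<Sum> x\<^sub>j a * y\<^sub>j b - x\<^sub>j b * y\<^sub>j a\<close>. So the condition below says
  \<open>\<Sum> x\<^sub>j \<and> y\<^sub>j = \<mu>\<^sup>* \<alpha>\<close>, for some \<open>\<alpha>\<close> in the dual of \<open>A\<^sup>2\<close>, and the relators are
  the images of these elements under \<open>x \<and> y \<mapsto> [x, y]\<close>.\<close>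

definition holonomy_relators ::
    "('k::field \<Rightarrow> 'a::ring_1 \<Rightarrow> 'a) \<Rightarrow> (nat \<Rightarrow> 'a set) \<Rightarrow> (('a \<Rightarrow> 'k) magma \<Rightarrow>\<^sub>0 'k) set set" where
  "holonomy_relators scale G =
     (let W = dual scale (G 1) in
      {vsum (free_lie W)
         (map (\<lambda>(x, y). aprod (free_lie W) (free_lie_gen W x) (free_lie_gen W y)) ps) | ps \<alpha>.
         set ps \<subseteq> vcarrier W \<times> vcarrier W \<and> \<alpha> \<in> vcarrier (dual scale (G 2)) \<and>
         (\<forall>a\<in>G 1. \<forall>b\<in>G 1. (\<Sum>(x, y)\<leftarrow>ps. x a * y b - x b * y a) = \<alpha> (a * b))})"

definition holonomy_ideal ::
    "('k::field \<Rightarrow> 'a::ring_1 \<Rightarrow> 'a) \<Rightarrow> (nat \<Rightarrow> 'a set) \<Rightarrow> (('a \<Rightarrow> 'k) magma \<Rightarrow>\<^sub>0 'k) set set" where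
  "holonomy_ideal scale G =
     ideal_gen (free_lie (dual scale (G 1))) (holonomy_relators scale G)"

definition holonomy ::
    "('k::field \<Rightarrow> 'a::ring_1 \<Rightarrow> 'a) \<Rightarrow> (nat \<Rightarrow> 'a set) \<Rightarrow>
      ('k, (('a \<Rightarrow> 'k) magma \<Rightarrow>\<^sub>0 'k) set set) alg" where
  "holonomy scale G = quotient_alg (free_lie (dual scale (G 1))) (holonomy_ideal scale G)"

definition holonomy_degree ::
    "('k::field \<Rightarrow> 'a::ring_1 \<Rightarrow> 'a) \<Rightarrow> (nat \<Rightarrow> 'a set) \<Rightarrow>
      nat \<Rightarrow> (('a \<Rightarrow> 'k) magma \<Rightarrow>\<^sub>0 'k) set set set" where
  "holonomy_degree scale G n =
     coset (free_lie (dual scale (G 1))) (holonomy_ideal scale G) `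
       free_lie_degree (dual scale (G 1)) n"

definition completed_holonomy ::
    "('k::field \<Rightarrow> 'a::ring_1 \<Rightarrow> 'a) \<Rightarrow> (nat \<Rightarrow> 'a set) \<Rightarrow>
      ('k, nat \<Rightarrow> (('a \<Rightarrow> 'k) magma \<Rightarrow>\<^sub>0 'k) set set) filtered_alg" where
  "completed_holonomy scale G =
     degree_completion (holonomy scale G) (holonomy_degree scale G)"

section \<open>Canonical 1-minimal model\<close>

definition generators_upto :: "('k::field \<Rightarrow> 'm::ring_1 \<Rightarrow> 'm) \<Rightarrow> (nat \<Rightarrow> 'm set) \<Rightarrow> nat \<Rightarrow> 'm set" where
  "generators_upto scale V i = module.span scale (\<Union>j\<in>{1..i}. V j)"

definition stage :: "('k::field \<Rightarrow> 'm::ring_1 \<Rightarrow> 'm) \<Rightarrow> (nat \<Rightarrow> 'm set) \<Rightarrow> nat \<Rightarrow> 'm set" where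
  "stage scale V i = module.span scale {prod_list vs | vs. set vs \<subseteq> (\<Union>j\<in>{1..i}. V j)}"

definition weight_part :: "('k::field \<Rightarrow> 'm::ring_1 \<Rightarrow> 'm) \<Rightarrow> (nat \<Rightarrow> 'm set) \<Rightarrow> nat \<Rightarrow> 'm set" where
  "weight_part scale V w =
     module.span scale
       {prod_list vs | vs js. list_all2 (\<lambda>v j. v \<in> V j) vs js \<and> sum_list js = w}"

text \<open>\<open>S\<close> is the underlying set of a sub-dga. Cohomology in positive degrees only, written with
  \<open>n + 1\<close> for the degree.\<close>

definition coboundaries :: "(nat \<Rightarrow> 'm set) \<Rightarrow> ('m \<Rightarrow> 'm) \<Rightarrow> 'm set \<Rightarrow> nat \<Rightarrow> 'm set" where
  "coboundaries G d S n = d ` (S \<inter> G n)"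

definition cohomology_class ::
    "('k \<Rightarrow> 'm::ring_1 \<Rightarrow> 'm) \<Rightarrow> (nat \<Rightarrow> 'm set) \<Rightarrow> ('m \<Rightarrow> 'm) \<Rightarrow> 'm set \<Rightarrow> nat \<Rightarrow> 'm \<Rightarrow> 'm set" where
  "cohomology_class scale G d S n z = coset (sub_alg scale S) (coboundaries G d S n) z"

definition cohomology_Suc ::
    "('k \<Rightarrow> 'm::ring_1 \<Rightarrow> 'm) \<Rightarrow> (nat \<Rightarrow> 'm set) \<Rightarrow> ('m \<Rightarrow> 'm) \<Rightarrow> 'm set \<Rightarrow> nat \<Rightarrow> 'm set set" where
  "cohomology_Suc scale G d S n =
     cohomology_class scale G d S n ` {z \<in> S \<inter> G (Suc n). d z = 0}"

text \<open>
  The dga \<open>(M, d)\<close> with generating spaces \<open>V 1, V 2, \<dots>\<close> in degree 1 and structure map \<open>\<phi>\<close> to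
  \<open>(A, 0)\<close> is the result of the inductive construction. The constructed spaces are
  subquotients of exterior algebras on the previous ones and so cannot literally share one type; they are
  identified with subspaces \<open>V i\<close> of \<open>M\<close> by isomorphisms: \<open>V 1\<close> with \<open>A\<^sup>1\<close> by \<open>\<phi>\<close>, and
  \<open>V i\<close>, for \<open>i \<ge> 2\<close>, with the kernel of the map from \<open>H\<^sup>2\<close> of the stage \<open>i - 1\<close> to \<open>A\<^sup>2\<close>,
  by sending \<open>v\<close> to the class of its representing cocycle \<open>d v\<close>. For \<open>i = 2\<close> the stage \<open>1\<close> has
  zero differential, its \<open>H\<^sup>2\<close> is the exterior square of \<open>V 1\<close>, and the kernel is that of \<open>\<mu>\<close>.
  A class \<open>C\<close> is sent to zero iff \<open>\<phi>\<close> vanishes on all representatives.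
  The choice of representing cocycles is arbitrary, subject to homogeneity.
\<close>

locale canonical_one_minimal_model =
  dga_morphism sM GM d sA GA "\<lambda>_. 0" \<phi>
  for sA :: "'k::field_char_0 \<Rightarrow> 'a::ring_1 \<Rightarrow> 'a" and GA :: "nat \<Rightarrow> 'a set"
    and sM :: "'k \<Rightarrow> 'm::ring_1 \<Rightarrow> 'm" and GM :: "nat \<Rightarrow> 'm set" and d :: "'m \<Rightarrow> 'm"
    and \<phi> :: "'m \<Rightarrow> 'a" +
  fixes V :: "nat \<Rightarrow> 'm set"
  assumes V_0: "V 0 = {0}"
    and subspace_V: "module.subspace sM (V i)"
    and direct_sum_V: "internal_direct_sum (GM 1) V"
    and stage_exterior: "i \<ge> 1 \<Longrightarrow> is_exterior_algebra sM (generators_upto sM V i) (stage sM V i)"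
    and union_stages: "(\<Union>i\<in>{1..}. stage sM V i) = UNIV"
    and \<phi>_V_1: "bij_betw \<phi> (V 1) (GA 1)"
    and \<phi>_V_higher: "i \<ge> 2 \<Longrightarrow> v \<in> V i \<Longrightarrow> \<phi> v = 0"
    and d_V_1: "v \<in> V 1 \<Longrightarrow> d v = 0"
    and d_V_stage: "i \<ge> 2 \<Longrightarrow> v \<in> V i \<Longrightarrow> d v \<in> stage sM V (i - 1)"
    and d_V_weight: "i \<ge> 2 \<Longrightarrow> v \<in> V i \<Longrightarrow> d v \<in> weight_part sM V i"
    and V_kernel: "i \<ge> 2 \<Longrightarrow>
      bij_betw (\<lambda>v. cohomology_class sM GM d (stage sM V (i - 1)) 1 (d v)) (V i)
        {C \<in> cohomology_Suc sM GM d (stage sM V (i - 1)) 1. \<phi> ` C = {0}}"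

subsection \<open>The dual Lie algebra of the model\<close>

text \<open>\<open>u \<and> v\<close> as a functional on \<open>M\<^sub>i\<^sup>2\<close>, the exterior square of \<open>M\<^sub>i\<^sup>1\<close>.\<close>

definition wedge_functional ::
    "('k::field \<Rightarrow> 'm::ring_1 \<Rightarrow> 'm) \<Rightarrow> (nat \<Rightarrow> 'm set) \<Rightarrow> (nat \<Rightarrow> 'm set) \<Rightarrow> nat \<Rightarrow>
      ('m \<Rightarrow> 'k) \<Rightarrow> ('m \<Rightarrow> 'k) \<Rightarrow> 'm \<Rightarrow> 'k" where
  "wedge_functional scale G V i u v =
     (THE g. g \<in> vcarrier (dual scale (stage scale V i \<inter> G 2)) \<and>
        (\<forall>a\<in>stage scale V i \<inter> G 1. \<forall>b\<in>stage scale V i \<inter> G 1.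
           g (a * b) = u a * v b - u b * v a))"

definition model_lie_stage ::
    "('k::field \<Rightarrow> 'm::ring_1 \<Rightarrow> 'm) \<Rightarrow> (nat \<Rightarrow> 'm set) \<Rightarrow> ('m \<Rightarrow> 'm) \<Rightarrow> (nat \<Rightarrow> 'm set) \<Rightarrow> nat \<Rightarrow>
      ('k, 'm \<Rightarrow> 'k) alg" where
  "model_lie_stage scale G d V i =
     vspace.extend (dual scale (stage scale V i \<inter> G 1))
       (alg.fields (\<lambda>u v w. if w \<in> stage scale V i \<inter> G 1
                            then wedge_functional scale G V i u v (d w) else 0))"

definition model_lie_algebra ::
    "('k::field \<Rightarrow> 'm::ring_1 \<Rightarrow> 'm) \<Rightarrow> (nat \<Rightarrow> 'm set) \<Rightarrow> ('m \<Rightarrow> 'm) \<Rightarrow> (nat \<Rightarrow> 'm set) \<Rightarrow>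
      ('k, nat \<Rightarrow> 'm \<Rightarrow> 'k) filtered_alg" where
  "model_lie_algebra scale G d V =
     inverse_limit (model_lie_stage scale G d V)
       (\<lambda>i f x. if x \<in> stage scale V i \<inter> G 1 then f x else 0)"

end

theory Submission
  imports Defs
begin

text \<open>
  Let \<open>M\<close> be the model, \<open>M\<^sup>1\<close> its part of degree one, which is the direct sum of the \<open>V n\<close>, and
  \<open>h\<close> the holonomy Lie algebra. Both sides of the theorem are compared with a third Lie
  algebra: the space \<open>functionals\<close> of all linear functionals on \<open>M\<^sup>1\<close>, with the bracket dual to
  \<open>d\<close> (\<open>dual_lie\<close>). The \<open>n\<close>-th term of its filtration consists of the functionals which vanish on
  \<open>V j\<close> for all \<open>j < n\<close>. As \<open>M\<^sup>1\<close> is the union of the stages, restriction identifies this algebra with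
  the inverse limit of the dual Lie algebras of the stages (\<open>to_model_iso\<close>). As \<open>d\<close> respects
  weights, it is also the completion of the graded Lie algebra with parts \<open>V n\<^sup>*\<close>, and what
  remains is to identify the latter with \<open>h\<close>.

  For the bracket one needs the pairing of \<open>u \<and> v\<close> with elements of \<open>M\<^sup>2\<close>. It is obtained by
  contracting with \<open>u\<close> and then with \<open>v\<close>. Contractions exist because all relations in \<open>M\<close> are
  those of an exterior algebra (\<open>iota_well_defined\<close>). Pairing three functionals with
  \<open>d z\<close> gives the Chevalley--Eilenberg formula \<open>triple_contract_d\<close>, hence the Jacobi identity, and
  Euler's formula \<open>euler_formula\<close> makes the pairings nondegenerate in characteristic zero.

  A generator \<open>x\<close> of \<open>h\<close>, that is, a functional on \<open>A\<^sup>1\<close>, is sent to \<open>x \<circ> \<phi>\<close>. The extension \<open>psi\<close> of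
  this map to the free algebra respects degrees. It kills the holonomy relations: a relation which
  comes from a functional \<open>\<alpha>\<close> on \<open>A\<^sup>2\<close> is sent to the functional \<open>w \<mapsto> \<alpha> (\<phi> (d w))\<close>, and \<open>\<phi> (d w) = 0\<close>.
  So \<open>psi\<close> induces maps from \<open>h\<^sub>n\<close> to \<open>V n\<^sup>*\<close>.

  These maps are surjective. If \<open>n \<ge> 2\<close> and \<open>w\<close> in \<open>V n\<close> is killed by all brackets of functionals
  of lower degree, then \<open>d w = 0\<close> by nondegeneracy, so \<open>w = 0\<close>, since \<open>V n\<close> embeds into the
  cohomology of the previous stage. Hence finitely many of these brackets span \<open>V n\<^sup>*\<close>
  (\<open>frames_exist\<close>; the induction starts with the finite dimension of \<open>A\<^sup>1\<close>).

  They are injective (\<open>psi_injective\<close>), by induction on \<open>n\<close>. For \<open>n \<ge> 2\<close> let \<open>lam\<close> be a functional on \<open>h\<^sub>n\<close>. Then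
  \<open>(x, y) \<mapsto> lam [x, y]\<close> is an alternating form on the part of \<open>h\<close> of degree below \<open>n\<close>, which is known by
  induction; so this form is an element \<open>c\<close> of \<open>M\<^sup>2\<close> of weight \<open>n\<close>. The Jacobi identity in \<open>h\<close> says
  \<open>d c = 0\<close>, and the holonomy relations say \<open>\<phi> c = 0\<close>. But \<open>V n\<close> is the kernel of the map from the second
  cohomology of stage \<open>n - 1\<close> to \<open>A\<^sup>2\<close>, so \<open>c\<close> is cohomologous to \<open>d v\<close> for some \<open>v\<close> in \<open>V n\<close>, and \<open>lam\<close> is the composite of
  \<open>psi\<close> with evaluation at \<open>v\<close>. Thus an element of \<open>h\<^sub>n\<close> which is killed by \<open>psi\<close> is killed by
  every functional.
\<close>

section \<open>Vector spaces with explicit carrier\<close>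

definition vdiff :: "('k::field, 'x, 'e) vspace_scheme \<Rightarrow> 'x \<Rightarrow> 'x \<Rightarrow> 'x" where
  "vdiff X x y = vadd X x (vsmult X (- 1) y)"

locale carrier_vector_space =
  fixes X :: "('k::field, 'x, 'e) vspace_scheme"
  assumes vs: "vector_space_on X"
begin

lemma zero_closed [simp]: "vzero X \<in> vcarrier X"
  and add_closed [simp]: "x \<in> vcarrier X \<Longrightarrow> y \<in> vcarrier X \<Longrightarrow> vadd X x y \<in> vcarrier X"
  and smult_closed [simp]: "x \<in> vcarrier X \<Longrightarrow> vsmult X c x \<in> vcarrier X"
  and add_assoc: "x \<in> vcarrier X \<Longrightarrow> y \<in> vcarrier X \<Longrightarrow> z \<in> vcarrier X \<Longrightarrow>
        vadd X (vadd X x y) z = vadd X x (vadd X y z)"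
  and add_commute: "x \<in> vcarrier X \<Longrightarrow> y \<in> vcarrier X \<Longrightarrow> vadd X x y = vadd X y x"
  and zero_add [simp]: "x \<in> vcarrier X \<Longrightarrow> vadd X (vzero X) x = x"
  and ex_inverse: "x \<in> vcarrier X \<Longrightarrow> \<exists>y\<in>vcarrier X. vadd X x y = vzero X"
  and smult_add: "x \<in> vcarrier X \<Longrightarrow> y \<in> vcarrier X \<Longrightarrow>
        vsmult X c (vadd X x y) = vadd X (vsmult X c x) (vsmult X c y)"
  and add_smult: "x \<in> vcarrier X \<Longrightarrow>
        vsmult X (a + b) x = vadd X (vsmult X a x) (vsmult X b x)"
  and smult_smult: "x \<in> vcarrier X \<Longrightarrow> vsmult X a (vsmult X b x) = vsmult X (a * b) x"
  and one_smult [simp]: "x \<in> vcarrier X \<Longrightarrow> vsmult X 1 x = x"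
  using vs unfolding vector_space_on_def by (blast | metis)+

lemma add_left_commute:
  "x \<in> vcarrier X \<Longrightarrow> y \<in> vcarrier X \<Longrightarrow> z \<in> vcarrier X \<Longrightarrow>
    vadd X x (vadd X y z) = vadd X y (vadd X x z)"
  by (metis add_assoc add_commute)

lemma add_zero [simp]: "x \<in> vcarrier X \<Longrightarrow> vadd X x (vzero X) = x"
  by (metis add_commute zero_add zero_closed)

lemma add_left_cancel:
  assumes "x \<in> vcarrier X" "y \<in> vcarrier X" "z \<in> vcarrier X" "vadd X x y = vadd X x z"
  shows "y = z"
proof -
  obtain u where u: "u \<in> vcarrier X" "vadd X x u = vzero X" using ex_inverse assms by blast
  have "y = vadd X (vadd X u x) y" using u assms add_commute by simp
  also have "\<dots> = vadd X (vadd X u x) z" using u assms by (simp add: add_assoc)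
  also have "\<dots> = z" using u assms add_commute by simp
  finally show ?thesis .
qed

lemma zero_smult [simp]: "x \<in> vcarrier X \<Longrightarrow> vsmult X 0 x = vzero X"
  by (metis add.right_neutral add_left_cancel add_smult add_zero smult_closed zero_closed)

lemma smult_zero [simp]: "vsmult X c (vzero X) = vzero X"
  by (metis mult_zero_right smult_smult zero_closed zero_smult)

lemma vdiff_closed [simp]: "x \<in> vcarrier X \<Longrightarrow> y \<in> vcarrier X \<Longrightarrow> vdiff X x y \<in> vcarrier X"
  by (simp add: vdiff_def)

lemma vdiff_self [simp]: "x \<in> vcarrier X \<Longrightarrow> vdiff X x x = vzero X"
  unfolding vdiff_def by (metis add_smult one_smult add.right_inverse zero_smult)

lemma add_vdiff: "x \<in> vcarrier X \<Longrightarrow> y \<in> vcarrier X \<Longrightarrow> vadd X y (vdiff X x y) = x"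
  by (metis add_left_commute add_zero smult_closed vdiff_def vdiff_self)

lemma vdiff_eq_zero: "x \<in> vcarrier X \<Longrightarrow> y \<in> vcarrier X \<Longrightarrow> vdiff X x y = vzero X \<longleftrightarrow> x = y"
  by (metis add_vdiff add_zero vdiff_self)

lemma vdiff_add: "x \<in> vcarrier X \<Longrightarrow> y \<in> vcarrier X \<Longrightarrow> z = vadd X y x \<Longrightarrow> vdiff X z y = x"
  by (metis add_closed add_left_cancel add_vdiff vdiff_closed)

lemma vdiff_triangle:
  assumes "x \<in> vcarrier X" "y \<in> vcarrier X" "z \<in> vcarrier X"
  shows "vdiff X x z = vadd X (vdiff X x y) (vdiff X y z)"
proof (rule vdiff_add)
  have "vadd X z (vadd X (vdiff X x y) (vdiff X y z)) = vadd X (vdiff X x y) (vadd X z (vdiff X y z))"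
    using assms by (simp add: add_left_commute)
  also have "\<dots> = x" using assms by (simp add: add_vdiff add_commute[of _ y])
  finally show "x = vadd X z (vadd X (vdiff X x y) (vdiff X y z))" by simp
qed (use assms in simp_all)

lemma vdiff_swap:
  assumes "x \<in> vcarrier X" "y \<in> vcarrier X"
  shows "vdiff X y x = vsmult X (- 1) (vdiff X x y)"
  using assms by (simp add: vdiff_def smult_add smult_smult add_commute)

lemma vdiff_vadd_vadd:
  assumes "x \<in> vcarrier X" "y \<in> vcarrier X" "x' \<in> vcarrier X" "y' \<in> vcarrier X"
  shows "vdiff X (vadd X x y) (vadd X x' y') = vadd X (vdiff X x x') (vdiff X y y')"
  using assms by (simp add: vdiff_def smult_add add_assoc add_left_commute)

lemma vdiff_smult_smult:
  assumes "x \<in> vcarrier X" "y \<in> vcarrier X"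
  shows "vdiff X (vsmult X c x) (vsmult X c y) = vsmult X c (vdiff X x y)"
  using assms by (simp add: vdiff_def smult_add smult_smult)

lemma vsum_closed: "set xs \<subseteq> vcarrier X \<Longrightarrow> vsum X xs \<in> vcarrier X"
  by (induction xs) (auto simp: vsum_def)

lemma mem_coset:
  assumes "vsubspace X S" "x \<in> vcarrier X"
  shows "z \<in> coset X S x \<longleftrightarrow> z \<in> vcarrier X \<and> vdiff X z x \<in> S"
proof
  assume "z \<in> coset X S x"
  then obtain s where s: "s \<in> S" "z = vadd X x s" unfolding coset_def by auto
  then have "s \<in> vcarrier X" using assms unfolding vsubspace_def by auto
  with s assms show "z \<in> vcarrier X \<and> vdiff X z x \<in> S" using vdiff_add by auto
next
  assume "z \<in> vcarrier X \<and> vdiff X z x \<in> S"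
  then show "z \<in> coset X S x" using assms add_vdiff unfolding coset_def by (metis imageI)
qed

lemma coset_eq_iff:
  assumes S: "vsubspace X S" and x: "x \<in> vcarrier X" and y: "y \<in> vcarrier X"
  shows "coset X S x = coset X S y \<longleftrightarrow> vdiff X x y \<in> S"
proof
  assume "coset X S x = coset X S y"
  moreover have "x \<in> coset X S x"
    using S x by (simp add: mem_coset) (simp add: vsubspace_def)
  ultimately show "vdiff X x y \<in> S" using mem_coset S y by blast
next
  assume xy: "vdiff X x y \<in> S"
  then have yx: "vdiff X y x \<in> S" using vdiff_swap x y S unfolding vsubspace_def by metis
  have *: "z \<in> coset X S b"
    if "a \<in> vcarrier X" "b \<in> vcarrier X" "vdiff X a b \<in> S" "z \<in> coset X S a" for a b z
    using that vdiff_triangle[of z a b] S unfolding vsubspace_def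
    by (simp add: mem_coset[OF S])
  have "z \<in> coset X S x \<longleftrightarrow> z \<in> coset X S y" for z
    using *[OF x y xy] *[OF y x yx] by blast
  then show "coset X S x = coset X S y" by blast
qed

lemma self_mem_coset: "vsubspace X S \<Longrightarrow> x \<in> vcarrier X \<Longrightarrow> x \<in> coset X S x"
  by (simp add: mem_coset) (simp add: vsubspace_def)

text \<open>The quotient operations are unions over representatives; each such union has only one
  distinct member.\<close>

lemma UN_coset:
  assumes S: "vsubspace X S" and x: "x \<in> vcarrier X"
    and g: "\<And>z. z \<in> vcarrier X \<Longrightarrow> vdiff X z x \<in> S \<Longrightarrow> g z = g x"
  shows "(\<Union>z\<in>coset X S x. g z) = g x"
  using g self_mem_coset[OF S x] mem_coset[OF S x] by fastforce

end

lemma algebra_on_vs: "algebra_on X \<Longrightarrow> carrier_vector_space X"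
  unfolding algebra_on_def carrier_vector_space_def by simp

section \<open>Surjective homomorphisms and quotients\<close>

text \<open>The target is not assumed to satisfy any axioms. They are transported along the map, which is
  why preservation of zero is demanded separately.\<close>

definition alg_epi ::
    "('k, 'x, 'e) alg_scheme \<Rightarrow> ('k, 'y, 'f) alg_scheme \<Rightarrow> ('x \<Rightarrow> 'y) \<Rightarrow> bool" where
  "alg_epi X Y f \<longleftrightarrow> f ` vcarrier X = vcarrier Y \<and> f (vzero X) = vzero Y \<and>
     (\<forall>x\<in>vcarrier X. \<forall>y\<in>vcarrier X. f (vadd X x y) = vadd Y (f x) (f y)) \<and>
     (\<forall>c. \<forall>x\<in>vcarrier X. f (vsmult X c x) = vsmult Y c (f x)) \<and>
     (\<forall>x\<in>vcarrier X. \<forall>y\<in>vcarrier X. f (aprod X x y) = aprod Y (f x) (f y))"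

lemma algebra_on_epi:
  fixes X :: "('k::field, 'x, 'e) alg_scheme" and Y :: "('k, 'y, 'f) alg_scheme"
  assumes X: "algebra_on X" and f: "alg_epi X Y f"
  shows "algebra_on Y"
proof -
  interpret carrier_vector_space X using X by (rule algebra_on_vs)
  have Y: "vcarrier Y = f ` vcarrier X" using f unfolding alg_epi_def by simp
  have ops: "vzero Y = f (vzero X)"
    "\<And>x y. x \<in> vcarrier X \<Longrightarrow> y \<in> vcarrier X \<Longrightarrow> vadd Y (f x) (f y) = f (vadd X x y)"
    "\<And>c x. x \<in> vcarrier X \<Longrightarrow> vsmult Y c (f x) = f (vsmult X c x)"
    "\<And>x y. x \<in> vcarrier X \<Longrightarrow> y \<in> vcarrier X \<Longrightarrow> aprod Y (f x) (f y) = f (aprod X x y)"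
    using f unfolding alg_epi_def by simp_all
  have "vector_space_on Y"
    unfolding vector_space_on_def Y ball_simps bex_simps
  proof (intro conjI ballI allI)
    fix x assume "x \<in> vcarrier X"
    moreover obtain y where "y \<in> vcarrier X" "vadd X x y = vzero X"
      using ex_inverse calculation by blast
    ultimately show "\<exists>y\<in>vcarrier X. vadd Y (f x) (f y) = vzero Y" using ops by metis
  qed ((simp_all add: ops add_assoc smult_add add_smult smult_smult)?,
      (simp_all add: add_commute)?)
  moreover have "aprod X x y \<in> vcarrier X" if "x \<in> vcarrier X" "y \<in> vcarrier X" for x y
    using X that unfolding algebra_on_def by simp
  ultimately show ?thesis
    using X unfolding algebra_on_def Y ball_simps by (simp add: ops)
qed

lemma lie_algebra_epi:
  fixes X :: "('k::field, 'x, 'e) alg_scheme" and Y :: "('k, 'y, 'f) alg_scheme"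
  assumes X: "lie_algebra X" and f: "alg_epi X Y f"
  shows "lie_algebra Y"
proof -
  have A: "algebra_on X" using X unfolding lie_algebra_def by simp
  interpret carrier_vector_space X using A by (rule algebra_on_vs)
  have Y: "vcarrier Y = f ` vcarrier X" using f unfolding alg_epi_def by simp
  have ops: "vzero Y = f (vzero X)"
    "\<And>x y. x \<in> vcarrier X \<Longrightarrow> y \<in> vcarrier X \<Longrightarrow> vadd Y (f x) (f y) = f (vadd X x y)"
    "\<And>x y. x \<in> vcarrier X \<Longrightarrow> y \<in> vcarrier X \<Longrightarrow> aprod Y (f x) (f y) = f (aprod X x y)"
    using f unfolding alg_epi_def by simp_all
  have cl: "aprod X x y \<in> vcarrier X" if "x \<in> vcarrier X" "y \<in> vcarrier X" for x y
    using A that unfolding algebra_on_def by simp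
  have "jacobiator Y (f x) (f y) (f z) = f (jacobiator X x y z)"
    if "x \<in> vcarrier X" "y \<in> vcarrier X" "z \<in> vcarrier X" for x y z
    using that unfolding jacobiator_def by (simp add: ops cl)
  then show ?thesis
    using X algebra_on_epi[OF A f] unfolding lie_algebra_def Y by (auto simp: ops)
qed

lemma alg_epi_comp:
  assumes "alg_epi X Y f" "alg_epi Y Z g"
  shows "alg_epi X Z (\<lambda>x. g (f x))"
proof -
  have Y: "vcarrier Y = f ` vcarrier X" using assms(1) unfolding alg_epi_def by simp
  show ?thesis
    using assms unfolding alg_epi_def Y by (auto simp: image_image)
qed

lemma alg_epi_vsum:
  fixes X :: "('k::field, 'x, 'e) alg_scheme" and Y :: "('k, 'y, 'f) alg_scheme"
  assumes X: "algebra_on X" and f: "alg_epi X Y f" and "set xs \<subseteq> vcarrier X"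
  shows "f (vsum X xs) = vsum Y (map f xs)"
proof -
  interpret carrier_vector_space X using X by (rule algebra_on_vs)
  show ?thesis
    using assms(3) f
    by (induction xs) (simp_all add: vsum_def alg_epi_def vsum_closed[unfolded vsum_def])
qed

lemma alg_epi_vdiff:
  fixes X :: "('k::field, 'x, 'e) alg_scheme" and Y :: "('k, 'y, 'f) alg_scheme"
  assumes X: "algebra_on X" and f: "alg_epi X Y f" and "x \<in> vcarrier X" "y \<in> vcarrier X"
  shows "f (vdiff X x y) = vdiff Y (f x) (f y)"
proof -
  interpret carrier_vector_space X using X by (rule algebra_on_vs)
  show ?thesis using assms unfolding vdiff_def alg_epi_def by simp
qed

lemma alg_ideal_kernel:
  fixes X :: "('k::field, 'x, 'e) alg_scheme" and Y :: "('k, 'y, 'f) alg_scheme"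
  assumes X: "algebra_on X" and f: "alg_epi X Y f"
  shows "alg_ideal X {x \<in> vcarrier X. f x = vzero Y}"
proof -
  interpret X: carrier_vector_space X using X by (rule algebra_on_vs)
  have AY: "algebra_on Y" by (rule algebra_on_epi[OF X f])
  interpret Y: carrier_vector_space Y using AY by (rule algebra_on_vs)
  have Y: "f x \<in> vcarrier Y" if "x \<in> vcarrier X" for x using f that unfolding alg_epi_def by auto
  have z: "aprod Y (vzero Y) y = vzero Y" "aprod Y y (vzero Y) = vzero Y"
    if "y \<in> vcarrier Y" for y
  proof -
    have "aprod Y (vsmult Y 0 (vzero Y)) y = vsmult Y 0 (aprod Y (vzero Y) y)"
      "aprod Y y (vsmult Y 0 (vzero Y)) = vsmult Y 0 (aprod Y y (vzero Y))"
      and "aprod Y (vzero Y) y \<in> vcarrier Y" "aprod Y y (vzero Y) \<in> vcarrier Y"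
      using AY that Y.zero_closed unfolding algebra_on_def by blast+
    then show "aprod Y (vzero Y) y = vzero Y" "aprod Y y (vzero Y) = vzero Y" by simp_all
  qed
  show ?thesis
    using f X Y z unfolding alg_ideal_def vsubspace_def alg_epi_def algebra_on_def by auto
qed

lemma ideal_gen_least: "alg_ideal X I \<Longrightarrow> R \<subseteq> I \<Longrightarrow> ideal_gen X R \<subseteq> I"
  unfolding ideal_gen_def by auto

lemma ideal_gen_superset: "R \<subseteq> ideal_gen X R"
  unfolding ideal_gen_def by auto

lemma alg_ideal_ideal_gen:
  fixes X :: "('k::field, 'x, 'e) alg_scheme"
  assumes X: "algebra_on X" and R: "R \<subseteq> vcarrier X"
  shows "alg_ideal X (ideal_gen X R)"
proof -
  interpret carrier_vector_space X using X by (rule algebra_on_vs)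
  have "alg_ideal X (vcarrier X)"
    using X unfolding alg_ideal_def vsubspace_def algebra_on_def by auto
  then have "ideal_gen X R \<subseteq> vcarrier X" using R by (rule ideal_gen_least)
  then show ?thesis
    unfolding alg_ideal_def vsubspace_def ideal_gen_def by auto
qed

lemma alg_epi_coset:
  fixes X :: "('k::field, 'x, 'e) alg_scheme"
  assumes X: "algebra_on X" and S: "alg_ideal X S"
  shows "alg_epi X (quotient_alg X S) (coset X S)"
proof -
  interpret carrier_vector_space X using X by (rule algebra_on_vs)
  have SS: "vsubspace X S" using S unfolding alg_ideal_def by simp
  have Sadd: "\<And>x y. x \<in> S \<Longrightarrow> y \<in> S \<Longrightarrow> vadd X x y \<in> S"
    and Ssm: "\<And>c x. x \<in> S \<Longrightarrow> vsmult X c x \<in> S"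
    and Sl: "\<And>x y. x \<in> vcarrier X \<Longrightarrow> y \<in> S \<Longrightarrow> aprod X x y \<in> S"
    and Sr: "\<And>x y. x \<in> vcarrier X \<Longrightarrow> y \<in> S \<Longrightarrow> aprod X y x \<in> S"
    and S0: "vzero X \<in> S"
    using S unfolding alg_ideal_def vsubspace_def by auto
  have cl: "aprod X x y \<in> vcarrier X" if "x \<in> vcarrier X" "y \<in> vcarrier X" for x y
    using X that unfolding algebra_on_def by simp
  have dl: "vdiff X (aprod X x y) (aprod X x' y) = aprod X (vdiff X x x') y"
    and dr: "vdiff X (aprod X y x) (aprod X y x') = aprod X y (vdiff X x x')"
    if "x \<in> vcarrier X" "y \<in> vcarrier X" "x' \<in> vcarrier X" for x y x'
    using X that unfolding algebra_on_def vdiff_def by simp_all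
  have two: "(\<Union>a\<in>coset X S x. \<Union>b\<in>coset X S y. coset X S (h a b)) = coset X S (h x y)"
    if xy: "x \<in> vcarrier X" "y \<in> vcarrier X"
      and h: "\<And>a b. a \<in> vcarrier X \<Longrightarrow> b \<in> vcarrier X \<Longrightarrow> h a b \<in> vcarrier X"
      and hl: "\<And>a b. a \<in> vcarrier X \<Longrightarrow> b \<in> vcarrier X \<Longrightarrow> vdiff X a x \<in> S \<Longrightarrow> vdiff X (h a b) (h x b) \<in> S"
      and hr: "\<And>b. b \<in> vcarrier X \<Longrightarrow> vdiff X b y \<in> S \<Longrightarrow> vdiff X (h x b) (h x y) \<in> S"
    for x y h
  proof -
    have "(\<Union>a\<in>coset X S x. \<Union>b\<in>coset X S y. coset X S (h a b))
        = (\<Union>b\<in>coset X S y. coset X S (h x b))"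
    proof (rule UN_coset[OF SS xy(1)])
      fix a assume a: "a \<in> vcarrier X" "vdiff X a x \<in> S"
      have "coset X S (h a b) = coset X S (h x b)" if "b \<in> coset X S y" for b
        using that a xy h hl by (simp add: coset_eq_iff[OF SS] mem_coset[OF SS])
      then show "(\<Union>b\<in>coset X S y. coset X S (h a b)) = (\<Union>b\<in>coset X S y. coset X S (h x b))"
        by simp
    qed
    also have "\<dots> = coset X S (h x y)"
      by (rule UN_coset[OF SS xy(2)]) (use xy h hr in \<open>simp add: coset_eq_iff[OF SS]\<close>)
    finally show ?thesis .
  qed
  have "coset X S (vadd X x y) = vadd (quotient_alg X S) (coset X S x) (coset X S y)"
    if "x \<in> vcarrier X" "y \<in> vcarrier X" for x y
    unfolding quotient_alg_def using that
    by simp (rule two[symmetric]; simp add: vdiff_vadd_vadd S0 Sadd)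
  moreover have "coset X S (aprod X x y) = aprod (quotient_alg X S) (coset X S x) (coset X S y)"
    if "x \<in> vcarrier X" "y \<in> vcarrier X" for x y
    unfolding quotient_alg_def using that
    by simp (rule two[symmetric]; simp add: dl dr Sl Sr cl)
  moreover have "coset X S (vsmult X c x) = vsmult (quotient_alg X S) c (coset X S x)"
    if "x \<in> vcarrier X" for x c
    unfolding quotient_alg_def using that
    by simp (rule UN_coset[OF SS, symmetric]; simp add: coset_eq_iff[OF SS] vdiff_smult_smult Ssm)
  ultimately show ?thesis
    unfolding alg_epi_def by (simp add: quotient_alg_def)
qed

text \<open>This controls the kernel of an iterated quotient without a presentation of the composite. The
  image of \<open>K\<close> in the first quotient is again an ideal, and \<open>K\<close> is its full preimage because it
  contains \<open>S\<close>.\<close>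

lemma quotient_kernel_least:
  fixes X :: "('k::field, 'x, 'e) alg_scheme"
  assumes X: "algebra_on X" and S: "alg_ideal X S" and K: "alg_ideal X K" and SK: "S \<subseteq> K"
    and R: "R \<subseteq> coset X S ` K"
    and x: "x \<in> vcarrier X" and xR: "coset X S x \<in> ideal_gen (quotient_alg X S) R"
  shows "x \<in> K"
proof -
  interpret carrier_vector_space X using X by (rule algebra_on_vs)
  let ?Q = "quotient_alg X S"
  have f: "alg_epi X ?Q (coset X S)" by (rule alg_epi_coset[OF X S])
  have Kc: "K \<subseteq> vcarrier X" using K unfolding alg_ideal_def vsubspace_def by simp
  have Q: "vcarrier ?Q = coset X S ` vcarrier X" using f unfolding alg_epi_def by simp
  have ops: "vzero ?Q = coset X S (vzero X)"
    "\<And>x y. x \<in> vcarrier X \<Longrightarrow> y \<in> vcarrier X \<Longrightarrow>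
       vadd ?Q (coset X S x) (coset X S y) = coset X S (vadd X x y)"
    "\<And>c x. x \<in> vcarrier X \<Longrightarrow> vsmult ?Q c (coset X S x) = coset X S (vsmult X c x)"
    "\<And>x y. x \<in> vcarrier X \<Longrightarrow> y \<in> vcarrier X \<Longrightarrow>
       aprod ?Q (coset X S x) (coset X S y) = coset X S (aprod X x y)"
    using f unfolding alg_epi_def by simp_all
  have "alg_ideal ?Q (coset X S ` K)"
    unfolding alg_ideal_def vsubspace_def Q ball_simps
    using K Kc unfolding alg_ideal_def vsubspace_def by (auto simp: ops subset_eq)
  then have "coset X S x \<in> coset X S ` K" using ideal_gen_least[OF _ R] xR by blast
  then obtain k where k: "k \<in> K" "coset X S x = coset X S k" by auto
  then have "k \<in> vcarrier X" using Kc by auto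
  moreover have "vsubspace X S" using S unfolding alg_ideal_def by simp
  ultimately have "vdiff X x k \<in> K" using coset_eq_iff[of S x k] k SK x by blast
  then have "vadd X k (vdiff X x k) \<in> K" using k K unfolding alg_ideal_def vsubspace_def by blast
  moreover have "vadd X k (vdiff X x k) = x"
    by (rule add_vdiff[OF x]) (use k Kc in blast)
  ultimately show ?thesis by simp
qed

section \<open>Complete filtered Lie algebras\<close>

text \<open>Completeness in terms of Cauchy sequences. Unlike the definition by inverse limits of
  cosets, this form visibly depends on the vector space structure and the filtration only, so it
  passes along isomorphisms.\<close>

definition cauchy_complete :: "('k::field, 'x, 'e) filtered_alg_scheme \<Rightarrow> bool" where
  "cauchy_complete L \<longleftrightarrow>
     (\<forall>x\<in>vcarrier L. (\<forall>k\<ge>1. x \<in> filt L k) \<longrightarrow> x = vzero L) \<and>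
     (\<forall>x. (\<forall>k\<ge>1. x k \<in> vcarrier L \<and> vdiff L (x (Suc k)) (x k) \<in> filt L k) \<longrightarrow>
        (\<exists>y\<in>vcarrier L. \<forall>k\<ge>1. vdiff L y (x k) \<in> filt L k))"

lemma complete_filtered_lie_algebraI:
  fixes L :: "('k::field, 'x, 'e) filtered_alg_scheme"
  assumes L: "filtered_lie_algebra L" and C: "cauchy_complete L"
  shows "complete_filtered_lie_algebra L"
proof -
  have A: "algebra_on L" using L unfolding filtered_lie_algebra_def lie_algebra_def by simp
  interpret carrier_vector_space L using A by (rule algebra_on_vs)
  have sub: "vsubspace L (filt L k)" if "k \<ge> 1" for k
    using L that unfolding filtered_lie_algebra_def by simp
  have dec: "filt L (Suc k) \<subseteq> filt L k" if "k \<ge> 1" for k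
    using L that unfolding filtered_lie_algebra_def by simp
  let ?c = "\<lambda>x. \<lambda>k\<in>{1..}. coset L (filt L k) x"
  let ?\<pi> = "\<lambda>k C. \<Union>x\<in>C. coset L (filt L k) x"
  let ?C = "\<lambda>k. coset L (filt L k) ` vcarrier L"
  have \<pi>: "?\<pi> k (coset L (filt L (Suc k)) x) = coset L (filt L k) x"
    if "k \<ge> 1" "x \<in> vcarrier L" for k x
    by (rule UN_coset) (use that sub[of k] sub[of "Suc k"] dec[of k] in \<open>auto simp: coset_eq_iff\<close>)
  have "inj_on ?c (vcarrier L)"
  proof (rule inj_onI)
    fix x y assume x: "x \<in> vcarrier L" and y: "y \<in> vcarrier L" and e: "?c x = ?c y"
    have "vdiff L x y \<in> filt L k" if "k \<ge> 1" for k
      using fun_cong[OF e, of k] that x y by (simp add: coset_eq_iff[OF sub])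
    then have "vdiff L x y = vzero L" using C x y unfolding cauchy_complete_def by simp
    then show "x = y" using x y by (simp add: vdiff_eq_zero)
  qed
  moreover have "?c ` vcarrier L = lim_carrier ?C ?\<pi>"
  proof
    show "?c ` vcarrier L \<subseteq> lim_carrier ?C ?\<pi>"
    proof (rule image_subsetI)
      fix x assume x: "x \<in> vcarrier L"
      show "?c x \<in> lim_carrier ?C ?\<pi>"
        unfolding lim_carrier_def using \<pi>[OF _ x] x by simp
    qed
    show "lim_carrier ?C ?\<pi> \<subseteq> ?c ` vcarrier L"
    proof
      fix z assume "z \<in> lim_carrier ?C ?\<pi>"
      then have zP: "z \<in> PiE {1..} ?C" and z\<pi>: "\<And>k. k \<ge> 1 \<Longrightarrow> ?\<pi> k (z (Suc k)) = z k"
        unfolding lim_carrier_def by auto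
      have "\<forall>k. \<exists>a. k \<ge> 1 \<longrightarrow> a \<in> vcarrier L \<and> z k = coset L (filt L k) a"
        using zP by (auto simp: PiE_iff image_iff)
      then obtain x where x: "\<And>k. k \<ge> 1 \<Longrightarrow> x k \<in> vcarrier L"
        and zx: "\<And>k. k \<ge> 1 \<Longrightarrow> z k = coset L (filt L k) (x k)" by metis
      have "vdiff L (x (Suc k)) (x k) \<in> filt L k" if k: "k \<ge> 1" for k
      proof -
        have "coset L (filt L k) (x (Suc k)) = coset L (filt L k) (x k)"
          using z\<pi>[OF k] zx[OF k] zx[of "Suc k"] \<pi>[OF k] x[of "Suc k"] by simp
        then show ?thesis using x[OF k] x[of "Suc k"] sub[OF k] by (simp add: coset_eq_iff)
      qed
      then obtain y where y: "y \<in> vcarrier L" "\<And>k. k \<ge> 1 \<Longrightarrow> vdiff L y (x k) \<in> filt L k"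
        using C x unfolding cauchy_complete_def by blast
      have "z = ?c y"
      proof
        fix k show "z k = ?c y k"
        proof (cases "k \<ge> 1")
          case True
          then have "coset L (filt L k) y = coset L (filt L k) (x k)"
            using y x by (simp add: coset_eq_iff[OF sub])
          then show ?thesis using zx True by simp
        next
          case False
          then show ?thesis using zP by (auto simp: PiE_def extensional_def)
        qed
      qed
      then show "z \<in> ?c ` vcarrier L" using y by blast
    qed
  qed
  ultimately show ?thesis
    using L unfolding complete_filtered_lie_algebra_def bij_betw_def by simp
qed

lemma alg_iso_epi:
  fixes X :: "('k::field, 'x, 'e) alg_scheme" and Y :: "('k, 'y, 'f) alg_scheme"
  assumes X: "algebra_on X" and f: "alg_iso X Y f" and z: "f (vzero X) = vzero Y"
  shows "alg_epi X Y f"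
  using f z unfolding alg_iso_def alg_epi_def bij_betw_def by simp

text \<open>By transport, only one of the three filtered Lie algebras has to be examined; the other two are
  given by quotients of quotients and by sequences of functionals.\<close>

lemma complete_filtered_lie_transport:
  fixes L :: "('k::field, 'x, 'e) filtered_alg_scheme"
    and L' :: "('k, 'y, 'f) filtered_alg_scheme"
  assumes L: "filtered_lie_algebra L" and C: "cauchy_complete L"
    and f: "alg_iso L L' f" and z: "f (vzero L) = vzero L'"
    and filt: "\<And>k. k \<ge> 1 \<Longrightarrow> f ` filt L k = filt L' k"
  shows "complete_filtered_lie_algebra L'"
proof -
  have lie: "lie_algebra L" using L unfolding filtered_lie_algebra_def by simp
  then have A: "algebra_on L" unfolding lie_algebra_def by simp
  interpret carrier_vector_space L using A by (rule algebra_on_vs)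
  have e: "alg_epi L L' f" by (rule alg_iso_epi[OF A f z])
  have inj: "inj_on f (vcarrier L)" and sur: "vcarrier L' = f ` vcarrier L"
    using f unfolding alg_iso_def bij_betw_def by auto
  have sub: "vsubspace L (filt L k)" "filt L (Suc k) \<subseteq> filt L k" if "k \<ge> 1" for k
    using L that unfolding filtered_lie_algebra_def by auto
  have subc: "filt L k \<subseteq> vcarrier L" if "k \<ge> 1" for k
    using sub(1)[OF that] unfolding vsubspace_def by simp
  have ops: "vzero L' = f (vzero L)"
    "\<And>x y. x \<in> vcarrier L \<Longrightarrow> y \<in> vcarrier L \<Longrightarrow> vadd L' (f x) (f y) = f (vadd L x y)"
    "\<And>c x. x \<in> vcarrier L \<Longrightarrow> vsmult L' c (f x) = f (vsmult L c x)"
    "\<And>x y. x \<in> vcarrier L \<Longrightarrow> y \<in> vcarrier L \<Longrightarrow> aprod L' (f x) (f y) = f (aprod L x y)"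
    using e unfolding alg_epi_def by simp_all
  have mem: "f x \<in> filt L' k \<longleftrightarrow> x \<in> filt L k" if "k \<ge> 1" "x \<in> vcarrier L" for x k
    using filt[OF that(1)] subc[OF that(1)] inj that(2) by (metis inj_on_image_mem_iff)
  have diff: "vdiff L' (f x) (f y) = f (vdiff L x y)" if "x \<in> vcarrier L" "y \<in> vcarrier L" for x y
    using alg_epi_vdiff[OF A e that] by simp
  have "filtered_lie_algebra L'"
    unfolding filtered_lie_algebra_def
  proof (intro conjI allI impI)
    show "lie_algebra L'" by (rule lie_algebra_epi[OF lie e])
    show "filt L' 1 = vcarrier L'"
      using filt[of 1] L sur unfolding filtered_lie_algebra_def by simp
    fix k :: nat assume k: "1 \<le> k"
    show "vsubspace L' (filt L' k)"
      unfolding vsubspace_def filt[OF k, symmetric] sur ball_simps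
      using sub(1)[OF k] unfolding vsubspace_def by (auto simp: ops subset_eq)
    show "filt L' (Suc k) \<subseteq> filt L' k"
      using image_mono[OF sub(2)[OF k], of f] filt[OF k] filt[of "Suc k"] by simp
  next
    fix j k :: nat assume j: "1 \<le> j" and k: "1 \<le> k"
    then have jk: "1 \<le> j + k" by simp
    show "\<forall>x\<in>filt L' j. \<forall>y\<in>filt L' k. aprod L' x y \<in> filt L' (j + k)"
      unfolding filt[OF k, symmetric] filt[OF j, symmetric] filt[OF jk, symmetric] ball_simps
      using L j k subc[OF j] subc[OF k] unfolding filtered_lie_algebra_def
      by (auto simp: ops subset_eq)
  qed
  moreover have "cauchy_complete L'"
    unfolding cauchy_complete_def
  proof (intro conjI allI ballI impI)
    fix x assume "x \<in> vcarrier L'" "\<forall>k\<ge>1. x \<in> filt L' k"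
    then show "x = vzero L'"
      using C sur mem unfolding cauchy_complete_def ops(1) by auto
  next
    fix x assume x: "\<forall>k\<ge>1. x k \<in> vcarrier L' \<and> vdiff L' (x (Suc k)) (x k) \<in> filt L' k"
    then have "\<forall>k. \<exists>a. k \<ge> 1 \<longrightarrow> a \<in> vcarrier L \<and> x k = f a" unfolding sur by blast
    then obtain a where a: "\<And>k. k \<ge> 1 \<Longrightarrow> a k \<in> vcarrier L" "\<And>k. k \<ge> 1 \<Longrightarrow> x k = f (a k)"
      by metis
    have "vdiff L (a (Suc k)) (a k) \<in> filt L k" if "k \<ge> 1" for k
    proof -
      have k: "a k \<in> vcarrier L" "a (Suc k) \<in> vcarrier L" using a that by auto
      have "f (vdiff L (a (Suc k)) (a k)) \<in> filt L' k"
        using x that a k by (simp flip: diff)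
      then show ?thesis using mem[OF that vdiff_closed[OF k(2,1)]] by simp
    qed
    then obtain y where y: "y \<in> vcarrier L" "\<And>k. k \<ge> 1 \<Longrightarrow> vdiff L y (a k) \<in> filt L k"
      using C a unfolding cauchy_complete_def by blast
    show "\<exists>y\<in>vcarrier L'. \<forall>k\<ge>1. vdiff L' y (x k) \<in> filt L' k"
      by (rule bexI[of _ "f y"]) (use y a sur in \<open>auto simp: diff mem\<close>)
  qed
  ultimately show ?thesis by (rule complete_filtered_lie_algebraI)
qed

lemma alg_iso_via:
  fixes L :: "('k::field, 'x, 'e) alg_scheme" and X :: "('k, 'y, 'f) alg_scheme"
    and Y :: "('k, 'z, 'g) alg_scheme"
  assumes A: "algebra_on L" and g: "alg_iso L X g" and h: "alg_iso L Y h"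
  shows "alg_iso X Y (\<lambda>x. h (inv_into (vcarrier L) g x))"
proof -
  have ig: "inj_on g (vcarrier L)" and X: "vcarrier X = g ` vcarrier L"
    using g unfolding alg_iso_def bij_betw_def by auto
  interpret carrier_vector_space L using A by (rule algebra_on_vs)
  have cl: "aprod L x y \<in> vcarrier L" if "x \<in> vcarrier L" "y \<in> vcarrier L" for x y
    using A that unfolding algebra_on_def by simp
  have ops: 
    "\<And>x y. x \<in> vcarrier L \<Longrightarrow> y \<in> vcarrier L \<Longrightarrow> vadd X (g x) (g y) = g (vadd L x y)"
    "\<And>c x. x \<in> vcarrier L \<Longrightarrow> vsmult X c (g x) = g (vsmult L c x)"
    "\<And>x y. x \<in> vcarrier L \<Longrightarrow> y \<in> vcarrier L \<Longrightarrow> aprod X (g x) (g y) = g (aprod L x y)"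
    using g unfolding alg_iso_def by simp_all
  have "bij_betw (\<lambda>x. h (inv_into (vcarrier L) g x)) (vcarrier X) (vcarrier Y)"
    using bij_betw_trans[OF bij_betw_inv_into[of g "vcarrier L" "vcarrier X"],
        of h "vcarrier Y"] g h
    unfolding alg_iso_def by (simp add: comp_def)
  then show ?thesis
    using h unfolding alg_iso_def X ball_simps by (simp add: ops inv_into_f_f[OF ig] cl)
qed

section \<open>Linear extension from a basis\<close>

abbreviation keys :: "('b \<Rightarrow>\<^sub>0 'k::zero) \<Rightarrow> 'b set" where
  "keys \<equiv> Poly_Mapping.keys"

abbreviation lookup :: "('b \<Rightarrow>\<^sub>0 'k::zero) \<Rightarrow> 'b \<Rightarrow> 'k" where
  "lookup \<equiv> Poly_Mapping.lookup"

abbreviation single :: "'b \<Rightarrow> 'k \<Rightarrow> ('b \<Rightarrow>\<^sub>0 'k::zero)" where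
  "single \<equiv> Poly_Mapping.single"

text \<open>A constant for the scalar action keeps rewriting away from the abstraction inside
  \<^const>\<open>Poly_Mapping.map\<close>.\<close>

definition pscale :: "'k::field \<Rightarrow> ('b \<Rightarrow>\<^sub>0 'k) \<Rightarrow> 'b \<Rightarrow>\<^sub>0 'k" where
  "pscale c = Poly_Mapping.map (\<lambda>x. c * x)"

lemma lookup_pscale [simp]: "lookup (pscale c p) t = c * lookup p t"
  unfolding pscale_def by transfer (simp add: when_def)

lemma keys_pscale: "keys (pscale c p) \<subseteq> keys p"
  by (auto simp: in_keys_iff)

lemma vector_space_pscale: "vector_space (pscale :: 'k::field \<Rightarrow> _)"
  by unfold_locales (rule poly_mapping_eqI, simp add: lookup_add algebra_simps)+

lemma vector_space_times: "vector_space ((*) :: 'k::field \<Rightarrow> _)"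
  by unfold_locales (simp_all add: algebra_simps)

lemma pscale_single [simp]: "pscale c (single t a) = single t (c * a)"
  by (rule poly_mapping_eqI) (simp add: lookup_single when_def)

text \<open>Targets of linear extensions. The scalings of interest are those of the model, of the given
  algebra, of the scalars themselves, and of spaces of finitely supported functions.\<close>

locale free_extension = vector_space scale
  for scale :: "'a::field \<Rightarrow> 'b::ab_group_add \<Rightarrow> 'b" (infixr \<open>*s\<close> 75)
begin

definition lin_ext :: "('w \<Rightarrow> 'b) \<Rightarrow> ('w \<Rightarrow>\<^sub>0 'a) \<Rightarrow> 'b" where
  "lin_ext h p = (\<Sum>t\<in>keys p. lookup p t *s h t)"

lemma lin_ext_superset:
  fixes p :: "'w \<Rightarrow>\<^sub>0 'a"
  assumes "finite S" "keys p \<subseteq> S"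
  shows "lin_ext h p = (\<Sum>t\<in>S. lookup p t *s h t)"
  unfolding lin_ext_def using assms by (intro sum.mono_neutral_left) (auto simp: in_keys_iff)

lemma lin_ext_zero [simp]: "lin_ext h 0 = 0"
  by (simp add: lin_ext_def)

lemma lin_ext_single [simp]: "lin_ext h (single t c) = c *s h t"
  by (simp add: lin_ext_def)

lemma lin_ext_add: "lin_ext h (p + q) = lin_ext h p + lin_ext h q"
proof -
  let ?S = "keys p \<union> keys q"
  have "keys (p + q) \<subseteq> ?S" by (rule keys_add)
  then show ?thesis
    by (subst (1 2 3) lin_ext_superset[of ?S])
       (auto simp: lookup_add scale_left_distrib sum.distrib)
qed

lemma lin_ext_pscale: "lin_ext h (pscale c p) = c *s lin_ext h p"
  by (subst lin_ext_superset[OF finite_keys keys_pscale]) (simp add: lin_ext_def scale_sum_right)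

lemma lin_ext_uminus: "lin_ext h (- p) = - lin_ext h p"
  by (metis add.left_inverse add_eq_0_iff2 lin_ext_add lin_ext_zero)

lemma lin_ext_diff: "lin_ext h (p - q) = lin_ext h p - lin_ext h q"
  using lin_ext_add[of h p "- q"] by (simp add: lin_ext_uminus)

lemma lin_ext_sum: "lin_ext h (sum p I) = (\<Sum>i\<in>I. lin_ext h (p i))"
  by (induction I rule: infinite_finite_induct) (simp_all add: lin_ext_add)

lemma lin_ext_cong: "(\<And>t. t \<in> keys p \<Longrightarrow> h t = h' t) \<Longrightarrow> lin_ext h p = lin_ext h' p"
  unfolding lin_ext_def by (intro sum.cong) auto

lemma lin_ext_fun_add: "lin_ext (\<lambda>t. h t + h' t) p = lin_ext h p + lin_ext h' p"
  unfolding lin_ext_def by (simp add: scale_right_distrib sum.distrib)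

lemma lin_ext_fun_scale: "lin_ext (\<lambda>t. c *s h t) p = c *s lin_ext h p"
  unfolding lin_ext_def by (simp add: scale_sum_right mult.commute)

lemma lin_ext_fun_zero [simp]: "lin_ext (\<lambda>t. 0) p = 0"
  unfolding lin_ext_def by simp

lemma lin_ext_mem:
  assumes "subspace S" "\<And>t. t \<in> keys p \<Longrightarrow> h t \<in> S"
  shows "lin_ext h p \<in> S"
  unfolding lin_ext_def using assms by (intro subspace_sum subspace_scale) auto

end

lemma free_extension_pscale: "free_extension (pscale :: 'k::field \<Rightarrow> _)"
  by (intro free_extension.intro vector_space_pscale)

lemma free_extension_times: "free_extension ((*) :: 'k::field \<Rightarrow> _)"
  by (intro free_extension.intro vector_space_times)

section \<open>Algebras spanned by a magma\<close>

definition mprod :: "('b \<Rightarrow> 'b \<Rightarrow> 'b) \<Rightarrow> ('b \<Rightarrow>\<^sub>0 'k) \<Rightarrow> ('b \<Rightarrow>\<^sub>0 'k) \<Rightarrow> ('b \<Rightarrow>\<^sub>0 'k::field)" where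
  "mprod m p q = (\<Sum>s\<in>keys p. \<Sum>t\<in>keys q.
     single (m s t) (lookup p s * lookup q t))"

lemma magma_algebra_simps [simp]:
  "vcarrier (magma_algebra S m) = {p. keys p \<subseteq> S}"
  "vadd (magma_algebra S m) = (+)" "vzero (magma_algebra S m) = 0"
  "vsmult (magma_algebra S m) = pscale" "aprod (magma_algebra S m) = mprod m"
  unfolding magma_algebra_def mprod_def pscale_def by (simp_all add: fun_eq_iff)

lemma mprod_single [simp]:
  "mprod m (single s a) (single t b) = single (m s t) (a * b)"
  by (simp add: mprod_def)

lemma keys_sum_subset:
  assumes "\<And>i. i \<in> I \<Longrightarrow> keys (p i) \<subseteq> S"
  shows "keys (sum p I) \<subseteq> S"
  using assms
proof (induction I rule: infinite_finite_induct)
  case (insert x F)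
  then show ?case using keys_add[of "p x" "sum p F"] by simp blast
qed simp_all

lemma keys_mprod: "keys (mprod m p q) \<subseteq> {m s t |s t. s \<in> keys p \<and> t \<in> keys q}"
  unfolding mprod_def by (intro keys_sum_subset) auto

context free_extension
begin

text \<open>Evaluating a linear extension on a product is iterated linear extension. All multiplicative
  properties of maps out of the free algebras below come from this formula.\<close>

lemma lin_ext_mprod: "lin_ext h (mprod m p q) = lin_ext (\<lambda>s. lin_ext (\<lambda>t. h (m s t)) q) p"
  unfolding mprod_def lin_ext_sum lin_ext_single
  unfolding lin_ext_def by (simp add: scale_sum_right)

end

text \<open>Bilinearity is immediate once the product is seen as an iterated linear extension.\<close>

lemma mprod_eq_lin_ext:
  fixes p q :: "'b \<Rightarrow>\<^sub>0 'a::field"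
  shows
  "mprod m p q = free_extension.lin_ext pscale
     (\<lambda>s. free_extension.lin_ext pscale (\<lambda>t. single (m s t) 1) q) p"
proof -
  interpret P: free_extension "pscale :: 'a \<Rightarrow> ('b \<Rightarrow>\<^sub>0 'a) \<Rightarrow> _" by (rule free_extension_pscale)
  show ?thesis unfolding mprod_def P.lin_ext_def by (simp add: P.scale_sum_right)
qed

lemma mprod_linear:
  fixes p q :: "'b \<Rightarrow>\<^sub>0 'a::field"
  shows
  "mprod m (p + p') q = mprod m p q + mprod m p' q"
  "mprod m p (q + q') = mprod m p q + mprod m p q'"
  "mprod m (pscale c p) q = pscale c (mprod m p q)"
  "mprod m p (pscale c q) = pscale c (mprod m p q)"
proof -
  interpret P: free_extension "pscale :: 'a \<Rightarrow> ('b \<Rightarrow>\<^sub>0 'a) \<Rightarrow> _" by (rule free_extension_pscale)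
  show "mprod m (p + p') q = mprod m p q + mprod m p' q"
    "mprod m p (q + q') = mprod m p q + mprod m p q'"
    "mprod m (pscale c p) q = pscale c (mprod m p q)"
    "mprod m p (pscale c q) = pscale c (mprod m p q)"
    unfolding mprod_eq_lin_ext
    by (simp_all add: P.lin_ext_add P.lin_ext_pscale P.lin_ext_fun_add P.lin_ext_fun_scale)
qed

lemma keys_diff: "keys (p - q) \<subseteq> keys p \<union> keys q"
  for p :: "'b \<Rightarrow>\<^sub>0 'k::field"
  using keys_add[of p "- q"] by simp

lemma algebra_on_magma_algebra:
  assumes "\<And>s t. s \<in> S \<Longrightarrow> t \<in> S \<Longrightarrow> m s t \<in> S"
  shows "algebra_on (magma_algebra S m :: ('k::field, _) alg)"
proof -
  interpret P: free_extension "pscale :: 'k \<Rightarrow> ('a \<Rightarrow>\<^sub>0 'k) \<Rightarrow> _" by (rule free_extension_pscale)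
  have add: "keys (p + q) \<subseteq> S"
    if "keys p \<subseteq> S" "keys q \<subseteq> S" for p q :: "'a \<Rightarrow>\<^sub>0 'k"
    using that keys_add[of p q] by blast
  have sc: "keys (pscale c p) \<subseteq> S"
    if "keys p \<subseteq> S" for p and c :: 'k
    using that keys_pscale[of c p] by blast
  have pr: "keys (mprod m p q) \<subseteq> S"
    if "keys p \<subseteq> S" "keys q \<subseteq> S" for p q :: "'a \<Rightarrow>\<^sub>0 'k"
    using that keys_mprod[of m p q] assms by blast
  have inv: "\<exists>q. keys q \<subseteq> S \<and> p + q = 0" if "keys p \<subseteq> S"
    for p :: "'a \<Rightarrow>\<^sub>0 'k"
    using that by (intro exI[of _ "- p"]) simp
  show ?thesis
    unfolding algebra_on_def vector_space_on_def
    by (simp add: add sc pr inv mprod_linear P.scale_right_distrib P.scale_left_distrib algebra_simps)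
qed

lemma vdiff_magma_algebra [simp]: "vdiff (magma_algebra S m) p q = p - q"
proof -
  have "pscale (- 1) q = - q" for q :: "'a \<Rightarrow>\<^sub>0 'b" by (rule poly_mapping_eqI) simp
  then show ?thesis unfolding vdiff_def by simp
qed

lemma sum_singles:
  "(\<Sum>t\<in>keys p. single t (lookup p t)) = p"
  by (rule poly_mapping_eqI) (auto simp: lookup_sum lookup_single when_def in_keys_iff sum.delta)

lemma mprod_unit:
  assumes "\<And>t. m e t = t"
  shows "mprod m (single e 1) q = q"
proof -
  have "mprod m (single e 1) q =
      (\<Sum>t\<in>keys q. single t (lookup q t))"
    unfolding mprod_def by (simp add: assms)
  then show ?thesis by (simp only: sum_singles)
qed

lemma poly_mapping_carrier_induct [consumes 1, case_names zero single add]: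
  fixes p :: "'b \<Rightarrow>\<^sub>0 'k::field"
  assumes p: "keys p \<subseteq> S"
    and 0: "Q 0" and 1: "\<And>t c. t \<in> S \<Longrightarrow> Q (single t c)"
    and 2: "\<And>p q. keys p \<subseteq> S \<Longrightarrow> keys q \<subseteq> S \<Longrightarrow> Q p \<Longrightarrow> Q q \<Longrightarrow> Q (p + q)"
  shows "Q p"
proof -
  let ?s = "\<lambda>T. \<Sum>t\<in>T. single t (lookup p t)"
  have "Q (?s T)" if "finite T" "T \<subseteq> S" for T
    using that
  proof (induction T rule: finite_induct)
    case (insert t T)
    have "keys (?s T) \<subseteq> S"
      by (rule keys_sum_subset) (use insert.prems in auto)
    then have "Q (single t (lookup p t) + ?s T)"
      by (intro 2 1) (use insert in auto)
    then show ?case using insert by simp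
  qed (simp add: 0)
  from this[OF finite_keys p] show ?thesis by (simp only: sum_singles)
qed

section \<open>Linear algebra\<close>

text \<open>A basis of the subspace remains independent when the point is added to it.\<close>

lemma (in free_extension) separating_functional:
  assumes S: "subspace S" and x: "x \<notin> S"
  shows "\<exists>f. (\<forall>u v. f (u + v) = f u + f v) \<and> (\<forall>c u. f (c *s u) = c * f u) \<and>
    (\<forall>u\<in>S. f u = 0) \<and> f x = 1"
proof -
  interpret K: vector_space "(*) :: 'a \<Rightarrow> 'a \<Rightarrow> 'a" by (rule vector_space_times)
  interpret VK: vector_space_pair scale "(*) :: 'a \<Rightarrow> 'a \<Rightarrow> 'a" ..
  obtain B where B: "B \<subseteq> S" "independent B" "S \<subseteq> span B"
    using maximal_independent_subset by blast
  have sB: "span B = S" using B S by (simp add: span_subspace)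
  then have "independent (insert x B)" using x B by (simp add: independent_insert)
  from VK.linear_independent_extend[OF this, of "\<lambda>b. if b = x then 1 else 0"]
  obtain f where f: "Vector_Spaces.linear scale (*) f"
    and fB: "\<forall>b\<in>insert x B. f b = (if b = x then 1 else 0)" by blast
  interpret f: Vector_Spaces.linear scale "(*)" f by (rule f)
  have "f u = 0" if "u \<in> S" for u
  proof -
    have "f u = 0" if "u \<in> span B" for u
      using that
    proof (induction rule: span_induct_alt)
      case (step c a y)
      have "a \<noteq> x" using step x sB span_superset by blast
      then show ?case using step fB by (simp add: f.add f.scale)
    qed (simp add: f.zero)
    then show ?thesis using that sB by simp
  qed
  then show ?thesis using fB f.add f.scale by (intro exI[of _ f]) simp
qed

text \<open>A substitute for a basis and its dual basis, with dual vectors chosen among the given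
  functionals; finite dimension is a consequence. A functional which does not vanish on the
  subspace takes the value 1 at some \<open>e0\<close>. The induction hypothesis applies to its kernel, and
  subtracting the part of \<open>e0\<close> seen by the other functionals gives the new vector.\<close>

lemma (in free_extension) frame_exists:
  assumes "finite I" and "subspace S"
    and "\<And>i u v. i \<in> I \<Longrightarrow> u \<in> S \<Longrightarrow> v \<in> S \<Longrightarrow> G i (u + v) = G i u + G i v"
    and "\<And>i c u. i \<in> I \<Longrightarrow> u \<in> S \<Longrightarrow> G i (c *s u) = c * G i u"
    and "\<And>u. u \<in> S \<Longrightarrow> (\<And>i. i \<in> I \<Longrightarrow> G i u = 0) \<Longrightarrow> u = 0"
  shows "\<exists>N e g. (\<forall>k<N. e k \<in> S \<and> g k \<in> I) \<and>
    (\<forall>u\<in>S. u = (\<Sum>k<N::nat. G (g k) u *s e k))"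
  using assms
proof (induction I arbitrary: S rule: finite_induct)
  case empty
  then show ?case by (intro exI[of _ 0]) auto
next
  case (insert i I)
  show ?case
  proof (cases "\<forall>u\<in>S. G i u = 0")
    case True
    have "\<exists>N e g. (\<forall>k<N. e k \<in> S \<and> g k \<in> I) \<and> (\<forall>u\<in>S. u = (\<Sum>k<N::nat. G (g k) u *s e k))"
    proof (rule insert.IH)
      fix u assume u: "u \<in> S" "\<And>j. j \<in> I \<Longrightarrow> G j u = 0"
      then have "G j u = 0" if "j \<in> insert i I" for j using that True by blast
      then show "u = 0" using insert.prems(4) u(1) by blast
    qed (use insert.prems in auto)
    then show ?thesis by blast
  next
    case False
    then obtain a where a: "a \<in> S" "G i a \<noteq> 0" by blast
    define e0 where "e0 = (1 / G i a) *s a"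
    have e0: "e0 \<in> S" "G i e0 = 1"
      using a insert.prems(1,3) unfolding e0_def by (auto simp: subspace_scale)
    let ?S = "{u \<in> S. G i u = 0}"
    have G0: "G j 0 = 0" if "j \<in> insert i I" for j
      using insert.prems(3)[OF that, of 0 0] insert.prems(1) by (simp add: subspace_0)
    have "subspace ?S"
      unfolding subspace_def using insert.prems(1-3) G0
      by (auto simp: subspace_0 subspace_add subspace_scale)
    then have "\<exists>N e g. (\<forall>k<N. e k \<in> ?S \<and> g k \<in> I) \<and>
        (\<forall>u\<in>?S. u = (\<Sum>k<N::nat. G (g k) u *s e k))"
    proof (rule insert.IH)
      fix u assume u: "u \<in> ?S" "\<And>j. j \<in> I \<Longrightarrow> G j u = 0"
      then have "G j u = 0" if "j \<in> insert i I" for j using that by blast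
      then show "u = 0" using insert.prems(4) u(1) by blast
    qed (use insert.prems in auto)
    then obtain N e g where eg: "\<And>k. k < N \<Longrightarrow> e k \<in> S \<and> g k \<in> I"
      and rep: "\<And>u. u \<in> S \<Longrightarrow> G i u = 0 \<Longrightarrow> u = (\<Sum>k<N::nat. G (g k) u *s e k)"
      by blast
    define e1 where "e1 = e0 - (\<Sum>k<N. G (g k) e0 *s e k)"
    have e1: "e1 \<in> S"
      unfolding e1_def using e0 eg insert.prems(1)
      by (intro subspace_diff subspace_sum subspace_scale) auto
    have "u = (\<Sum>k<Suc N. G ((g(N := i)) k) u *s (e(N := e1)) k)" if u: "u \<in> S" for u
    proof -
      define c where "c = G i u"
      let ?v = "u + (- c) *s e0"
      have ce: "(- c) *s e0 \<in> S" using e0 insert.prems(1) by (simp add: subspace_scale subspace_neg)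
      have v: "?v \<in> S" by (rule subspace_add[OF insert.prems(1) u ce])
      have Gv: "G j ?v = G j u - c * G j e0" if j: "j \<in> insert i I" for j
        using insert.prems(2)[OF j u ce] insert.prems(3)[OF j e0(1), of "- c"] by simp
      have "G i ?v = 0" using Gv[of i] e0 by (simp add: c_def)
      then have "?v = (\<Sum>k<N. G (g k) ?v *s e k)" by (rule rep[OF v])
      also have "\<dots> = (\<Sum>k<N. (G (g k) u - c * G (g k) e0) *s e k)"
        using eg Gv by (intro sum.cong) auto
      also have "\<dots> = (\<Sum>k<N. G (g k) u *s e k) - c *s (\<Sum>k<N. G (g k) e0 *s e k)"
        by (simp add: scale_left_diff_distrib sum_subtractf scale_sum_right)
      finally have "u = c *s e1 + (\<Sum>k<N. G (g k) u *s e k)"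
        unfolding e1_def by (simp add: scale_right_diff_distrib algebra_simps)
      then show ?thesis by (simp add: c_def add.commute)
    qed
    moreover have "\<forall>k<Suc N. (e(N := e1)) k \<in> S \<and> (g(N := i)) k \<in> insert i I"
      using eg e1 by (auto simp: less_Suc_eq)
    ultimately show ?thesis by blast
  qed
qed

section \<open>Contractions on the minimal model\<close>

text \<open>Collecting the summands by degree gives one decomposition of the sum; another one has the whole
  sum in degree \<open>n\<close> and zero elsewhere. By uniqueness they agree.\<close>

lemma internal_direct_sum_component:
  assumes G: "internal_direct_sum S G" and add: "\<And>m x y. x \<in> G m \<Longrightarrow> y \<in> G m \<Longrightarrow> x + y \<in> G m"
    and zero: "\<And>m. 0 \<in> G m"
    and T: "finite T" "\<And>t. t \<in> T \<Longrightarrow> y t \<in> G (deg t)"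
    and x: "(\<Sum>t\<in>T. y t) \<in> G n"
  shows "(\<Sum>t\<in>T. y t) = (\<Sum>t | t \<in> T \<and> deg t = n. y t)"
proof -
  let ?x = "\<Sum>t\<in>T. y t"
  define f where "f m = (\<Sum>t | t \<in> T \<and> deg t = m. y t)" for m
  have sum_mem: "sum y T' \<in> G m" if "finite T'" "\<And>t. t \<in> T' \<Longrightarrow> y t \<in> G m" for T' m
    using that by (induction T' rule: finite_induct) (auto simp: zero add)
  have f1: "f m \<in> G m" for m
    unfolding f_def by (rule sum_mem) (use T in auto)
  have supp: "{m. f m \<noteq> 0} \<subseteq> deg ` T"
  proof
    fix m assume "m \<in> {m. f m \<noteq> 0}"
    show "m \<in> deg ` T"
    proof (rule ccontr)
      assume "m \<notin> deg ` T"
      then have "{t. t \<in> T \<and> deg t = m} = {}" by auto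
      then have "f m = 0" unfolding f_def by (simp only: sum.empty)
      with \<open>m \<in> {m. f m \<noteq> 0}\<close> show False by simp
    qed
  qed
  have f2: "finite {m. f m \<noteq> 0}" using finite_subset[OF supp] T by simp
  have "(\<Sum>m | f m \<noteq> 0. f m) = (\<Sum>m\<in>deg ` T. f m)"
    by (rule sum.mono_neutral_left) (use supp T in auto)
  also have "\<dots> = ?x" unfolding f_def using T by (subst sum.group) auto
  finally have f3: "?x = (\<Sum>m | f m \<noteq> 0. f m)" by simp
  define g where "g m = (if m = n then ?x else 0)" for m
  have "{m. g m \<noteq> 0} \<subseteq> {n}" by (auto simp: g_def)
  then have g2: "finite {m. g m \<noteq> 0}" by (rule finite_subset) simp
  have "(\<Sum>m | g m \<noteq> 0. g m) = (\<Sum>m\<in>{n}. g m)"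
    by (rule sum.mono_neutral_left) (auto simp: g_def)
  then have g3: "?x = (\<Sum>m | g m \<noteq> 0. g m)" by (simp add: g_def)
  have g1: "g m \<in> G m" for m using x zero by (simp add: g_def)
  have "?x \<in> S" using G x unfolding internal_direct_sum_def by blast
  then have "\<exists>!f. (\<forall>n. f n \<in> G n) \<and> finite {n. f n \<noteq> 0} \<and> ?x = (\<Sum>n | f n \<noteq> 0. f n)"
    using G unfolding internal_direct_sum_def by blast
  then have "f = g" using f1 f2 f3 g1 g2 g3 by blast
  then have "f n = ?x" by (simp add: g_def)
  then show ?thesis unfolding f_def by simp
qed

sublocale canonical_one_minimal_model \<subseteq> M: free_extension sM
  by (intro free_extension.intro D1.vector_space_axioms)

sublocale canonical_one_minimal_model \<subseteq> A: free_extension sA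
  by (intro free_extension.intro D2.vector_space_axioms)

sublocale canonical_one_minimal_model \<subseteq> K: free_extension "(*) :: 'k \<Rightarrow> 'k \<Rightarrow> 'k"
  by (rule free_extension_times)

context canonical_one_minimal_model
begin

lemma GM_subspace: "D1.subspace (GM n)"
  by (rule D1.subspace_grade)

lemma V_subset: "V j \<subseteq> GM 1"
  using direct_sum_V unfolding internal_direct_sum_def by simp

abbreviation gens :: "nat \<Rightarrow> 'm set" where
  "gens i \<equiv> \<Union>j\<in>{1..i}. V j"

lemma V_subset_generators: "j \<in> {1..i} \<Longrightarrow> V j \<subseteq> generators_upto sM V i"
  unfolding generators_upto_def using D1.span_superset by fastforce

lemma generators_subset: "generators_upto sM V i \<subseteq> GM 1"
  unfolding generators_upto_def
  by (rule D1.span_minimal) (use V_subset GM_subspace in auto)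

lemma generators_mono: "i \<le> j \<Longrightarrow> generators_upto sM V i \<subseteq> generators_upto sM V j"
  unfolding generators_upto_def by (rule D1.span_mono, rule UN_mono) auto

lemma stage_mono: "i \<le> j \<Longrightarrow> stage sM V i \<subseteq> stage sM V j"
proof -
  assume "i \<le> j"
  then have "gens i \<subseteq> gens j" by (intro UN_mono) auto
  then show ?thesis unfolding stage_def by (intro D1.span_mono) blast
qed

lemma GM_1_generators:
  assumes "x \<in> GM 1"
  shows "\<exists>i\<ge>1. x \<in> generators_upto sM V i"
proof -
  obtain f where f: "\<forall>n. f n \<in> V n" "finite {n. f n \<noteq> 0}" "x = (\<Sum>n | f n \<noteq> 0. f n)"
    using direct_sum_V assms unfolding internal_direct_sum_def by blast
  define i where "i = Max (insert 1 {n. f n \<noteq> 0})"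
  have "f n \<in> generators_upto sM V i" if "f n \<noteq> 0" for n
  proof -
    have "n \<noteq> 0" using f(1) V_0 that by (metis singletonD)
    moreover have "n \<le> i" unfolding i_def using f(2) that by (intro Max_ge) auto
    ultimately show ?thesis using V_subset_generators[of n i] f(1) by auto
  qed
  then have "x \<in> generators_upto sM V i"
    unfolding f(3) generators_upto_def by (intro D1.span_sum) auto
  moreover have "i \<ge> 1" unfolding i_def using f(2) by (intro Max_ge) auto
  ultimately show ?thesis by blast
qed

text \<open>A relation between words involves finitely many letters, so it already lives over one stage.\<close>

lemma finite_words_generators:
  assumes "finite T" "T \<subseteq> lists (GM 1)"
  shows "\<exists>i\<ge>1. T \<subseteq> lists (generators_upto sM V i)"
proof -
  have *: "\<exists>i\<ge>1. F \<subseteq> generators_upto sM V i" if "finite F" "F \<subseteq> GM 1" for F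
    using that
  proof (induction F rule: finite_induct)
    case empty
    then show ?case by auto
  next
    case (insert a F)
    then obtain i j where "i \<ge> 1" "F \<subseteq> generators_upto sM V i" "j \<ge> 1" "a \<in> generators_upto sM V j"
      using GM_1_generators by (metis insert_subset)
    then have "insert a F \<subseteq> generators_upto sM V (max i j)"
      using generators_mono[of i "max i j"] generators_mono[of j "max i j"] by auto
    then show ?case using \<open>i \<ge> 1\<close> by (intro exI[of _ "max i j"]) auto
  qed
  have "finite (\<Union>(set ` T))" "\<Union>(set ` T) \<subseteq> GM 1" using assms by auto
  from *[OF this] show ?thesis by (auto simp: subset_eq)
qed

abbreviation ev :: "('m list \<Rightarrow>\<^sub>0 'k) \<Rightarrow> 'm" where
  "ev \<equiv> M.lin_ext prod_list"

lemma lin_ext_mult_left: "M.lin_ext (\<lambda>t. a * h t) p = a * M.lin_ext h p"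
  unfolding M.lin_ext_def by (simp add: sum_distrib_left D1.scale_mult_right)

lemma lin_ext_mult_right: "M.lin_ext (\<lambda>t. h t * a) p = M.lin_ext h p * a"
  unfolding M.lin_ext_def by (simp add: sum_distrib_right D1.scale_mult_left)

lemma ev_mprod: "ev (mprod (@) p q) = ev p * ev q"
  by (simp add: M.lin_ext_mprod lin_ext_mult_left lin_ext_mult_right)

lemma GM_square: "x \<in> GM 1 \<Longrightarrow> x * x = 0"
proof -
  assume x: "x \<in> GM 1"
  have "x * x = - (x * x)" using D1.graded_commute[OF x x] by simp
  then have "sM 2 (x * x) = 0"
    using D1.scale_left_distrib[of 1 1 "x * x"] by (simp add: eq_neg_iff_add_eq_0)
  then show "x * x = 0" by simp
qed

lemma GM_anticommute: "x \<in> GM 1 \<Longrightarrow> y \<in> GM 1 \<Longrightarrow> y * x = - (x * y)"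
  using D1.graded_commute[of x 1 y 1] by simp

lemma sub_alg_simps [simp]:
  "vcarrier (sub_alg sM S) = S" "vadd (sub_alg sM S) = (+)" "vzero (sub_alg sM S) = 0"
  "vsmult (sub_alg sM S) = sM" "aprod (sub_alg sM S) = (*)"
  unfolding sub_alg_def by simp_all

lemma algebra_free_assoc: "algebra_on (free_assoc W)"
  unfolding free_assoc_def by (rule algebra_on_magma_algebra) auto

lemma exterior_relators_subset:
  fixes S :: "'m set"
  assumes S: "D1.subspace S"
  shows "linear_relators (sub_alg sM S) (\<lambda>x. single [x] 1) \<union>
        {single [x, x] 1 | x. x \<in> S} \<subseteq> {p. keys p \<subseteq> lists S}"
proof -
  have 1: "keys (single [x] (1::'k)) \<subseteq> lists S" if "x \<in> S" for x
    using that by auto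
  have 2: "keys (p - q) \<subseteq> lists S"
    if "keys p \<subseteq> lists S" "keys q \<subseteq> lists S" for p q :: "'m list \<Rightarrow>\<^sub>0 'k"
    using keys_diff[of p q] that by blast
  have 3: "keys (pscale c p) \<subseteq> lists S"
    if "keys p \<subseteq> lists S" for p :: "'m list \<Rightarrow>\<^sub>0 'k" and c
    using keys_pscale[of c p] that by blast
  have 4: "x + y \<in> S" "sM c x \<in> S" if "x \<in> S" "y \<in> S" for x y c
    using S that by (auto simp: D1.subspace_add D1.subspace_scale)
  have "keys (single [x, x] (1::'k)) \<subseteq> lists S" if "x \<in> S" for x
    using that by auto
  moreover have "linear_relators (sub_alg sM S) (\<lambda>x. single [x] 1) \<subseteq>
      {p. keys p \<subseteq> lists S}"
  proof -
    have 5: "sM c x \<in> S" if "x \<in> S" for x c using 4(2)[OF that that] .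
    have "keys (single [x + y] (1::'k) - single [x] 1 -
        single [y] 1) \<subseteq> lists S" if "x \<in> S" "y \<in> S" for x y
      by (intro 2 1 4 that)
    moreover have "keys (single [sM c x] (1::'k) -
        pscale c (single [x] 1)) \<subseteq> lists S" if "x \<in> S" for x c
      by (intro 2 3 1 5 that)
    ultimately show ?thesis
      unfolding linear_relators_def pscale_def[symmetric] sub_alg_simps by blast
  qed
  ultimately show ?thesis by blast
qed

text \<open>The isomorphism with the exterior algebra is evaluation of words: both are multiplicative and
  agree on generators. Its injectivity gives the claim.\<close>

lemma ev_zero_exterior_ideal:
  assumes i: "i \<ge> 1" and p: "keys p \<subseteq> lists (generators_upto sM V i)" and ev: "ev p = 0"
  shows "p \<in> exterior_ideal (sub_alg sM (generators_upto sM V i))"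
proof -
  let ?U = "generators_upto sM V i"
  let ?W = "sub_alg sM ?U"
  let ?F = "free_assoc ?W :: ('k, 'm list \<Rightarrow>\<^sub>0 'k) alg"
  let ?I = "exterior_ideal ?W"
  let ?S = "sub_alg sM (stage sM V i)"
  have FW: "?F = magma_algebra (lists ?U) (@)" by (simp add: free_assoc_def)
  have U: "D1.subspace ?U" unfolding generators_upto_def by simp
  have F: "algebra_on ?F" by (rule algebra_free_assoc)
  interpret F: carrier_vector_space ?F using F by (rule algebra_on_vs)
  have I: "alg_ideal ?F ?I"
    unfolding exterior_ideal_def
    by (rule alg_ideal_ideal_gen[OF F])
      (use exterior_relators_subset[OF U] in \<open>simp add: FW\<close>)
  have Is: "vsubspace ?F ?I" using I unfolding alg_ideal_def by simp
  have c: "alg_epi ?F (exterior_algebra ?W) (coset ?F ?I)"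
    unfolding exterior_algebra_def by (rule alg_epi_coset[OF F I])
  obtain f where f: "alg_iso (exterior_algebra ?W) ?S f"
    and fx: "\<And>x. x \<in> ?U \<Longrightarrow> f (exterior_gen ?W x) = x"
    using stage_exterior[OF i] unfolding is_exterior_algebra_def by blast
  define h where "h p = f (coset ?F ?I p)" for p
  have E: "vcarrier (exterior_algebra ?W) = coset ?F ?I ` vcarrier ?F"
    using c unfolding alg_epi_def by simp
  have h_add: "h (p + q) = h p + h q" and h_mult: "h (mprod (@) p q) = h p * h q"
    if "p \<in> vcarrier ?F" "q \<in> vcarrier ?F" for p q
  proof -
    have "coset ?F ?I (p + q) = vadd (exterior_algebra ?W) (coset ?F ?I p) (coset ?F ?I q)"
      "coset ?F ?I (mprod (@) p q) = aprod (exterior_algebra ?W) (coset ?F ?I p) (coset ?F ?I q)"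
      using c that unfolding alg_epi_def by (simp_all add: FW)
    moreover have "coset ?F ?I p \<in> vcarrier (exterior_algebra ?W)"
      "coset ?F ?I q \<in> vcarrier (exterior_algebra ?W)" using that E by auto
    ultimately show "h (p + q) = h p + h q" "h (mprod (@) p q) = h p * h q"
      using f unfolding alg_iso_def h_def by simp_all
  qed
  have h_sc: "h (pscale a p) = sM a (h p)" if "p \<in> vcarrier ?F" for p a
  proof -
    have "coset ?F ?I (pscale a p) = vsmult (exterior_algebra ?W) a (coset ?F ?I p)"
      using c that unfolding alg_epi_def by (simp add: FW)
    moreover have "coset ?F ?I p \<in> vcarrier (exterior_algebra ?W)" using that E by auto
    ultimately show ?thesis using f unfolding alg_iso_def h_def by simp
  qed
  have h0: "h 0 = 0" using h_add[of 0 0] by (simp add: FW)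
  have img: "h ` vcarrier ?F = stage sM V i"
    using f unfolding alg_iso_def bij_betw_def E h_def by (simp add: image_image)
  have h_gen: "h (single [x] 1) = x" if "x \<in> ?U" for x
    using fx[OF that] unfolding h_def exterior_gen_def .
  \<comment> \<open>Unitality is no part of an isomorphism of algebras here; it follows from surjectivity.\<close>
  have one: "h (single [] 1) = 1"
  proof -
    have "1 \<in> stage sM V i"
      unfolding stage_def by (rule D1.span_base) (auto intro!: exI[of _ "[]"])
    then obtain q where q: "q \<in> vcarrier ?F" "h q = 1" unfolding img[symmetric] by (metis imageE)
    have "mprod (@) (single [] 1) q = q" by (rule mprod_unit) simp
    then show ?thesis using h_mult[of "single [] 1" q] q by (simp add: FW)
  qed
  have h_word: "h (single xs 1) = prod_list xs" if "xs \<in> lists ?U" for xs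
    using that
  proof (induction xs)
    case (Cons x xs)
    have "mprod (@) (single [x] 1) (single xs 1) = single (x # xs) (1::'k)"
      by simp
    then show ?case
      using h_mult[of "single [x] 1" "single xs 1"] Cons h_gen
      by (simp add: FW)
  qed (simp add: one)
  have "h p = ev p"
    using p
  proof (induction rule: poly_mapping_carrier_induct)
    case (single t a)
    have "h (pscale a (single t 1)) = sM a (h (single t 1))"
      by (rule h_sc) (use single in \<open>simp add: FW\<close>)
    then show ?case using h_word single by simp
  next
    case (add p q)
    then show ?case using h_add by (simp add: FW M.lin_ext_add)
  qed (simp add: h0)
  then have "f (coset ?F ?I p) = f (coset ?F ?I 0)" using h0 ev by (simp add: h_def)
  moreover have pc: "p \<in> vcarrier ?F" "0 \<in> vcarrier ?F" using p by (simp_all add: FW)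
  ultimately have "coset ?F ?I p = coset ?F ?I 0"
    using f unfolding alg_iso_def bij_betw_def E by (simp add: inj_on_def)
  then have "vdiff ?F p 0 \<in> ?I" using F.coset_eq_iff[OF Is pc] by simp
  then show ?thesis by (simp add: FW)
qed

text \<open>Contraction with \<open>u\<close> on the level of words: the antiderivation with value \<open>u x\<close> on a letter \<open>x\<close>.\<close>

primrec iota :: "('m \<Rightarrow> 'k) \<Rightarrow> 'm list \<Rightarrow> 'm" where
  "iota u [] = 0"
| "iota u (x # xs) = sM (u x) (prod_list xs) - x * iota u xs"

lemma iota_append:
  "iota u (xs @ ys) = iota u xs * prod_list ys + sM ((- 1) ^ length xs) (prod_list xs) * iota u ys"
  by (induction xs)
    (simp_all add: algebra_simps D1.scale_mult_left[symmetric] D1.scale_mult_right[symmetric] mult.assoc)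

definition functionals :: "('m \<Rightarrow> 'k) set" where
  "functionals = vcarrier (dual sM (GM 1))"

lemma functionals_iff:
  "u \<in> functionals \<longleftrightarrow> (\<forall>x\<in>GM 1. \<forall>y\<in>GM 1. u (x + y) = u x + u y) \<and>
     (\<forall>c. \<forall>x\<in>GM 1. u (sM c x) = c * u x) \<and> (\<forall>x. x \<notin> GM 1 \<longrightarrow> u x = 0)"
  unfolding functionals_def dual_def by simp

text \<open>The combinations of words on which contraction vanishes do not form an ideal. Those on which the
  value and the signed value vanish as well do, and this ideal contains the relators of the exterior
  algebra. Vanishing of the constant coefficient is carried along to define the augmentation.\<close>

lemma iota_well_defined:
  assumes u: "u \<in> functionals" and p: "keys p \<subseteq> lists (GM 1)" and ev: "ev p = 0"
  shows "M.lin_ext (iota u) p = 0 \<and> lookup p [] = 0"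
proof -
  obtain i where i: "i \<ge> 1" "keys p \<subseteq> lists (generators_upto sM V i)"
    using finite_words_generators[OF finite_keys p] by blast
  let ?U = "generators_upto sM V i"
  let ?W = "sub_alg sM ?U"
  let ?F = "free_assoc ?W :: ('k, 'm list \<Rightarrow>\<^sub>0 'k) alg"
  define sg where "sg xs = sM ((- 1) ^ length xs) (prod_list xs)" for xs
  define cst :: "'m list \<Rightarrow> 'k" where "cst xs = (if xs = [] then 1 else 0)" for xs
  have FW: "?F = magma_algebra (lists ?U) (@)" by (simp add: free_assoc_def)
  have F: "algebra_on ?F" by (rule algebra_free_assoc)
  have lookup: "lookup p [] = K.lin_ext cst p" for p :: "'m list \<Rightarrow>\<^sub>0 'k"
    unfolding K.lin_ext_def cst_def by (simp add: if_distrib sum.delta in_keys_iff cong: if_cong)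
  have sub: "D1.subspace ?U" unfolding generators_upto_def by simp
  \<comment> \<open>The signed value occurs because contraction of a product \<open>p q\<close> involves the value of \<open>p\<close> with
    the sign of its degree.\<close>
  define I where "I = {p. keys p \<subseteq> lists ?U \<and> ev p = 0 \<and> M.lin_ext sg p = 0 \<and>
    M.lin_ext (iota u) p = 0 \<and> K.lin_ext cst p = 0}"
  have "alg_ideal ?F I"
    unfolding alg_ideal_def
  proof (intro conjI ballI)
    have "keys (p + q) \<subseteq> lists ?U"
      if "keys p \<subseteq> lists ?U" "keys q \<subseteq> lists ?U" for p q :: "'m list \<Rightarrow>\<^sub>0 'k"
      using that keys_add[of p q] by blast
    moreover have "keys (pscale c p) \<subseteq> lists ?U"
      if "keys p \<subseteq> lists ?U" for p :: "'m list \<Rightarrow>\<^sub>0 'k" and c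
      using that keys_pscale[of c p] by blast
    ultimately show "vsubspace ?F I"
      unfolding vsubspace_def FW I_def
      by (auto simp: M.lin_ext_add K.lin_ext_add M.lin_ext_pscale K.lin_ext_pscale)
  next
    fix q p assume q: "q \<in> vcarrier ?F" and p: "p \<in> I"
    then have keys: "keys q \<subseteq> lists ?U" "keys p \<subseteq> lists ?U"
      by (auto simp: FW I_def)
    have pI: "ev p = 0" "M.lin_ext sg p = 0" "M.lin_ext (iota u) p = 0" "K.lin_ext cst p = 0"
      using p unfolding I_def by auto
    have "keys (mprod (@) q p) \<subseteq> lists ?U" "keys (mprod (@) p q) \<subseteq> lists ?U"
      using keys keys_mprod[of "(@)" q p] keys_mprod[of "(@)" p q] by force+
    moreover have "ev (mprod (@) q p) = 0" "ev (mprod (@) p q) = 0" using pI by (simp_all add: ev_mprod)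
    moreover have sg: "sg (xs @ ys) = sg xs * sg ys" for xs ys
      by (simp add: sg_def power_add D1.scale_mult_left[symmetric] D1.scale_mult_right[symmetric])
    have "M.lin_ext sg (mprod (@) q p) = 0" "M.lin_ext sg (mprod (@) p q) = 0"
      using pI by (simp_all only: M.lin_ext_mprod sg lin_ext_mult_left lin_ext_mult_right) simp_all
    moreover have "M.lin_ext (iota u) (mprod (@) q p) = 0" "M.lin_ext (iota u) (mprod (@) p q) = 0"
      using pI
      by (simp_all only: M.lin_ext_mprod iota_append sg_def[symmetric] M.lin_ext_fun_add lin_ext_mult_left lin_ext_mult_right)
         simp_all
    moreover have c: "K.lin_ext cst (mprod (@) p q) = K.lin_ext cst p * K.lin_ext cst q"
      for p q :: "'m list \<Rightarrow>\<^sub>0 'k"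
    proof -
      have "cst (xs @ ys) = cst xs * cst ys" for xs ys by (simp add: cst_def)
      then have "K.lin_ext cst (mprod (@) p q) = K.lin_ext (\<lambda>s. cst s * K.lin_ext cst q) p"
        by (simp only: K.lin_ext_mprod K.lin_ext_fun_scale)
      also have "\<dots> = K.lin_ext cst p * K.lin_ext cst q"
        unfolding K.lin_ext_def[of _ p] by (simp only: sum_distrib_right mult.assoc)
      finally show ?thesis .
    qed
    have "K.lin_ext cst (mprod (@) q p) = 0" "K.lin_ext cst (mprod (@) p q) = 0"
      using pI by (simp_all add: c)
    ultimately show "aprod ?F q p \<in> I" "aprod ?F p q \<in> I" by (simp_all add: FW I_def)
  qed
  moreover have "linear_relators ?W (\<lambda>x. single [x] 1) \<union>
        {single [x, x] 1 | x. x \<in> vcarrier ?W} \<subseteq> I"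
  proof -
    have u1: "u (x + y) = u x + u y" "u (sM c x) = c * u x" if "x \<in> ?U" "y \<in> ?U" for x y c
      using u subsetD[OF generators_subset that(1)] subsetD[OF generators_subset that(2)]
      unfolding functionals_iff by blast+
    have "x * x = 0" if "x \<in> ?U" for x using GM_square that generators_subset[of i] by auto
    then have "q \<in> I" if "q \<in> linear_relators ?W (\<lambda>x. single [x] 1) \<union>
        {single [x, x] 1 | x. x \<in> ?U}" for q
      unfolding I_def using subsetD[OF exterior_relators_subset[OF sub] that] that
      unfolding linear_relators_def sub_alg_simps pscale_def[symmetric]
      by (auto simp: M.lin_ext_diff K.lin_ext_diff u1 sg_def cst_def D1.scale_left_distrib D1.scale_right_distrib
          D1.scale_mult_right[symmetric])
    then show ?thesis by auto
  qed
  ultimately have "exterior_ideal ?W \<subseteq> I"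
    unfolding exterior_ideal_def by (rule ideal_gen_least)
  then have "p \<in> I" using ev_zero_exterior_ideal[OF i ev] by blast
  then show ?thesis unfolding I_def lookup by blast
qed

lemma span_prod_ev:
  assumes "x \<in> D1.span {prod_list vs | vs. P vs}"
  shows "\<exists>p. keys p \<subseteq> {vs. P vs} \<and> ev p = x"
  using assms
proof (induction rule: D1.span_induct_alt)
  case base
  then show ?case by (intro exI[of _ 0]) simp
next
  case (step c x y)
  then obtain vs q where vs: "x = prod_list vs" "P vs"
    and q: "keys q \<subseteq> {vs. P vs}" "ev q = y" by blast
  have "keys (single vs c + q) \<subseteq> {vs. P vs}"
    using keys_add[of "single vs c" q] vs q by (auto split: if_splits)
  then show ?case using vs q by (intro exI[of _ "single vs c + q"]) (simp add: M.lin_ext_add)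
qed

lemma gens_subset: "gens i \<subseteq> GM 1"
  using V_subset by blast

lemma ex_ev: "\<exists>p. keys p \<subseteq> lists (GM 1) \<and> ev p = x"
proof -
  obtain i where "x \<in> stage sM V i" using union_stages by blast
  then obtain p where "keys p \<subseteq> {vs. set vs \<subseteq> gens i}" "ev p = x"
    using span_prod_ev[of x "\<lambda>vs. set vs \<subseteq> gens i"] unfolding stage_def by blast
  moreover have "{vs. set vs \<subseteq> gens i} \<subseteq> lists (GM 1)"
    unfolding lists_eq_set using gens_subset by blast
  ultimately show ?thesis by blast
qed

lemma prod_list_grade: "set xs \<subseteq> GM 1 \<Longrightarrow> prod_list xs \<in> GM (length xs)"
proof (induction xs)
  case (Cons x xs)
  then show ?case using D1.mult_grade[of x 1 "prod_list xs" "length xs"] by simp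
qed (simp add: D1.one_grade)

text \<open>Words of another length contribute nothing, because the grading is direct.\<close>

lemma grade_ev:
  assumes p: "keys p \<subseteq> lists (GM 1)" and x: "ev p \<in> GM n"
  shows "\<exists>q. keys q \<subseteq> {xs \<in> keys p. length xs = n} \<and> ev q = ev p"
proof -
  let ?T = "{xs \<in> keys p. length xs = n}"
  define q where "q = (\<Sum>t\<in>?T. single t (lookup p t))"
  have "ev q = (\<Sum>t\<in>?T. sM (lookup p t) (prod_list t))"
    unfolding q_def by (simp add: M.lin_ext_sum)
  also have "\<dots> = ev p"
    unfolding M.lin_ext_def
  proof (rule internal_direct_sum_component[OF D1.direct_sum_grade, symmetric])
    show "sM (lookup p t) (prod_list t) \<in> GM (length t)"
      if "t \<in> keys p" for t
      using prod_list_grade[of t] p that GM_subspace by (auto intro!: D1.subspace_scale)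
  qed (use x GM_subspace in \<open>auto simp: D1.subspace_add D1.subspace_0 M.lin_ext_def\<close>)
  finally have "ev q = ev p" .
  moreover have "keys q \<subseteq> ?T"
    unfolding q_def by (rule keys_sum_subset) auto
  ultimately show ?thesis by blast
qed

lemma GM_ev:
  assumes "x \<in> GM n"
  shows "\<exists>p. keys p \<subseteq> {xs. set xs \<subseteq> GM 1 \<and> length xs = n} \<and> ev p = x"
proof -
  obtain p where p: "keys p \<subseteq> lists (GM 1)" "ev p = x" using ex_ev by blast
  have "ev p \<in> GM n" using p(2) assms by simp
  then obtain q where "keys q \<subseteq> {xs \<in> keys p. length xs = n}" "ev q = x"
    using grade_ev[OF p(1)] p(2) by blast
  moreover have "{xs \<in> keys p. length xs = n} \<subseteq> {xs. set xs \<subseteq> GM 1 \<and> length xs = n}"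
    using p(1) unfolding lists_eq_set by blast
  ultimately show ?thesis by blast
qed

lemma stage_GM_ev:
  assumes "x \<in> stage sM V i \<inter> GM n"
  shows "\<exists>p. keys p \<subseteq> {xs. set xs \<subseteq> gens i \<and> length xs = n} \<and> ev p = x"
proof -
  obtain p where p: "keys p \<subseteq> {xs. set xs \<subseteq> gens i}" "ev p = x"
    using assms span_prod_ev[of x "\<lambda>vs. set vs \<subseteq> gens i"] unfolding stage_def by blast
  have "keys p \<subseteq> lists (GM 1)"
    using p(1) gens_subset unfolding lists_eq_set by blast
  moreover have "ev p \<in> GM n" using p(2) assms by simp
  ultimately obtain q where "keys q \<subseteq> {xs \<in> keys p. length xs = n}" "ev q = x"
    using grade_ev p(2) by blast
  moreover have "{xs \<in> keys p. length xs = n} \<subseteq> {xs. set xs \<subseteq> gens i \<and> length xs = n}"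
    using p(1) by blast
  ultimately show ?thesis by blast
qed

lemma GM_induct [consumes 1, case_names zero word add]:
  assumes x: "x \<in> GM n" and 0: "Q 0"
    and 1: "\<And>c xs. set xs \<subseteq> GM 1 \<Longrightarrow> length xs = n \<Longrightarrow> Q (sM c (prod_list xs))"
    and 2: "\<And>x y. x \<in> GM n \<Longrightarrow> y \<in> GM n \<Longrightarrow> Q x \<Longrightarrow> Q y \<Longrightarrow> Q (x + y)"
  shows "Q x"
proof -
  obtain p where p: "keys p \<subseteq> {xs. set xs \<subseteq> GM 1 \<and> length xs = n}" "ev p = x"
    using GM_ev[OF x] by blast
  have ev: "ev q \<in> GM n" if "keys q \<subseteq> {xs. set xs \<subseteq> GM 1 \<and> length xs = n}" for q
    by (rule M.lin_ext_mem[OF GM_subspace]) (use that prod_list_grade in blast)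
  have "Q (ev p)"
    using p(1)
    by (induction rule: poly_mapping_carrier_induct) (simp_all add: 0 1 2 ev M.lin_ext_add)
  then show ?thesis using p by simp
qed

text \<open>Degree two is spanned by products of elements of degree one.\<close>

lemma GM_2_linear_eq:
  fixes f g :: "'m \<Rightarrow> 'k"
  assumes f: "\<And>x y. x \<in> GM 2 \<Longrightarrow> y \<in> GM 2 \<Longrightarrow> f (x + y) = f x + f y"
      "\<And>c x. x \<in> GM 2 \<Longrightarrow> f (sM c x) = c * f x"
    and g: "\<And>x y. x \<in> GM 2 \<Longrightarrow> y \<in> GM 2 \<Longrightarrow> g (x + y) = g x + g y"
      "\<And>c x. x \<in> GM 2 \<Longrightarrow> g (sM c x) = c * g x"
    and fg: "\<And>a b. a \<in> GM 1 \<Longrightarrow> b \<in> GM 1 \<Longrightarrow> f (a * b) = g (a * b)" and x: "x \<in> GM 2"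
  shows "f x = g x"
  using x
proof (induction rule: GM_induct)
  case zero
  have "0 \<in> GM 2" using GM_subspace by (rule D1.subspace_0)
  then show ?case using f(2)[of 0 0] g(2)[of 0 0] by simp
next
  case (word c xs)
  then obtain a b where xs: "xs = [a, b]"
    by (metis One_nat_def Suc_1 length_0_conv length_Suc_conv)
  have "a * b \<in> GM 2" using prod_list_grade[of xs] word xs by (simp add: numeral_2_eq_2)
  then show ?case using fg[of a b] word xs f(2) g(2) by simp
qed (simp add: f g)

subsection \<open>Contraction and augmentation\<close>

text \<open>The choice of the representative does not affect contraction and augmentation, by
  \<open>iota_well_defined\<close>.\<close>

definition word_rep :: "'m \<Rightarrow> 'm list \<Rightarrow>\<^sub>0 'k" where
  "word_rep x = (SOME p. keys p \<subseteq> lists (GM 1) \<and> ev p = x)"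

definition contract :: "('m \<Rightarrow> 'k) \<Rightarrow> 'm \<Rightarrow> 'm" where
  "contract u x = M.lin_ext (iota u) (word_rep x)"

definition aug :: "'m \<Rightarrow> 'k" where
  "aug x = lookup (word_rep x) []"

lemma word_rep: "keys (word_rep x) \<subseteq> lists (GM 1)" "ev (word_rep x) = x"
  using someI_ex[OF ex_ev[of x]] unfolding word_rep_def by auto

lemma word_rep_diff:
  assumes p: "keys p \<subseteq> lists (GM 1)"
  shows "keys (word_rep (ev p) - p) \<subseteq> lists (GM 1)" "ev (word_rep (ev p) - p) = 0"
  using keys_diff[of "word_rep (ev p)" p] word_rep[of "ev p"] p
  by (auto simp: M.lin_ext_diff)

lemma contract_ev:
  assumes "u \<in> functionals" "keys p \<subseteq> lists (GM 1)"
  shows "contract u (ev p) = M.lin_ext (iota u) p"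
  using iota_well_defined[OF assms(1) word_rep_diff[OF assms(2)]]
  unfolding contract_def by (simp add: M.lin_ext_diff)

lemma zero_functional: "(\<lambda>_. 0) \<in> functionals"
  unfolding functionals_iff by simp

lemma aug_ev:
  assumes "keys p \<subseteq> lists (GM 1)"
  shows "aug (ev p) = lookup p []"
  using iota_well_defined[OF zero_functional word_rep_diff[OF assms]]
  unfolding aug_def by (simp add: lookup_minus)

lemma contract_word:
  assumes "u \<in> functionals" "set xs \<subseteq> GM 1"
  shows "contract u (prod_list xs) = iota u xs"
  using contract_ev[OF assms(1), of "single xs 1"] assms(2) by (auto simp: subset_eq)

lemma ev_word_add: 
  assumes "keys p \<subseteq> lists (GM 1)" "keys q \<subseteq> lists (GM 1)"
  shows "keys (p + q) \<subseteq> lists (GM 1)"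
  using keys_add[of p q] assms by blast

lemma ev_word_scale: 
  assumes "keys p \<subseteq> lists (GM 1)"
  shows "keys (pscale c p) \<subseteq> lists (GM 1)"
  using keys_pscale[of c p] assms by blast

lemma contract_add: "u \<in> functionals \<Longrightarrow> contract u (x + y) = contract u x + contract u y"
  using contract_ev[OF _ ev_word_add[OF word_rep(1)[of x] word_rep(1)[of y]], of u]
  by (simp add: M.lin_ext_add word_rep) (simp add: contract_def)

lemma contract_scale: "u \<in> functionals \<Longrightarrow> contract u (sM c x) = sM c (contract u x)"
  using contract_ev[OF _ ev_word_scale[OF word_rep(1)[of x]], of u c]
  by (simp add: M.lin_ext_pscale word_rep) (simp add: contract_def)

lemma aug_add: "aug (x + y) = aug x + aug y"
  using aug_ev[OF ev_word_add[OF word_rep(1)[of x] word_rep(1)[of y]]]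
  by (simp add: M.lin_ext_add word_rep lookup_add) (simp add: aug_def)

lemma aug_scale: "aug (sM c x) = c * aug x"
  using aug_ev[OF ev_word_scale[OF word_rep(1)[of x]], of c]
  by (simp add: M.lin_ext_pscale word_rep) (simp add: aug_def)

lemma contract_zero [simp]: "u \<in> functionals \<Longrightarrow> contract u 0 = 0"
  using contract_scale[of u 0 0] by simp

lemma contract_uminus: "u \<in> functionals \<Longrightarrow> contract u (- x) = - contract u x"
  using contract_scale[of u "- 1" x] by simp

lemma contract_diff: "u \<in> functionals \<Longrightarrow> contract u (x - y) = contract u x - contract u y"
  using contract_add[of u x "- y"] by (simp add: contract_uminus)

lemma aug_zero [simp]: "aug 0 = 0"
  using aug_scale[of 0 0] by simp

lemma aug_uminus: "aug (- x) = - aug x"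
  using aug_scale[of "- 1" x] by simp

lemma aug_diff: "aug (x - y) = aug x - aug y"
  using aug_add[of x "- y"] by (simp add: aug_uminus)

lemma aug_one [simp]: "aug 1 = 1"
  using aug_ev[of "single [] 1"] by simp

lemma aug_grade_Suc: "x \<in> GM (Suc n) \<Longrightarrow> aug x = 0"
proof -
  assume "x \<in> GM (Suc n)"
  then obtain p where p: "keys p \<subseteq> {xs. set xs \<subseteq> GM 1 \<and> length xs = Suc n}" "ev p = x"
    using GM_ev by blast
  then have "aug x = lookup p []" using aug_ev[of p] by auto
  also have "\<dots> = 0" using p by (metis (mono_tags, lifting) in_keys_iff list.size(3) mem_Collect_eq nat.distinct(1) subsetD)
  finally show ?thesis .
qed

lemma GM_0_scalar: "x \<in> GM 0 \<Longrightarrow> x = sM (aug x) 1"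
proof (induction rule: GM_induct)
  case (add x y)
  then show ?case by (simp add: aug_add D1.scale_left_distrib)
qed (simp_all add: aug_scale)

lemma iota_grade:
  assumes "set xs \<subseteq> GM 1" "length xs = Suc n"
  shows "iota u xs \<in> GM n"
  using assms
proof (induction xs arbitrary: n)
  case (Cons x xs)
  have "x * iota u xs \<in> GM n"
  proof (cases n)
    case (Suc m)
    then have "iota u xs \<in> GM m" using Cons by auto
    then show ?thesis using D1.mult_grade[of x 1 "iota u xs" m] Cons Suc by simp
  qed (use Cons GM_subspace in \<open>auto simp: D1.subspace_0\<close>)
  then show ?case
    using Cons prod_list_grade[of xs] GM_subspace
    by (auto intro!: D1.subspace_diff D1.subspace_scale)
qed simp

lemma contract_grade:
  assumes u: "u \<in> functionals" and x: "x \<in> GM (Suc n)"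
  shows "contract u x \<in> GM n"
  using x
proof (induction rule: GM_induct)
  case (word c xs)
  then show ?case
    using iota_grade GM_subspace u
    by (simp add: contract_scale contract_word D1.subspace_scale)
qed (use GM_subspace u in \<open>simp_all add: contract_add D1.subspace_0 D1.subspace_add\<close>)

lemma contract_1: "u \<in> functionals \<Longrightarrow> a \<in> GM 1 \<Longrightarrow> contract u a = sM (u a) 1"
  using contract_word[of u "[a]"] by simp

lemma contract_mult_1:
  assumes u: "u \<in> functionals" and b: "b \<in> GM 1" and x: "x \<in> GM n"
  shows "contract u (x * b) = contract u x * b + sM ((- 1) ^ n * u b) x"
  using x
proof (induction rule: GM_induct)
  case (word c xs)
  have "contract u (prod_list (xs @ [b])) = iota u (xs @ [b])"
    by (rule contract_word[OF u]) (use word b in simp)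
  also have "\<dots> = iota u xs * b + sM ((- 1) ^ n * u b) (prod_list xs)"
    using word by (simp only: iota_append) (simp add: D1.scale_mult_right[symmetric])
  finally have "contract u (prod_list xs * b) = contract u (prod_list xs) * b +
      sM ((- 1) ^ n * u b) (prod_list xs)"
    using word u by (simp add: contract_word)
  then show ?case
    using u by (simp add: contract_scale D1.scale_mult_left[symmetric] D1.scale_right_distrib mult.commute)
qed (use u in \<open>simp_all add: contract_add distrib_right D1.scale_right_distrib\<close>)

text \<open>Euler's formula. It turns the vanishing of all contractions of a homogeneous element into
  the vanishing of the element, since the degree is invertible in characteristic zero.\<close>

lemma euler_formula:
  assumes I: "\<And>i. i \<in> I \<Longrightarrow> t i \<in> functionals" "\<And>i. i \<in> I \<Longrightarrow> e i \<in> GM 1"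
    and Y: "Y \<subseteq> GM 1" "\<And>a. a \<in> Y \<Longrightarrow> (\<Sum>i\<in>I. sM (t i a) (e i)) = a"
    and p: "keys p \<subseteq> {xs. set xs \<subseteq> Y \<and> length xs = n}"
  shows "(\<Sum>i\<in>I. e i * contract (t i) (ev p)) = sM (of_nat n) (ev p)"
proof -
  have word: "(\<Sum>i\<in>I. e i * iota (t i) xs) = sM (of_nat (length xs)) (prod_list xs)"
    if "set xs \<subseteq> Y" for xs
    using that
  proof (induction xs)
    case (Cons x xs)
    have "(\<Sum>i\<in>I. e i * iota (t i) (x # xs)) =
        (\<Sum>i\<in>I. sM (t i x) (e i) * prod_list xs + x * (e i * iota (t i) xs))"
    proof (rule sum.cong[OF refl])
      fix i assume i: "i \<in> I"
      have "e i * x = - (x * e i)" using GM_anticommute[of x "e i"] I(2)[OF i] Cons.prems Y(1) by auto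
      then show "e i * iota (t i) (x # xs) =
          sM (t i x) (e i) * prod_list xs + x * (e i * iota (t i) xs)"
        by (simp add: right_diff_distrib D1.scale_mult_right[symmetric] D1.scale_mult_left[symmetric]
            mult.assoc[symmetric])
    qed
    also have "\<dots> = (\<Sum>i\<in>I. sM (t i x) (e i)) * prod_list xs + x * (\<Sum>i\<in>I. e i * iota (t i) xs)"
      by (simp add: sum.distrib sum_distrib_left sum_distrib_right)
    also have "\<dots> = x * prod_list xs + sM (of_nat (length xs)) (x * prod_list xs)"
      using Cons Y(2) by (simp add: D1.scale_mult_right)
    also have "\<dots> = sM (of_nat (length (x # xs))) (prod_list (x # xs))"
      by (simp add: D1.scale_left_distrib)
    finally show ?case .
  qed simp
  show ?thesis
    using p
  proof (induction rule: poly_mapping_carrier_induct)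
    case (single xs c)
    then have xs: "set xs \<subseteq> GM 1" using Y by auto
    have "(\<Sum>i\<in>I. e i * contract (t i) (sM c (prod_list xs))) = (\<Sum>i\<in>I. sM c (e i * iota (t i) xs))"
      using xs I(1) by (intro sum.cong) (auto simp: contract_scale contract_word D1.scale_mult_right)
    also have "\<dots> = sM c (sM (of_nat n) (prod_list xs))"
      using word[of xs] single by (simp add: D1.scale_sum_right[symmetric])
    finally show ?case by (simp add: mult.commute)
  next
    case (add p q)
    then show ?case using I(1)
      by (simp add: M.lin_ext_add contract_add distrib_left sum.distrib D1.scale_right_distrib)
  qed (use I(1) in simp)
qed

subsection \<open>The pairing of bivectors with two-forms\<close>

definition pair :: "('m \<Rightarrow> 'k) \<Rightarrow> ('m \<Rightarrow> 'k) \<Rightarrow> 'm \<Rightarrow> 'k" where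
  "pair u v z = aug (contract v (contract u z))"

lemma pair_add: "u \<in> functionals \<Longrightarrow> v \<in> functionals \<Longrightarrow> pair u v (x + y) = pair u v x + pair u v y"
  and pair_scale: "u \<in> functionals \<Longrightarrow> v \<in> functionals \<Longrightarrow> pair u v (sM c x) = c * pair u v x"
  and pair_zero: "u \<in> functionals \<Longrightarrow> v \<in> functionals \<Longrightarrow> pair u v 0 = 0"
  unfolding pair_def by (simp_all add: contract_add contract_scale aug_add aug_scale)

lemma pair_mult:
  assumes "u \<in> functionals" "v \<in> functionals" "a \<in> GM 1" "b \<in> GM 1"
  shows "pair u v (a * b) = u a * v b - u b * v a"
  unfolding pair_def using contract_word[of u "[a, b]"] assms
  by (simp add: contract_diff contract_scale contract_1 aug_diff aug_scale D1.scale_mult_right[symmetric])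

text \<open>Two contractions lower the length by two, so only words of length two can reach the scalars
  detected by the augmentation.\<close>

lemma pair_word:
  assumes u: "u \<in> functionals" and v: "v \<in> functionals" and xs: "set xs \<subseteq> GM 1"
    and 2: "\<And>a b. xs = [a, b] \<Longrightarrow> u a * v b - u b * v a = 0"
  shows "pair u v (prod_list xs) = 0"
proof -
  consider "xs = []" | a where "xs = [a]" | a b where "xs = [a, b]" | n where "length xs = Suc (Suc (Suc n))"
    by (metis length_0_conv length_Suc_conv not0_implies_Suc)
  then show ?thesis
  proof cases
    case 1
    then show ?thesis using u v contract_word[OF u, of "[]"] by (simp add: pair_def)
  next
    case 2
    then show ?thesis using u v xs contract_word[OF v, of "[]"]
      by (simp add: pair_def contract_1 contract_scale)
  next
    case 3
    then show ?thesis using pair_mult[OF u v, of a b] xs assms(4) by simp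
  next
    case 4
    then have "contract v (contract u (prod_list xs)) \<in> GM (Suc n)"
      using contract_grade u v prod_list_grade[OF xs] by simp
    then show ?thesis by (simp add: pair_def aug_grade_Suc)
  qed
qed

lemma functional_add:
    "u \<in> functionals \<Longrightarrow> x \<in> GM 1 \<Longrightarrow> y \<in> GM 1 \<Longrightarrow> u (x + y) = u x + u y"
  and functional_scale: "u \<in> functionals \<Longrightarrow> x \<in> GM 1 \<Longrightarrow> u (sM c x) = c * u x"
  and functional_outside: "u \<in> functionals \<Longrightarrow> x \<notin> GM 1 \<Longrightarrow> u x = 0"
  unfolding functionals_iff by auto

lemma functionals_add: "u \<in> functionals \<Longrightarrow> v \<in> functionals \<Longrightarrow> (\<lambda>x. u x + v x) \<in> functionals"
  unfolding functionals_iff[of "\<lambda>x. u x + v x"]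
  by (simp add: functional_add[of u] functional_add[of v] functional_scale[of u] functional_scale[of v]
      functional_outside[of u] functional_outside[of v] distrib_left)

lemma functionals_scale: "u \<in> functionals \<Longrightarrow> (\<lambda>x. c * u x) \<in> functionals"
  unfolding functionals_iff[of "\<lambda>x. c * u x"]
  by (simp add: functional_add[of u] functional_scale[of u] functional_outside[of u] distrib_left)

lemma functional_zero: "u \<in> functionals \<Longrightarrow> u 0 = 0"
  using functional_scale[of u 0 0] D1.subspace_0[OF GM_subspace, of 1] by simp

lemma pair_bilinear:
  assumes "u \<in> functionals" "u' \<in> functionals" "v \<in> functionals" "z \<in> GM 2"
  shows "pair (\<lambda>x. u x + u' x) v z = pair u v z + pair u' v z"
    and "pair v (\<lambda>x. u x + u' x) z = pair v u z + pair v u' z"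
    and "pair (\<lambda>x. c * u x) v z = c * pair u v z"
    and "pair v (\<lambda>x. c * u x) z = c * pair v u z"
    and "pair v v z = 0" and "pair v u z = - pair u v z"
proof -
  note closed = assms(1-3) functionals_add[OF assms(1,2)] functionals_scale[OF assms(1), of c]
  note simps = closed pair_add pair_scale pair_mult
  show "pair (\<lambda>x. u x + u' x) v z = pair u v z + pair u' v z"
    by (rule GM_2_linear_eq[where f = "\<lambda>z. pair (\<lambda>x. u x + u' x) v z" and
        g = "\<lambda>z. pair u v z + pair u' v z", OF _ _ _ _ _ assms(4)]) (simp_all add: simps algebra_simps)
  show "pair v (\<lambda>x. u x + u' x) z = pair v u z + pair v u' z"
    by (rule GM_2_linear_eq[where f = "\<lambda>z. pair v (\<lambda>x. u x + u' x) z" and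
        g = "\<lambda>z. pair v u z + pair v u' z", OF _ _ _ _ _ assms(4)]) (simp_all add: simps algebra_simps)
  show "pair (\<lambda>x. c * u x) v z = c * pair u v z"
    by (rule GM_2_linear_eq[where f = "\<lambda>z. pair (\<lambda>x. c * u x) v z" and
        g = "\<lambda>z. c * pair u v z", OF _ _ _ _ _ assms(4)]) (simp_all only: simps distrib_left right_diff_distrib mult.left_commute mult.assoc)
  show "pair v (\<lambda>x. c * u x) z = c * pair v u z"
    by (rule GM_2_linear_eq[where f = "\<lambda>z. pair v (\<lambda>x. c * u x) z" and
        g = "\<lambda>z. c * pair v u z", OF _ _ _ _ _ assms(4)]) (simp_all only: simps distrib_left right_diff_distrib mult.left_commute mult.assoc)
  show "pair v v z = 0"
    by (rule GM_2_linear_eq[where f = "\<lambda>z. pair v v z" and g = "\<lambda>z. 0", OF _ _ _ _ _ assms(4)])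
      (simp_all add: simps algebra_simps)
  show "pair v u z = - pair u v z"
    by (rule GM_2_linear_eq[where f = "\<lambda>z. pair v u z" and g = "\<lambda>z. - pair u v z", OF _ _ _ _ _ assms(4)])
      (simp_all add: simps algebra_simps)
qed

lemma d_add: "d (x + y) = d x + d y" and d_scale: "d (sM c x) = sM c (d x)"
  using D1.linear_d unfolding Vector_Spaces.linear_def module_hom_def module_hom_axioms_def by auto

lemma d_zero [simp]: "d 0 = 0"
  using d_scale[of 0 0] by simp

subsection \<open>The bracket dual to the differential\<close>

definition bracket :: "('m \<Rightarrow> 'k) \<Rightarrow> ('m \<Rightarrow> 'k) \<Rightarrow> 'm \<Rightarrow> 'k" where
  "bracket u v w = (if w \<in> GM 1 then pair u v (d w) else 0)"

lemma d_GM_1: "w \<in> GM 1 \<Longrightarrow> d w \<in> GM 2"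
  using D1.d_grade[of w 1] by (simp add: numeral_2_eq_2)

lemma bracket_closed:
  assumes "u \<in> functionals" "v \<in> functionals"
  shows "bracket u v \<in> functionals"
  using assms GM_subspace[of 1]
  unfolding functionals_iff[of "bracket u v"]
  by (auto simp: bracket_def d_add d_scale pair_add pair_scale D1.subspace_add D1.subspace_scale)

text \<open>The transpose of \<open>d\<close> in the next degree is the Chevalley--Eilenberg differential of the
  bracket. For \<open>z = d w\<close> this is the Jacobi identity.\<close>

lemma triple_contract_d:
  assumes u: "u \<in> functionals" and v: "v \<in> functionals" and t: "t \<in> functionals" and z: "z \<in> GM 2"
  shows "aug (contract t (contract v (contract u (d z)))) =
    pair (bracket u v) t z + pair (bracket t u) v z + pair (bracket v t) u z"
proof (rule GM_2_linear_eq[OF _ _ _ _ _ z])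
  note closed = bracket_closed[OF u v] bracket_closed[OF t u] bracket_closed[OF v t]
  fix a b assume a: "a \<in> GM 1" and b: "b \<in> GM 1"
  have T: "aug (contract t (contract v (contract u (y * b)))) =
      pair u v y * t b + pair t u y * v b + pair v t y * u b"
    if y: "y \<in> GM 2" and b: "b \<in> GM 1" for y b
  proof -
    let ?x = "contract u y"
    have x: "?x \<in> GM 1" using contract_grade[OF u, of y 1] y by (simp add: numeral_2_eq_2)
    have vx: "v ?x = pair u v y" unfolding pair_def using contract_1[OF v x] by (simp add: aug_scale)
    have tx: "t ?x = pair u t y" unfolding pair_def using contract_1[OF t x] by (simp add: aug_scale)
    have "contract u (y * b) = ?x * b + sM (u b) y"
      using contract_mult_1[OF u b y] by simp
    moreover have "contract v (?x * b) = sM (v ?x) b - sM (v b) ?x"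
      using contract_mult_1[OF v b x] contract_1[OF v x] by (simp add: D1.scale_mult_left[symmetric])
    ultimately have "contract v (contract u (y * b)) =
        sM (v ?x) b - sM (v b) ?x + sM (u b) (contract v y)"
      using v by (simp add: contract_add contract_scale)
    then have "aug (contract t (contract v (contract u (y * b)))) =
        v ?x * t b - v b * t ?x + u b * pair v t y"
      using t contract_1[OF t b] contract_1[OF t x]
      by (simp add: contract_add contract_diff contract_scale aug_add aug_diff aug_scale pair_def)
    also have "\<dots> = pair u v y * t b - v b * pair u t y + u b * pair v t y" by (simp only: vx tx)
    also have "pair u t y = - pair t u y" using pair_bilinear(6)[OF t t u y] .
    finally show ?thesis by simp
  qed
  have da: "d a \<in> GM 2" and db: "d b \<in> GM 2" using a b d_GM_1 by auto
  have "d (a * b) = d a * b - a * d b" using D1.leibniz[OF a, of b] by simp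
  also have "a * d b = d b * a" using D1.graded_commute[OF a db] by simp
  finally show "aug (contract t (contract v (contract u (d (a * b))))) =
      pair (bracket u v) t (a * b) + pair (bracket t u) v (a * b) + pair (bracket v t) u (a * b)"
    using u v t a b
    by (simp add: contract_diff aug_diff T[OF da b] T[OF db a] pair_mult closed bracket_def)
qed (use assms bracket_closed in
    \<open>simp_all add: d_add d_scale contract_add contract_scale aug_add aug_scale pair_add pair_scale algebra_simps\<close>)

text \<open>The Lie algebra with which both sides of the theorem are compared. A functional on the direct
  sum of the \<open>V n\<close> is a family of functionals on the summands, so this is the completion of the
  graded Lie algebra with parts the duals of the \<open>V n\<close>.\<close>

definition dual_lie :: "('k, 'm \<Rightarrow> 'k) filtered_alg" where
  "dual_lie = \<lparr> vcarrier = functionals, vadd = (\<lambda>f g x. f x + g x), vzero = (\<lambda>x. 0),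
     vsmult = (\<lambda>c f x. c * f x), aprod = bracket,
     filt = (\<lambda>k. {u \<in> functionals. \<forall>j<k. \<forall>w\<in>V j. u w = 0}) \<rparr>"

lemma dual_lie_simps [simp]:
  "vcarrier dual_lie = functionals" "vadd dual_lie = (\<lambda>f g x. f x + g x)" "vzero dual_lie = (\<lambda>x. 0)"
  "vsmult dual_lie = (\<lambda>c f x. c * f x)" "aprod dual_lie = bracket"
  "filt dual_lie = (\<lambda>k. {u \<in> functionals. \<forall>j<k. \<forall>w\<in>V j. u w = 0})"
  unfolding dual_lie_def by simp_all

lemma vdiff_dual_lie [simp]: "vdiff dual_lie u v = (\<lambda>x. u x - v x)"
  unfolding vdiff_def by simp

lemma bracket_bilinear:
  assumes "u \<in> functionals" "u' \<in> functionals" "v \<in> functionals"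
  shows "bracket (\<lambda>x. u x + u' x) v = (\<lambda>w. bracket u v w + bracket u' v w)"
    and "bracket v (\<lambda>x. u x + u' x) = (\<lambda>w. bracket v u w + bracket v u' w)"
    and "bracket (\<lambda>x. c * u x) v = (\<lambda>w. c * bracket u v w)"
    and "bracket v (\<lambda>x. c * u x) = (\<lambda>w. c * bracket v u w)"
    and "bracket v v = (\<lambda>w. 0)"
  using assms by (auto simp: bracket_def fun_eq_iff pair_bilinear(1-5) d_GM_1)

lemma lie_algebra_dual_lie: "lie_algebra dual_lie"
proof -
  have neg: "\<exists>y\<in>functionals. \<forall>w. x w + y w = 0" if "x \<in> functionals" for x
    using functionals_scale[OF that, of "- 1"] by (intro bexI[of _ "\<lambda>w. - 1 * x w"]) simp_all
  have "vector_space_on dual_lie"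
    unfolding vector_space_on_def
    by (intro conjI ballI allI)
      (simp_all add: functionals_add functionals_scale zero_functional neg fun_eq_iff
        distrib_left distrib_right add.assoc add.commute)
  then have "algebra_on dual_lie"
    unfolding algebra_on_def by (simp add: bracket_closed bracket_bilinear)
  moreover have "jacobiator dual_lie u v t = (\<lambda>x. 0)"
    if "u \<in> functionals" "v \<in> functionals" "t \<in> functionals" for u v t
  proof
    fix w
    show "jacobiator dual_lie u v t w = 0"
    proof (cases "w \<in> GM 1")
      case True
      then show ?thesis
        using triple_contract_d[OF that d_GM_1[OF True]] that
        by (simp add: jacobiator_def D1.d_d bracket_def[of _ _ w] algebra_simps)
    qed (simp add: jacobiator_def bracket_def[of _ _ w])
  qed
  ultimately show ?thesis
    unfolding lie_algebra_def by (simp add: bracket_bilinear)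
qed

text \<open>As \<open>d\<close> respects weights, the value of a sum of brackets on \<open>V n\<close> depends only on what the
  functionals do in complementary weights. A sum rather than a single bracket is needed to compare
  a bracket with the brackets of homogeneous parts.\<close>

lemma bracket_weight_zero:
  assumes I: "finite I" "\<And>i. i \<in> I \<Longrightarrow> u i \<in> functionals" "\<And>i. i \<in> I \<Longrightarrow> v i \<in> functionals"
    and w: "w \<in> V n"
    and 0: "\<And>i j a b. a \<in> V i \<Longrightarrow> b \<in> V j \<Longrightarrow> i + j = n \<Longrightarrow>
      (\<Sum>l\<in>I. u l a * v l b - u l b * v l a) = 0"
  shows "(\<Sum>l\<in>I. bracket (u l) (v l) w) = 0"
proof -
  have w1: "w \<in> GM 1" using w V_subset by auto
  have "(\<Sum>l\<in>I. pair (u l) (v l) (d w)) = 0"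
  proof (cases "n \<ge> 2")
    case True
    have "d w \<in> weight_part sM V n" by (rule d_V_weight[OF True w])
    then show ?thesis
      unfolding weight_part_def
    proof (induction rule: D1.span_induct_alt)
      case base
      then show ?case using I by (simp add: pair_zero)
    next
      case (step c x y)
      then obtain vs js where x: "x = prod_list vs" and l: "list_all2 (\<lambda>v j. v \<in> V j) vs js"
        and s: "sum_list js = n" by blast
      have vs: "set vs \<subseteq> GM 1"
        using l V_subset by (force simp: list_all2_conv_all_nth in_set_conv_nth)
      have "(\<Sum>l\<in>I. pair (u l) (v l) x) = 0"
      proof (cases "\<exists>a b. vs = [a, b]")
        case True
        then obtain a b where ab: "vs = [a, b]" by blast
        then obtain i j where "js = [i, j]" "a \<in> V i" "b \<in> V j"
          using l by (auto simp: list_all2_Cons1)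
        then show ?thesis using x ab vs s 0[of a i b j] I by (simp add: pair_mult)
      next
        case False
        then have "pair (u l) (v l) x = 0" if "l \<in> I" for l
          unfolding x using I that vs by (intro pair_word) auto
        then show ?thesis by simp
      qed
      then show ?case using step I
        by (simp add: pair_add pair_scale sum.distrib sum_distrib_left[symmetric])
    qed
  next
    case False
    then consider "n = 0" | "n = 1" by linarith
    then have "d w = 0" using w V_0 d_V_1 by cases auto
    then show ?thesis using I by (simp add: pair_zero)
  qed
  then show ?thesis using w1 by (simp add: bracket_def)
qed

lemma filtered_lie_dual_lie: "filtered_lie_algebra dual_lie"
  unfolding filtered_lie_algebra_def
proof (intro conjI allI impI ballI)
  show "lie_algebra dual_lie" by (rule lie_algebra_dual_lie)
  show "filt dual_lie 1 = vcarrier dual_lie" using V_0 by (auto simp: functional_zero)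
  fix k :: nat
  show "vsubspace dual_lie (filt dual_lie k)"
    unfolding vsubspace_def by (simp add: functionals_add functionals_scale zero_functional subset_eq)
  show "filt dual_lie (Suc k) \<subseteq> filt dual_lie k" by (auto simp: less_Suc_eq)
next
  fix p q u v assume u: "u \<in> filt dual_lie p" and v: "v \<in> filt dual_lie q"
  then have cl: "u \<in> functionals" "v \<in> functionals" by auto
  have "bracket u v w = 0" if "n < p + q" and w: "w \<in> V n" for n w
  proof -
    have "(\<Sum>l\<in>{()}. bracket u v w) = 0"
    proof (rule bracket_weight_zero[OF _ _ _ w])
      fix i j a b assume ab: "a \<in> V i" "b \<in> V j" "i + j = n"
      then have "i < p \<or> j < q" "j < p \<or> i < q" using \<open>n < p + q\<close> by linarith+
      then show "(\<Sum>l\<in>{()}. u a * v b - u b * v a) = 0" using u v ab by auto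
    qed (use cl in auto)
    then show ?thesis by simp
  qed
  then show "aprod dual_lie u v \<in> filt dual_lie (p + q)" using cl by (simp add: bracket_closed)
qed

subsection \<open>Functionals and their homogeneous parts\<close>

lemma functional_sum:
  assumes "u \<in> functionals" "finite T" "\<And>t. t \<in> T \<Longrightarrow> y t \<in> GM 1"
  shows "u (\<Sum>t\<in>T. y t) = (\<Sum>t\<in>T. u (y t))"
  using assms(2,3)
  by (induction T rule: finite_induct)
    (auto simp: functional_zero[OF assms(1)] functional_add[OF assms(1)] D1.subspace_sum[OF GM_subspace])

lemma functionals_eqI:
  assumes "u \<in> functionals" "v \<in> functionals" and eq: "\<And>j w. j \<ge> 1 \<Longrightarrow> w \<in> V j \<Longrightarrow> u w = v w"
  shows "u = v"
proof
  fix x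
  show "u x = v x"
  proof (cases "x \<in> GM 1")
    case True
    then obtain f where f: "\<forall>n. f n \<in> V n" "finite {n. f n \<noteq> 0}" "x = (\<Sum>n | f n \<noteq> 0. f n)"
      using direct_sum_V unfolding internal_direct_sum_def by blast
    have "f n \<noteq> 0 \<Longrightarrow> n \<ge> 1" for n
      using f(1)[rule_format, of 0] V_0 by (cases n) auto
    then have "u (f n) = v (f n)" if "f n \<noteq> 0" for n using eq f(1) that by blast
    moreover have "f n \<in> GM 1" for n using f(1) V_subset by blast
    ultimately show ?thesis unfolding f(3) using f(2)
      by (simp add: functional_sum[OF assms(1)] functional_sum[OF assms(2)])
  qed (use functional_outside assms(1,2) in metis)
qed

text \<open>Functionals on the \<open>V j\<close> can be prescribed independently, because the sum of the \<open>V j\<close> is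
  direct.\<close>

lemma functional_glue:
  assumes h: "\<And>j. h j \<in> functionals"
  shows "\<exists>u\<in>functionals. \<forall>j. \<forall>w\<in>V j. u w = h j w"
proof -
  define comp where "comp x = (THE f. (\<forall>n. f n \<in> V n) \<and> finite {n. f n \<noteq> 0} \<and> x = (\<Sum>n | f n \<noteq> 0. f n))" for x
  have ex1: "\<exists>!f. (\<forall>n. f n \<in> V n) \<and> finite {n. f n \<noteq> 0} \<and> x = (\<Sum>n | f n \<noteq> 0. f n)" if "x \<in> GM 1" for x
    using direct_sum_V that unfolding internal_direct_sum_def by blast
  have comp: "comp x n \<in> V n" "finite {n. comp x n \<noteq> 0}" "x = (\<Sum>n | comp x n \<noteq> 0. comp x n)"
    if "x \<in> GM 1" for x n
    using theI'[OF ex1[OF that]] unfolding comp_def by auto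
  have compI: "comp x = f"
    if "\<And>n. f n \<in> V n" "finite S" "{n. f n \<noteq> 0} \<subseteq> S" "x = (\<Sum>n\<in>S. f n)" for x f S
  proof -
    have fin: "finite {n. f n \<noteq> 0}" using that by (blast intro: finite_subset)
    have x: "x = (\<Sum>n | f n \<noteq> 0. f n)"
      unfolding that(4) by (rule sum.mono_neutral_right) (use that in auto)
    have "x \<in> GM 1" unfolding that(4) using that(1) V_subset GM_subspace
      by (intro D1.subspace_sum) auto
    from the1_equality[OF ex1[OF this], of f] show ?thesis unfolding comp_def using that(1) fin x by simp
  qed
  define u where "u x = (if x \<in> GM 1 then \<Sum>n | comp x n \<noteq> 0. h n (comp x n) else 0)" for x
  have u_alt: "u x = (\<Sum>n\<in>S. h n (comp x n))"
    if "x \<in> GM 1" "finite S" "{n. comp x n \<noteq> 0} \<subseteq> S" for x S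
  proof -
    have "(\<Sum>n | comp x n \<noteq> 0. h n (comp x n)) = (\<Sum>n\<in>S. h n (comp x n))"
      by (rule sum.mono_neutral_left) (use that functional_zero[OF h] in auto)
    then show ?thesis using that by (simp add: u_def)
  qed
  have sumc: "x = (\<Sum>n\<in>S. comp x n)"
    if "x \<in> GM 1" "finite S" "{n. comp x n \<noteq> 0} \<subseteq> S" for x S
  proof -
    have "(\<Sum>n | comp x n \<noteq> 0. comp x n) = (\<Sum>n\<in>S. comp x n)"
      by (rule sum.mono_neutral_left) (use that in auto)
    then show ?thesis using comp(3)[OF that(1)] by simp
  qed
  have c1: "comp x n \<in> GM 1" if "x \<in> GM 1" for x n using comp(1)[OF that] V_subset by blast
  have "u \<in> functionals"
    unfolding functionals_iff
  proof (intro conjI ballI allI impI)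
    fix x y assume x: "x \<in> GM 1" and y: "y \<in> GM 1"
    then have xy: "x + y \<in> GM 1" using GM_subspace by (simp add: D1.subspace_add)
    let ?S = "{n. comp x n \<noteq> 0} \<union> {n. comp y n \<noteq> 0}"
    have S: "finite ?S" using comp x y by auto
    have e: "comp (x + y) = (\<lambda>n. comp x n + comp y n)"
    proof (rule compI[OF _ S])
      show "comp x n + comp y n \<in> V n" for n
        using comp(1)[OF x] comp(1)[OF y] subspace_V by (simp add: D1.subspace_add)
      show "x + y = (\<Sum>n\<in>?S. comp x n + comp y n)"
        unfolding sum.distrib using sumc[OF x S] sumc[OF y S] by auto
    qed auto
    have "u (x + y) = (\<Sum>n\<in>?S. h n (comp (x + y) n))" by (rule u_alt[OF xy S]) (auto simp: e)
    also have "\<dots> = (\<Sum>n\<in>?S. h n (comp x n)) + (\<Sum>n\<in>?S. h n (comp y n))"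
      unfolding sum.distrib[symmetric] e by (intro sum.cong refl functional_add[OF h] c1 x y)
    also have "(\<Sum>n\<in>?S. h n (comp x n)) = u x" by (rule u_alt[OF x S, symmetric]) auto
    also have "(\<Sum>n\<in>?S. h n (comp y n)) = u y" by (rule u_alt[OF y S, symmetric]) auto
    finally show "u (x + y) = u x + u y" .
  next
    fix c x assume x: "x \<in> GM 1"
    then have cx: "sM c x \<in> GM 1" using GM_subspace by (simp add: D1.subspace_scale)
    let ?S = "{n. comp x n \<noteq> 0}"
    have S: "finite ?S" using comp x by auto
    have e: "comp (sM c x) = (\<lambda>n. sM c (comp x n))"
    proof (rule compI[OF _ S])
      show "sM c (comp x n) \<in> V n" for n
        using comp(1)[OF x] subspace_V by (simp add: D1.subspace_scale)
      show "sM c x = (\<Sum>n\<in>?S. sM c (comp x n))"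
        unfolding D1.scale_sum_right[symmetric] using sumc[OF x S] by auto
    qed auto
    have "u (sM c x) = (\<Sum>n\<in>?S. h n (comp (sM c x) n))" by (rule u_alt[OF cx S]) (auto simp: e)
    also have "\<dots> = c * (\<Sum>n\<in>?S. h n (comp x n))"
      unfolding sum_distrib_left e by (intro sum.cong refl functional_scale[OF h] c1 x)
    also have "(\<Sum>n\<in>?S. h n (comp x n)) = u x" by (rule u_alt[OF x S, symmetric]) auto
    finally show "u (sM c x) = c * u x" .
  qed (simp add: u_def)
  moreover have "u w = h j w" if w: "w \<in> V j" for j w
  proof -
    have e: "comp w = (\<lambda>n. if n = j then w else 0)"
      by (rule compI[of _ "{j}"]) (use w subspace_V in \<open>auto simp: D1.subspace_0\<close>)
    have "w \<in> GM 1" using w V_subset by auto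
    then have "u w = (\<Sum>n\<in>{j}. h n (comp w n))" by (rule u_alt) (auto simp: e)
    then show ?thesis by (simp add: e)
  qed
  ultimately show ?thesis by blast
qed

lemma cauchy_complete_dual_lie: "cauchy_complete dual_lie"
  unfolding cauchy_complete_def
proof (intro conjI ballI allI impI)
  fix u assume u: "u \<in> vcarrier dual_lie" "\<forall>k\<ge>1. u \<in> filt dual_lie k"
  have "u = (\<lambda>x. 0)"
  proof (rule functionals_eqI)
    fix j w assume "w \<in> V j"
    then show "u w = 0" using u(2)[rule_format, of "Suc j"] by auto
  qed (use u zero_functional in auto)
  then show "u = vzero dual_lie" by simp
next
  fix x assume "\<forall>k\<ge>1. x k \<in> vcarrier dual_lie \<and> vdiff dual_lie (x (Suc k)) (x k) \<in> filt dual_lie k"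
  then have x: "x k \<in> functionals" "\<And>j w. j < k \<Longrightarrow> w \<in> V j \<Longrightarrow> x (Suc k) w = x k w"
    if "k \<ge> 1" for k using that by auto
  \<comment> \<open>From the member with index \<open>j + 1\<close> on, the sequence is constant on \<open>V j\<close>.\<close>
  obtain y where y: "y \<in> functionals" "\<And>j w. w \<in> V j \<Longrightarrow> y w = x (Suc j) w"
    using functional_glue[of "\<lambda>j. x (Suc j)"] x(1) by auto
  have xk: "x k w = x (Suc j) w" if "Suc j \<le> k" "w \<in> V j" for j k w
    using that(1)
  proof (induction k rule: dec_induct)
    case (step k)
    then show ?case using x(2)[of k j w] that(2) by simp
  qed simp
  have "y w - x k w = 0" if "j < k" "w \<in> V j" for j k w
    using y(2)[OF that(2)] xk[of j k w] that by simp
  moreover have "(\<lambda>w. y w - x k w) \<in> functionals" if "k \<ge> 1" for k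
    using functionals_add[OF y(1) functionals_scale[OF x(1)[OF that], of "- 1"]] by simp
  ultimately show "\<exists>y\<in>vcarrier dual_lie. \<forall>k\<ge>1. vdiff dual_lie y (x k) \<in> filt dual_lie k"
    using y(1) by (intro bexI[of _ y]) auto
qed

end

section \<open>Nondegeneracy of the pairing\<close>

context canonical_one_minimal_model
begin

definition words_span :: "'m set \<Rightarrow> nat \<Rightarrow> 'm set" where
  "words_span Y n = D1.span {prod_list xs | xs. set xs \<subseteq> Y \<and> length xs = n}"

lemma ev_words_span: "keys p \<subseteq> {xs. set xs \<subseteq> Y \<and> length xs = n} \<Longrightarrow> ev p \<in> words_span Y n"
  unfolding words_span_def by (rule M.lin_ext_mem) (auto intro!: D1.span_base)

lemma words_span_ev:
  "x \<in> words_span Y n \<Longrightarrow> \<exists>p. keys p \<subseteq> {xs. set xs \<subseteq> Y \<and> length xs = n} \<and> ev p = x"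
  unfolding words_span_def using span_prod_ev[of x "\<lambda>xs. set xs \<subseteq> Y \<and> length xs = n"] by blast

lemma stage_words_span: "x \<in> stage sM V i \<inter> GM n \<Longrightarrow> x \<in> words_span (gens i) n"
  using stage_GM_ev[of x i n] ev_words_span by blast

lemma words_span_mult:
  assumes a: "a \<in> Y" and x: "x \<in> words_span Y n"
  shows "a * x \<in> words_span Y (Suc n)"
  using x unfolding words_span_def
proof (induction rule: D1.span_induct_alt)
  case (step c x y)
  then obtain xs where xs: "x = prod_list xs" "set xs \<subseteq> Y" "length xs = n" by blast
  then have "prod_list (a # xs) \<in> D1.span {prod_list xs |xs. set xs \<subseteq> Y \<and> length xs = Suc n}"
    using a by (intro D1.span_base CollectI exI[of _ "a # xs"]) auto
  then show ?case
    using step xs by (simp add: distrib_left D1.scale_mult_right[symmetric] D1.span_add D1.span_scale)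
qed (simp add: D1.span_zero)

lemma iota_words_span: "set xs \<subseteq> Y \<Longrightarrow> length xs = Suc n \<Longrightarrow> iota u xs \<in> words_span Y n"
proof (induction xs arbitrary: n)
  case (Cons x xs)
  have "prod_list xs \<in> words_span Y n"
    unfolding words_span_def using Cons by (intro D1.span_base) auto
  moreover have "x * iota u xs \<in> words_span Y n"
  proof (cases n)
    case 0
    then show ?thesis using Cons by (simp add: words_span_def D1.span_zero)
  next
    case (Suc m)
    then show ?thesis using Cons words_span_mult[of x Y "iota u xs" m] by simp
  qed
  ultimately show ?case unfolding words_span_def by (simp add: D1.span_diff D1.span_scale)
qed simp

lemma contract_words_span:
  assumes u: "u \<in> functionals" and Y: "Y \<subseteq> GM 1" and x: "x \<in> words_span Y (Suc n)"
  shows "contract u x \<in> words_span Y n"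
  using x unfolding words_span_def
proof (induction rule: D1.span_induct_alt)
  case (step c x y)
  then obtain xs where xs: "x = prod_list xs" "set xs \<subseteq> Y" "length xs = Suc n" by blast
  then have "contract u x = iota u xs" using contract_word[OF u] Y by auto
  moreover have "iota u xs \<in> words_span Y n" using iota_words_span xs by simp
  ultimately show ?case
    using step u unfolding words_span_def
    by (simp add: contract_add contract_scale D1.span_add D1.span_scale)
qed (use u in \<open>simp add: D1.span_zero\<close>)

lemma words_span_GM: "Y \<subseteq> GM 1 \<Longrightarrow> words_span Y n \<subseteq> GM n"
  unfolding words_span_def
  by (rule D1.span_minimal) (use prod_list_grade GM_subspace in auto)

text \<open>For vectors \<open>e i\<close> and functionals \<open>t i\<close> that reconstruct all elements of \<open>Y\<close>, Euler's formula
  detects elements generated by \<open>Y\<close>, one degree at a time.\<close>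

context
  fixes I :: "'i set" and t :: "'i \<Rightarrow> 'm \<Rightarrow> 'k" and e :: "'i \<Rightarrow> 'm" and Y :: "'m set"
  assumes t: "\<And>i. i \<in> I \<Longrightarrow> t i \<in> functionals" and e: "\<And>i. i \<in> I \<Longrightarrow> e i \<in> GM 1"
    and Y: "Y \<subseteq> GM 1" and reconstruct: "\<And>a. a \<in> Y \<Longrightarrow> (\<Sum>i\<in>I. sM (t i a) (e i)) = a"
begin

lemma nondegenerate_step:
  assumes z: "z \<in> words_span Y (Suc n)" and 0: "\<And>i. i \<in> I \<Longrightarrow> contract (t i) z = 0"
  shows "z = 0"
proof -
  obtain p where p: "keys p \<subseteq> {xs. set xs \<subseteq> Y \<and> length xs = Suc n}" "ev p = z"
    using words_span_ev[OF z] by blast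
  have "sM (of_nat (Suc n)) z = (\<Sum>i\<in>I. e i * contract (t i) (ev p))"
    using euler_formula[OF t e Y reconstruct p(1)] p(2) by simp
  also have "\<dots> = 0" using 0 p(2) by simp
  finally show ?thesis by (metis D1.scale_eq_0_iff of_nat_eq_0_iff nat.distinct(1))
qed

lemma scalar_zero: "x \<in> words_span Y 0 \<Longrightarrow> aug x = 0 \<Longrightarrow> x = 0"
  using GM_0_scalar[of x] words_span_GM[OF Y, of 0] by auto

lemma nondegenerate_2:
  assumes z: "z \<in> words_span Y 2" and 0: "\<And>i j. i \<in> I \<Longrightarrow> j \<in> I \<Longrightarrow> pair (t i) (t j) z = 0"
  shows "z = 0"
proof (rule nondegenerate_step)
  show z2: "z \<in> words_span Y (Suc 1)" using z by (simp add: numeral_2_eq_2)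
  fix i assume i: "i \<in> I"
  have z1: "contract (t i) z \<in> words_span Y (Suc 0)" using contract_words_span[OF t[OF i] Y z2] by simp
  show "contract (t i) z = 0"
    by (rule nondegenerate_step[OF z1], rule scalar_zero)
      (use 0 i contract_words_span[OF t Y z1] in \<open>auto simp: pair_def\<close>)
qed

lemma nondegenerate_3:
  assumes z: "z \<in> words_span Y 3"
    and 0: "\<And>i j k. i \<in> I \<Longrightarrow> j \<in> I \<Longrightarrow> k \<in> I \<Longrightarrow> aug (contract (t k) (contract (t j) (contract (t i) z))) = 0"
  shows "z = 0"
proof (rule nondegenerate_step)
  show z3: "z \<in> words_span Y (Suc 2)" using z by (simp add: numeral_3_eq_3 numeral_2_eq_2)
  fix i assume i: "i \<in> I"
  show "contract (t i) z = 0"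
    by (rule nondegenerate_2[OF contract_words_span[OF t[OF i] Y z3]])
      (use 0 i in \<open>simp add: pair_def\<close>)
qed

end

text \<open>The class of \<open>d w\<close> in the cohomology of the previous stage determines \<open>w\<close>.\<close>

lemma d_injective:
  assumes n: "n \<ge> 2" and w: "w \<in> V n" and dw: "d w = 0"
  shows "w = 0"
proof -
  have "inj_on (\<lambda>v. cohomology_class sM GM d (stage sM V (n - 1)) 1 (d v)) (V n)"
    using V_kernel[OF n] unfolding bij_betw_def by simp
  moreover have "0 \<in> V n" using subspace_V by (rule D1.subspace_0)
  ultimately show ?thesis using w by - (erule inj_onD, simp_all add: dw)
qed

section \<open>The homomorphism from the free algebra to the dual Lie algebra\<close>

definition W :: "('k, 'a \<Rightarrow> 'k) vspace" where
  "W = dual sA (GA 1)"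

lemma W_iff:
  "x \<in> vcarrier W \<longleftrightarrow> (\<forall>a\<in>GA 1. \<forall>b\<in>GA 1. x (a + b) = x a + x b) \<and>
     (\<forall>c. \<forall>a\<in>GA 1. x (sA c a) = c * x a) \<and> (\<forall>a. a \<notin> GA 1 \<longrightarrow> x a = 0)"
  unfolding W_def dual_def by simp

lemma \<phi>_add: "\<phi> (x + y) = \<phi> x + \<phi> y" and \<phi>_scale: "\<phi> (sM c x) = sA c (\<phi> x)"
  using linear_morphism unfolding Vector_Spaces.linear_def module_hom_def module_hom_axioms_def by auto

lemma \<phi>_zero [simp]: "\<phi> 0 = 0"
  using \<phi>_scale[of 0 0] by simp

lemma \<phi>_sum: "\<phi> (sum g I) = (\<Sum>i\<in>I. \<phi> (g i))"
  by (induction I rule: infinite_finite_induct) (simp_all add: \<phi>_add)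

text \<open>A functional on \<open>A\<^sup>1\<close> is pulled back along \<open>\<phi>\<close>, which vanishes on \<open>V j\<close> for \<open>j \<ge> 2\<close>; thus
  generators have weight one.\<close>

primrec psi_tree :: "('a \<Rightarrow> 'k) magma \<Rightarrow> 'm \<Rightarrow> 'k" where
  "psi_tree (Gen x) = (\<lambda>w. if w \<in> GM 1 then x (\<phi> w) else 0)"
| "psi_tree (Br s t) = bracket (psi_tree s) (psi_tree t)"

definition psi :: "(('a \<Rightarrow> 'k) magma \<Rightarrow>\<^sub>0 'k) \<Rightarrow> 'm \<Rightarrow> 'k" where
  "psi p w = K.lin_ext (\<lambda>t. psi_tree t w) p"

abbreviation trees where "trees \<equiv> {t. letters t \<subseteq> vcarrier W}"

definition homogeneous_trees :: "nat \<Rightarrow> ('a \<Rightarrow> 'k) magma set" where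
  "homogeneous_trees n = {t \<in> trees. magma_degree t = n}"

abbreviation F :: "('k, ('a \<Rightarrow> 'k) magma \<Rightarrow>\<^sub>0 'k) alg" where "F \<equiv> free_nonassoc W"

lemma F_simps [simp]:
  "vcarrier F = {p. keys p \<subseteq> trees}" "vadd F = (+)" "vzero F = 0"
  "vsmult F = pscale" "aprod F = mprod Br" "vdiff F p q = p - q"
  unfolding free_nonassoc_def by simp_all

lemma algebra_F: "algebra_on F"
  unfolding free_nonassoc_def by (rule algebra_on_magma_algebra) auto

lemma psi_tree_closed: "letters t \<subseteq> vcarrier W \<Longrightarrow> psi_tree t \<in> functionals"
proof (induction t)
  case (Gen x)
  then have x: "x \<in> vcarrier W" by simp
  have \<phi>1: "\<phi> w \<in> GA 1" if "w \<in> GM 1" for w using morphism_grade[OF that] .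
  show ?case
    unfolding functionals_iff[of "psi_tree (Gen x)"]
    using x GM_subspace[of 1] \<phi>1 unfolding W_iff
    by (auto simp: \<phi>_add \<phi>_scale D1.subspace_add D1.subspace_scale)
qed (simp add: bracket_closed)

lemma psi_zero [simp]: "psi 0 = (\<lambda>w. 0)"
  and psi_add: "psi (p + q) = (\<lambda>w. psi p w + psi q w)"
  and psi_diff: "psi (p - q) = (\<lambda>w. psi p w - psi q w)"
  and psi_pscale: "psi (pscale c p) = (\<lambda>w. c * psi p w)"
  and psi_single [simp]: "psi (single t c) = (\<lambda>w. c * psi_tree t w)"
  and psi_sum: "psi (sum g I) = (\<lambda>w. \<Sum>i\<in>I. psi (g i) w)"
  unfolding psi_def
  by (simp_all add: fun_eq_iff K.lin_ext_add K.lin_ext_diff K.lin_ext_pscale K.lin_ext_sum)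

lemma psi_closed: "keys p \<subseteq> trees \<Longrightarrow> psi p \<in> functionals"
proof (induction rule: poly_mapping_carrier_induct)
  case (single t c)
  then show ?case using functionals_scale[OF psi_tree_closed] by simp
qed (simp_all add: zero_functional psi_add functionals_add)

lemma bracket_zero: "u \<in> functionals \<Longrightarrow> bracket u (\<lambda>w. 0) = (\<lambda>w. 0)"
  "u \<in> functionals \<Longrightarrow> bracket (\<lambda>w. 0) u = (\<lambda>w. 0)"
  using bracket_bilinear(3)[OF zero_functional zero_functional, of u 0]
    bracket_bilinear(4)[OF zero_functional zero_functional, of u 0] by simp_all

lemma psi_mprod:
  assumes p: "keys p \<subseteq> trees" and q: "keys q \<subseteq> trees"
  shows "psi (mprod Br p q) = bracket (psi p) (psi q)"
  using p
proof (induction rule: poly_mapping_carrier_induct)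
  case (single s c)
  then have s: "psi_tree s \<in> functionals" using psi_tree_closed by simp
  have cs: "(\<lambda>w. c * psi_tree s w) \<in> functionals" by (rule functionals_scale[OF s])
  from q show ?case
  proof (induction rule: poly_mapping_carrier_induct)
    case (single t a)
    then have t: "psi_tree t \<in> functionals" using psi_tree_closed by simp
    show ?case
      using bracket_bilinear(3)[OF s s functionals_scale[OF t], of c a]
        bracket_bilinear(4)[OF t t s, of a] by simp
  next
    case (add p q)
    then show ?case
      using bracket_bilinear(2)[OF psi_closed psi_closed cs, of p q] by (simp add: psi_add mprod_linear)
  next
    case zero
    then show ?case using bracket_zero[OF cs] by (simp add: mprod_def)
  qed
next
  case (add p p')
  then show ?case
    using bracket_bilinear(1)[OF psi_closed psi_closed psi_closed[OF q], of p p']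
    by (simp add: psi_add mprod_linear)
next
  case zero
  then show ?case using bracket_zero[OF psi_closed[OF q]] by (simp add: mprod_def)
qed

lemma psi_tree_weight:
  assumes "letters t \<subseteq> vcarrier W" and "w \<in> V j" and "j \<noteq> magma_degree t"
  shows "psi_tree t w = 0"
  using assms
proof (induction t arbitrary: j w)
  case (Gen x)
  have "\<phi> w = 0"
  proof (cases "j = 0")
    case True
    then show ?thesis using Gen V_0 by simp
  next
    case False
    then show ?thesis using Gen \<phi>_V_higher[of j w] by simp
  qed
  moreover have "x 0 = 0"
  proof -
    have "0 \<in> GA 1" using D2.subspace_grade by (rule D2.subspace_0)
    moreover have "x \<in> vcarrier W" using Gen.prems by simp
    ultimately have "x (sA 0 0) = 0 * x 0" unfolding W_iff by blast
    then show ?thesis by simp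
  qed
  ultimately show ?case by simp
next
  case (Br s t)
  have st: "psi_tree s \<in> functionals" "psi_tree t \<in> functionals" using Br.prems psi_tree_closed by auto
  have s0: "psi_tree s w = 0" if "w \<in> V j" "j \<noteq> magma_degree s" for w j
    using Br.IH(1) Br.prems(1) that by auto
  have t0: "psi_tree t w = 0" if "w \<in> V j" "j \<noteq> magma_degree t" for w j
    using Br.IH(2) Br.prems(1) that by auto
  have "(\<Sum>l\<in>{()}. bracket (psi_tree s) (psi_tree t) w) = 0"
  proof (rule bracket_weight_zero[OF _ _ _ Br.prems(2)])
    fix i i' a b assume ab: "a \<in> V i" "b \<in> V i'" "i + i' = j"
    then have "i \<noteq> magma_degree s \<or> i' \<noteq> magma_degree t" "i' \<noteq> magma_degree s \<or> i \<noteq> magma_degree t"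
      using Br.prems by auto
    then have "psi_tree s a = 0 \<or> psi_tree t b = 0" "psi_tree s b = 0 \<or> psi_tree t a = 0"
      using s0[OF ab(1)] s0[OF ab(2)] t0[OF ab(1)] t0[OF ab(2)] by blast+
    then show "(\<Sum>l\<in>{()}. psi_tree s a * psi_tree t b - psi_tree s b * psi_tree t a) = 0" by auto
  qed (use st in auto)
  then show ?case by simp
qed

lemma psi_weight:
  assumes "keys p \<subseteq> homogeneous_trees n" and "w \<in> V j" and "j \<noteq> n"
  shows "psi p w = 0"
proof -
  have "psi p w = K.lin_ext (\<lambda>t. 0) p"
    unfolding psi_def
    by (rule K.lin_ext_cong) (use assms psi_tree_weight in \<open>auto simp: homogeneous_trees_def\<close>)
  then show ?thesis by simp
qed

lemma homogeneous_trees_subset: "homogeneous_trees n \<subseteq> trees"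
  unfolding homogeneous_trees_def by auto

lemma mprod_homogeneous:
  assumes "keys p \<subseteq> homogeneous_trees m" "keys q \<subseteq> homogeneous_trees n"
  shows "keys (mprod Br p q) \<subseteq> homogeneous_trees (m + n)"
proof -
  have "{Br s t | s t. s \<in> keys p \<and> t \<in> keys q} \<subseteq> homogeneous_trees (m + n)"
    using assms unfolding homogeneous_trees_def by fastforce
  then show ?thesis using keys_mprod[of Br p q] by blast
qed

subsection \<open>Frames\<close>

text \<open>A frame of \<open>V n\<close> consists of vectors together with homogeneous elements of degree \<open>n\<close> of the
  free algebra whose images play the role of the dual basis.\<close>

definition frame :: "nat \<Rightarrow> nat \<Rightarrow> (nat \<Rightarrow> 'm) \<Rightarrow> (nat \<Rightarrow> ('a \<Rightarrow> 'k) magma \<Rightarrow>\<^sub>0 'k) \<Rightarrow> bool" where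
  "frame n N e T \<longleftrightarrow> (\<forall>k<N. e k \<in> V n \<and> keys (T k) \<subseteq> homogeneous_trees n) \<and>
     (\<forall>w\<in>V n. w = (\<Sum>k<N. sM (psi (T k) w) (e k)))"

definition frame_index :: "(nat \<Rightarrow> nat) \<Rightarrow> nat \<Rightarrow> (nat \<times> nat) set" where
  "frame_index N n = (SIGMA j:{1..<n}. {..<N j})"

text \<open>The frames of the several weights can be used together, because the functionals of degree \<open>j\<close>
  vanish on the other weights.\<close>

lemma frames_reconstruct:
  assumes fr: "\<And>j. 1 \<le> j \<Longrightarrow> j < n \<Longrightarrow> frame j (N j) (E j) (T j)"
    and a: "a \<in> gens (n - 1)"
  shows "(\<Sum>(j, k)\<in>frame_index N n. sM (psi (T j k) a) (E j k)) = a"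
proof -
  obtain i where i: "1 \<le> i" "i < n" "a \<in> V i" using a by fastforce
  have "(\<Sum>(j, k)\<in>frame_index N n. sM (psi (T j k) a) (E j k)) =
      (\<Sum>j\<in>{1..<n}. \<Sum>k<N j. sM (psi (T j k) a) (E j k))"
    unfolding frame_index_def by (subst sum.Sigma) auto
  also have "\<dots> = (\<Sum>j\<in>{i}. \<Sum>k<N j. sM (psi (T j k) a) (E j k))"
  proof (rule sum.mono_neutral_right)
    show "\<forall>j\<in>{1..<n} - {i}. (\<Sum>k<N j. sM (psi (T j k) a) (E j k)) = 0"
    proof
      fix j assume j: "j \<in> {1..<n} - {i}"
      have "psi (T j k) a = 0" if "k < N j" for k
        using fr[of j] j that psi_weight[of "T j k" j a i] i unfolding frame_def by auto
      then show "(\<Sum>k<N j. sM (psi (T j k) a) (E j k)) = 0" by simp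
    qed
  qed (use i in auto)
  also have "\<dots> = a" using fr[of i] i unfolding frame_def by simp
  finally show ?thesis .
qed

lemma frame_index_props:
  assumes fr: "\<And>j. 1 \<le> j \<Longrightarrow> j < n \<Longrightarrow> frame j (N j) (E j) (T j)"
    and i: "i \<in> frame_index N n"
  shows "keys (T (fst i) (snd i)) \<subseteq> homogeneous_trees (fst i)"
    "E (fst i) (snd i) \<in> V (fst i)" "psi (T (fst i) (snd i)) \<in> functionals" "E (fst i) (snd i) \<in> GM 1"
    "1 \<le> fst i" "fst i < n"
proof -
  have "1 \<le> fst i" "fst i < n" "snd i < N (fst i)" using i unfolding frame_index_def by auto
  then show "keys (T (fst i) (snd i)) \<subseteq> homogeneous_trees (fst i)"
    "E (fst i) (snd i) \<in> V (fst i)" "1 \<le> fst i" "fst i < n"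
    using fr[of "fst i"] unfolding frame_def by auto
  then show "psi (T (fst i) (snd i)) \<in> functionals" "E (fst i) (snd i) \<in> GM 1"
    using psi_closed homogeneous_trees_subset V_subset by blast+
qed

text \<open>By nondegeneracy, the brackets of the dual vectors of lower weight have no common zero on \<open>V n\<close>,
  because such a zero \<open>w\<close> would satisfy \<open>d w = 0\<close>. So finitely many of them form the dual part of a
  frame.\<close>

lemma frame_step:
  assumes n: "n \<ge> 2" and fr: "\<And>j. 1 \<le> j \<Longrightarrow> j < n \<Longrightarrow> frame j (N j) (E j) (T j)"
  shows "\<exists>N e T. frame n N e T"
proof -
  let ?I = "frame_index N n"
  let ?T = "\<lambda>i. T (fst i) (snd i)"
  let ?II = "{(a, b) \<in> ?I \<times> ?I. fst a + fst b = n}"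
  let ?P = "\<lambda>ab. mprod Br (?T (fst ab)) (?T (snd ab))"
  have fI: "finite ?I" unfolding frame_index_def by auto
  then have fII: "finite ?II" by (auto intro: finite_subset[of _ "?I \<times> ?I"])
  have P: "keys (mprod Br (?T a) (?T b)) \<subseteq> homogeneous_trees (fst a + fst b)"
    "psi (mprod Br (?T a) (?T b)) = bracket (psi (?T a)) (psi (?T b))"
    if "a \<in> ?I" "b \<in> ?I" for a b
    using mprod_homogeneous[OF frame_index_props(1)[OF fr that(1)] frame_index_props(1)[OF fr that(2)]]
      psi_mprod frame_index_props(1)[OF fr that(1)] frame_index_props(1)[OF fr that(2)]
      homogeneous_trees_subset by blast+
  have closed: "psi (?P ab) \<in> functionals" if "ab \<in> ?II" for ab
    using P that psi_closed homogeneous_trees_subset[of n] by fastforce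
  have inj: "w = 0" if w: "w \<in> V n" and 0: "\<And>ab. ab \<in> ?II \<Longrightarrow> psi (?P ab) w = 0" for w
  proof -
    have w1: "w \<in> GM 1" using w V_subset by auto
    have "d w \<in> stage sM V (n - 1) \<inter> GM 2" using d_V_stage[OF n w] d_GM_1[OF w1] by simp
    then have "d w \<in> words_span (gens (n - 1)) 2" by (rule stage_words_span)
    then have "d w = 0"
    proof (rule nondegenerate_2[where I = "?I" and t = "\<lambda>i. psi (?T i)" and e = "\<lambda>i. E (fst i) (snd i)", rotated -2])
      fix a b assume ab: "a \<in> ?I" "b \<in> ?I"
      have "pair (psi (?T a)) (psi (?T b)) (d w) = psi (mprod Br (?T a) (?T b)) w"
        using P(2)[OF ab] w1 by (simp add: bracket_def)
      also have "\<dots> = 0"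
      proof (cases "fst a + fst b = n")
        case True
        then show ?thesis using 0[of "(a, b)"] ab by simp
      next
        case False
        then show ?thesis using psi_weight[OF P(1)[OF ab] w] by simp
      qed
      finally show "pair (psi (?T a)) (psi (?T b)) (d w) = 0" .
    next
      show "(\<Sum>i\<in>?I. sM (psi (?T i) a) (E (fst i) (snd i))) = a" if "a \<in> gens (n - 1)" for a
        using frames_reconstruct[OF fr that] by (simp add: case_prod_beta)
    qed (use gens_subset frame_index_props[OF fr] in auto)
    then show "w = 0" using d_injective[OF n w] by simp
  qed
  have "\<exists>N e g. (\<forall>k<N. e k \<in> V n \<and> g k \<in> ?II) \<and>
      (\<forall>u\<in>V n. u = (\<Sum>k<N::nat. sM (psi (?P (g k)) u) (e k)))"
  proof (rule M.frame_exists[OF fII subspace_V])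
    fix i u v assume "i \<in> ?II" "u \<in> V n" "v \<in> V n"
    then show "psi (?P i) (u + v) = psi (?P i) u + psi (?P i) v"
      using functional_add[OF closed] V_subset by blast
  next
    fix i u c assume "i \<in> ?II" "u \<in> V n"
    then show "psi (?P i) (sM c u) = c * psi (?P i) u"
      using functional_scale[OF closed] V_subset by blast
  qed (use inj in auto)
  then obtain N' e g where eg: "(\<forall>k<N'. e k \<in> V n \<and> g k \<in> ?II) \<and>
      (\<forall>u\<in>V n. u = (\<Sum>k<N'::nat. sM (psi (?P (g k)) u) (e k)))"
    by (elim exE)
  then have e: "\<And>k. k < N' \<Longrightarrow> e k \<in> V n" and g: "\<And>k. k < N' \<Longrightarrow> g k \<in> ?II" by simp_all
  have "keys (?P (g k)) \<subseteq> homogeneous_trees n" if "k < N'" for k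
    using g[OF that] P(1)[of "fst (g k)" "snd (g k)"] by auto
  then have "frame n N' e (\<lambda>k. ?P (g k))" unfolding frame_def using e eg by simp
  then show ?thesis by blast
qed

lemma \<phi>_1: "w \<in> GM 1 \<Longrightarrow> \<phi> w \<in> GA 1"
  using morphism_grade .

text \<open>Coordinates with respect to a basis of \<open>A\<^sup>1\<close>, pulled back along the bijection \<open>\<phi>\<close>.\<close>

lemma frame_1:
  assumes "\<exists>B. finite B \<and> D2.span B = GA 1"
  shows "\<exists>N e T. frame 1 N e T"
proof -
  obtain B where B: "finite B" "D2.span B = GA 1" using assms by blast
  obtain C where C: "C \<subseteq> B" "D2.independent C" "B \<subseteq> D2.span C"
    using D2.maximal_independent_subset by blast
  have fC: "finite C" using B C finite_subset by blast
  have sC: "D2.span C = GA 1"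
    using B C D2.span_mono[OF C(1)] D2.span_minimal[OF C(3)] by auto
  obtain h where h: "bij_betw h {0..<card C} C" using ex_bij_betw_nat_finite[OF fC] by blast
  define N where "N = card C"
  let ?r = "\<lambda>y. D2.representation C y"
  have rep: "(\<Sum>k<N. sA (?r y (h k)) (h k)) = y" if "y \<in> GA 1" for y
  proof -
    have "(\<Sum>k<N. sA (?r y (h k)) (h k)) = (\<Sum>c\<in>C. sA (?r y c) c)"
      unfolding N_def lessThan_atLeast0
      by (rule sum.reindex_bij_betw[OF h, of "\<lambda>c. sA (?r y c) c"])
    also have "\<dots> = y"
      by (rule D2.sum_representation_eq[OF C(2)]) (use that sC fC in auto)
    finally show ?thesis .
  qed
  define x where "x k y = (if y \<in> GA 1 then ?r y (h k) else 0)" for k y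
  have x: "x k \<in> vcarrier W" for k
    unfolding W_iff x_def using D2.subspace_grade[of 1] C(2) sC
    by (auto simp: D2.subspace_add D2.subspace_scale D2.representation_add D2.representation_scale)
  have hC: "h k \<in> GA 1" if "k < N" for k
    using h that D2.span_superset[of C] sC unfolding N_def bij_betw_def by auto
  define e where "e k = inv_into (V 1) \<phi> (h k)" for k
  have im: "\<phi> ` V 1 = GA 1" and inj: "inj_on \<phi> (V 1)" using \<phi>_V_1 unfolding bij_betw_def by auto
  have e: "e k \<in> V 1" "\<phi> (e k) = h k" if "k < N" for k
    using inv_into_into[of "h k" \<phi> "V 1"] f_inv_into_f[of "h k" \<phi> "V 1"] hC[OF that] im
    unfolding e_def by auto
  define T where "T k = single (Gen (x k)) (1::'k)" for k
  have psiT: "psi (T k) w = ?r (\<phi> w) (h k)" if "w \<in> V 1" for k w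
  proof -
    have "w \<in> GM 1" using that V_subset by auto
    then show ?thesis using \<phi>_1 by (simp add: T_def x_def)
  qed
  have "frame 1 N e T"
    unfolding frame_def
  proof (intro conjI allI impI ballI)
    fix k assume "k < N"
    then show "e k \<in> V 1" "keys (T k) \<subseteq> homogeneous_trees 1"
      using e x[of k] by (auto simp: T_def homogeneous_trees_def)
  next
    fix w assume w: "w \<in> V 1"
    have "\<phi> (\<Sum>k<N. sM (psi (T k) w) (e k)) = (\<Sum>k<N. sA (?r (\<phi> w) (h k)) (h k))"
      unfolding \<phi>_sum by (rule sum.cong) (use e psiT[OF w] in \<open>auto simp: \<phi>_scale\<close>)
    also have "\<dots> = \<phi> w" using rep im w by blast
    finally have "\<phi> (\<Sum>k<N. sM (psi (T k) w) (e k)) = \<phi> w" .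
    moreover have "(\<Sum>k<N. sM (psi (T k) w) (e k)) \<in> V 1"
      using e subspace_V by (intro D1.subspace_sum D1.subspace_scale) auto
    ultimately show "w = (\<Sum>k<N. sM (psi (T k) w) (e k))" using inj w by (auto dest: inj_onD)
  qed
  then show ?thesis by blast
qed

lemma frames_exist:
  assumes "\<exists>B. finite B \<and> D2.span B = GA 1"
  shows "\<exists>N E T. \<forall>n\<ge>1. frame n (N n) (E n) (T n)"
proof -
  have "\<exists>N e T. n \<ge> 1 \<longrightarrow> frame n N e T" for n
  proof (induction n rule: less_induct)
    case (less n)
    then obtain N E T where "\<And>j. j < n \<Longrightarrow> 1 \<le> j \<Longrightarrow> frame j (N j) (E j) (T j)" by metis
    then show ?case using frame_1[OF assms] frame_step[of n N E T] by (cases "n = 1"; cases "n = 0") auto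
  qed
  then show ?thesis by metis
qed

end

section \<open>The holonomy Lie algebra as a quotient of the free algebra\<close>

context canonical_one_minimal_model
begin

abbreviation H where "H \<equiv> holonomy sA GA"

definition hol :: "(('a \<Rightarrow> 'k) magma \<Rightarrow>\<^sub>0 'k) \<Rightarrow> (('a \<Rightarrow> 'k) magma \<Rightarrow>\<^sub>0 'k) set set" where
  "hol p = coset (free_lie W) (holonomy_ideal sA GA) (coset F (lie_ideal W) p)"

definition lie_relators :: "(('a \<Rightarrow> 'k) magma \<Rightarrow>\<^sub>0 'k) set" where
  "lie_relators = linear_relators W (\<lambda>x. single (Gen x) 1) \<union>
     {aprod F p p | p. p \<in> vcarrier F} \<union>
     {jacobiator F p q r | p q r. p \<in> vcarrier F \<and> q \<in> vcarrier F \<and> r \<in> vcarrier F}"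

lemma lie_ideal_eq: "lie_ideal W = ideal_gen F lie_relators"
  unfolding lie_ideal_def lie_relators_def Let_def ..

lemma W_simps: "vadd W = (\<lambda>f g x. f x + g x)" "vsmult W = (\<lambda>c f x. c * f x)"
  unfolding W_def dual_def by simp_all

lemma W_add: "x \<in> vcarrier W \<Longrightarrow> y \<in> vcarrier W \<Longrightarrow> (\<lambda>a. x a + y a) \<in> vcarrier W"
  unfolding W_iff by (simp add: distrib_left)

lemma W_scale: "x \<in> vcarrier W \<Longrightarrow> (\<lambda>a. c * x a) \<in> vcarrier W"
  unfolding W_iff by (simp add: distrib_left)

lemma W_zero: "(\<lambda>a. 0) \<in> vcarrier W"
  unfolding W_iff by simp

lemma F_add_closed: "keys p \<subseteq> trees \<Longrightarrow> keys q \<subseteq> trees \<Longrightarrow> keys (p + q) \<subseteq> trees"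
  for p q :: "('a \<Rightarrow> 'k) magma \<Rightarrow>\<^sub>0 'k"
  using keys_add[of p q] by blast

lemma F_diff_closed: "keys p \<subseteq> trees \<Longrightarrow> keys q \<subseteq> trees \<Longrightarrow> keys (p - q) \<subseteq> trees"
  for p q :: "('a \<Rightarrow> 'k) magma \<Rightarrow>\<^sub>0 'k"
  using keys_diff[of p q] by blast

lemma F_pscale_closed: "keys p \<subseteq> trees \<Longrightarrow> keys (pscale c p) \<subseteq> trees"
  using keys_pscale[of c p] by blast

lemma F_mprod_closed:
  assumes "keys p \<subseteq> trees" "keys q \<subseteq> trees"
  shows "keys (mprod Br p q) \<subseteq> trees"
proof -
  have "{Br s t | s t. s \<in> keys p \<and> t \<in> keys q} \<subseteq> trees"
    using assms by fastforce
  then show ?thesis using keys_mprod[of Br p q] by blast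
qed

lemmas F_closed = F_add_closed F_diff_closed F_pscale_closed F_mprod_closed

lemma gen_trees: "x \<in> vcarrier W \<Longrightarrow> keys (single (Gen x) c) \<subseteq> trees"
  by simp

lemma jacobiator_F:
  "jacobiator F p q r = mprod Br (mprod Br p q) r + mprod Br (mprod Br q r) p + mprod Br (mprod Br r p) q"
  unfolding jacobiator_def by simp

lemma lie_relators_subset: "lie_relators \<subseteq> vcarrier F"
proof -
  have "linear_relators W (\<lambda>x. single (Gen x) 1) \<subseteq> vcarrier F"
    unfolding linear_relators_def W_simps pscale_def[symmetric] F_simps
    by (intro Un_least subsetI; elim CollectE exE conjE; simp only: mem_Collect_eq)
      (intro F_closed(2) F_closed(3) gen_trees W_add W_scale; assumption)+
  moreover have "aprod F p q \<in> vcarrier F" if "p \<in> vcarrier F" "q \<in> vcarrier F" for p q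
    using F_closed(4) that by simp
  moreover have "jacobiator F p q r \<in> vcarrier F"
    if "p \<in> vcarrier F" "q \<in> vcarrier F" "r \<in> vcarrier F" for p q r
    unfolding jacobiator_F using that by (simp add: F_closed)
  ultimately show ?thesis unfolding lie_relators_def by blast
qed

lemma lie_ideal_ideal: "alg_ideal F (lie_ideal W)"
  unfolding lie_ideal_eq by (rule alg_ideal_ideal_gen[OF algebra_F lie_relators_subset])

lemma free_lie_epi: "alg_epi F (free_lie W) (coset F (lie_ideal W))"
  unfolding free_lie_def by (rule alg_epi_coset[OF algebra_F lie_ideal_ideal])

text \<open>A holonomy relator, lifted to the free algebra.\<close>

definition quadratic :: "(('a \<Rightarrow> 'k) \<times> ('a \<Rightarrow> 'k)) list \<Rightarrow> ('a \<Rightarrow> 'k) magma \<Rightarrow>\<^sub>0 'k" where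
  "quadratic ps = vsum F (map (\<lambda>(x, y). single (Br (Gen x) (Gen y)) 1) ps)"

lemma quadratic_simps [simp]: "quadratic [] = 0"
  "quadratic ((x, y) # ps) = single (Br (Gen x) (Gen y)) 1 + quadratic ps"
  unfolding quadratic_def vsum_def by simp_all

lemma quadratic_closed:
  "set ps \<subseteq> vcarrier W \<times> vcarrier W \<Longrightarrow> keys (quadratic ps) \<subseteq> trees"
proof (induction ps)
  case (Cons xy ps)
  obtain x y where "xy = (x, y)" by force
  then show ?case
    using Cons F_closed(1)[of "single (Br (Gen x) (Gen y)) 1" "quadratic ps"] by simp
qed simp

lemma quadratic_coset:
  assumes "set ps \<subseteq> vcarrier W \<times> vcarrier W"
  shows "vsum (free_lie W) (map (\<lambda>(x, y). aprod (free_lie W) (free_lie_gen W x) (free_lie_gen W y)) ps)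
    = coset F (lie_ideal W) (quadratic ps)"
proof -
  let ?c = "coset F (lie_ideal W)"
  have "?c (single (Br (Gen x) (Gen y)) 1) =
      aprod (free_lie W) (free_lie_gen W x) (free_lie_gen W y)"
    if "x \<in> vcarrier W" "y \<in> vcarrier W" for x y
  proof -
    have "\<forall>p\<in>vcarrier F. \<forall>q\<in>vcarrier F. ?c (aprod F p q) = aprod (free_lie W) (?c p) (?c q)"
      using free_lie_epi unfolding alg_epi_def by blast
    from bspec[OF bspec[OF this, of "single (Gen x) 1"], of "single (Gen y) 1"]
    have "?c (aprod F (single (Gen x) 1) (single (Gen y) 1)) =
        aprod (free_lie W) (?c (single (Gen x) 1)) (?c (single (Gen y) 1))"
      using that by simp
    then show ?thesis by (simp add: free_lie_gen_def)
  qed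
  then have e: "map (\<lambda>(x, y). aprod (free_lie W) (free_lie_gen W x) (free_lie_gen W y)) ps =
      map ?c (map (\<lambda>(x, y). single (Br (Gen x) (Gen y)) 1) ps)"
    using assms by auto
  show ?thesis
    unfolding quadratic_def e
    by (rule alg_epi_vsum[OF algebra_F free_lie_epi, symmetric]) (use assms in auto)
qed

definition quadratic_relation :: "(('a \<Rightarrow> 'k) \<times> ('a \<Rightarrow> 'k)) list \<Rightarrow> ('a \<Rightarrow> 'k) \<Rightarrow> bool" where
  "quadratic_relation ps \<alpha> \<longleftrightarrow> set ps \<subseteq> vcarrier W \<times> vcarrier W \<and>
     \<alpha> \<in> vcarrier (dual sA (GA 2)) \<and>
     (\<forall>a\<in>GA 1. \<forall>b\<in>GA 1. (\<Sum>(x, y)\<leftarrow>ps. x a * y b - x b * y a) = \<alpha> (a * b))"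

lemma holonomy_relators_eq:
  "holonomy_relators sA GA = {coset F (lie_ideal W) (quadratic ps) | ps \<alpha>. quadratic_relation ps \<alpha>}"
  unfolding holonomy_relators_def Let_def quadratic_relation_def W_def[symmetric]
  using quadratic_coset by blast

lemma algebra_free_lie: "algebra_on (free_lie W)"
  by (rule algebra_on_epi[OF algebra_F free_lie_epi])

lemma holonomy_ideal_ideal: "alg_ideal (free_lie W) (holonomy_ideal sA GA)"
  unfolding holonomy_ideal_def W_def[symmetric]
proof (rule alg_ideal_ideal_gen[OF algebra_free_lie])
  have "vcarrier (free_lie W) = coset F (lie_ideal W) ` vcarrier F"
    using free_lie_epi unfolding alg_epi_def by simp
  then show "holonomy_relators sA GA \<subseteq> vcarrier (free_lie W)"
    unfolding holonomy_relators_eq using quadratic_closed by (auto simp: quadratic_relation_def)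
qed

lemma hol_epi: "alg_epi F H hol"
proof -
  have "alg_epi (free_lie W) H (coset (free_lie W) (holonomy_ideal sA GA))"
    unfolding holonomy_def W_def[symmetric] by (rule alg_epi_coset[OF algebra_free_lie holonomy_ideal_ideal])
  from alg_epi_comp[OF free_lie_epi this] show ?thesis by (simp add: hol_def[abs_def])
qed

lemma algebra_H: "algebra_on H"
  by (rule algebra_on_epi[OF algebra_F hol_epi])

definition hol_kernel :: "(('a \<Rightarrow> 'k) magma \<Rightarrow>\<^sub>0 'k) set" where
  "hol_kernel = {p \<in> vcarrier F. hol p = vzero H}"

lemma hol_kernel_ideal: "alg_ideal F hol_kernel"
  unfolding hol_kernel_def by (rule alg_ideal_kernel[OF algebra_F hol_epi])

lemma hol_kernel_zero: "0 \<in> hol_kernel"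
  and hol_kernel_add: "p \<in> hol_kernel \<Longrightarrow> q \<in> hol_kernel \<Longrightarrow> p + q \<in> hol_kernel"
  and hol_kernel_pscale: "p \<in> hol_kernel \<Longrightarrow> pscale c p \<in> hol_kernel"
  and hol_kernel_mprod_left: "keys q \<subseteq> trees \<Longrightarrow> p \<in> hol_kernel \<Longrightarrow> mprod Br q p \<in> hol_kernel"
  and hol_kernel_mprod_right: "keys q \<subseteq> trees \<Longrightarrow> p \<in> hol_kernel \<Longrightarrow> mprod Br p q \<in> hol_kernel"
  using hol_kernel_ideal unfolding alg_ideal_def vsubspace_def by auto

lemma hol_kernel_diff: "p \<in> hol_kernel \<Longrightarrow> q \<in> hol_kernel \<Longrightarrow> p - q \<in> hol_kernel"
proof -
  assume "p \<in> hol_kernel" "q \<in> hol_kernel"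
  then have "p + pscale (- 1) q \<in> hol_kernel" by (intro hol_kernel_add hol_kernel_pscale)
  moreover have "p + pscale (- 1) q = p - q" by (rule poly_mapping_eqI) (simp add: lookup_add lookup_minus)
  ultimately show ?thesis by simp
qed

lemma hol_eq_iff:
  assumes "keys p \<subseteq> trees" "keys q \<subseteq> trees"
  shows "hol p = hol q \<longleftrightarrow> p - q \<in> hol_kernel"
proof -
  interpret H: carrier_vector_space H using algebra_H by (rule algebra_on_vs)
  have c: "hol p \<in> vcarrier H" "hol q \<in> vcarrier H"
    using hol_epi assms unfolding alg_epi_def by auto
  have "hol (vdiff F p q) = vdiff H (hol p) (hol q)"
    by (rule alg_epi_vdiff[OF algebra_F hol_epi]) (use assms in auto)
  then show ?thesis
    using H.vdiff_eq_zero[OF c] F_closed(2)[OF assms] unfolding hol_kernel_def by simp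
qed

lemma lie_relators_hol_kernel: "lie_relators \<subseteq> hol_kernel"
proof
  fix p assume p: "p \<in> lie_relators"
  interpret F: carrier_vector_space F using algebra_F by (rule algebra_on_vs)
  have pF: "p \<in> vcarrier F" using p lie_relators_subset by blast
  have "p \<in> lie_ideal W" unfolding lie_ideal_eq by (rule subsetD[OF ideal_gen_superset p])
  then have "coset F (lie_ideal W) p = coset F (lie_ideal W) 0"
    using F.coset_eq_iff[of "lie_ideal W" p 0] lie_ideal_ideal pF unfolding alg_ideal_def by simp
  moreover have "hol 0 = vzero H" using hol_epi unfolding alg_epi_def by simp
  ultimately show "p \<in> hol_kernel" using pF unfolding hol_kernel_def hol_def by simp
qed

lemma quadratic_hol_kernel:
  assumes "quadratic_relation ps \<alpha>"
  shows "quadratic ps \<in> hol_kernel"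
proof -
  interpret L: carrier_vector_space "free_lie W" using algebra_free_lie by (rule algebra_on_vs)
  have q: "quadratic ps \<in> vcarrier F" using quadratic_closed assms by (simp add: quadratic_relation_def)
  let ?c = "coset F (lie_ideal W)"
  have c: "?c (quadratic ps) \<in> vcarrier (free_lie W)" "?c 0 = vzero (free_lie W)"
    using free_lie_epi q unfolding alg_epi_def by auto
  have "?c (quadratic ps) \<in> holonomy_ideal sA GA"
    unfolding holonomy_ideal_def W_def[symmetric]
  proof (rule subsetD[OF ideal_gen_superset])
    show "?c (quadratic ps) \<in> holonomy_relators sA GA"
      unfolding holonomy_relators_eq using assms by blast
  qed
  moreover have "vdiff (free_lie W) (?c (quadratic ps)) (?c 0) = ?c (quadratic ps)"
    using c by (simp add: vdiff_def)
  ultimately have "hol (quadratic ps) = hol 0"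
    using L.coset_eq_iff[of "holonomy_ideal sA GA" "?c (quadratic ps)" "?c 0"] holonomy_ideal_ideal c
    unfolding alg_ideal_def hol_def by simp
  moreover have "hol 0 = vzero H" using hol_epi unfolding alg_epi_def by simp
  ultimately show ?thesis using q unfolding hol_kernel_def by simp
qed

lemma dual_GA_2_iff:
  "\<alpha> \<in> vcarrier (dual sA (GA 2)) \<longleftrightarrow> (\<forall>a\<in>GA 2. \<forall>b\<in>GA 2. \<alpha> (a + b) = \<alpha> a + \<alpha> b) \<and>
     (\<forall>c. \<forall>a\<in>GA 2. \<alpha> (sA c a) = c * \<alpha> a) \<and> (\<forall>a. a \<notin> GA 2 \<longrightarrow> \<alpha> a = 0)"
  unfolding dual_def by simp

text \<open>By the defining property of \<open>\<alpha>\<close>, the image pairs with a two-form \<open>z\<close> as \<open>\<alpha> (\<phi> z)\<close>. For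
  \<open>z = d w\<close> this is zero because the differential of the target of \<open>\<phi>\<close> is zero.\<close>

lemma psi_quadratic:
  assumes r: "quadratic_relation ps \<alpha>"
  shows "psi (quadratic ps) = (\<lambda>w. 0)"
proof
  fix w
  let ?g = "\<lambda>x. psi_tree (Gen x)"
  have ps: "set ps \<subseteq> vcarrier W \<times> vcarrier W" using r unfolding quadratic_relation_def by simp
  have g: "\<forall>xy\<in>set ps. ?g (fst xy) \<in> functionals \<and> ?g (snd xy) \<in> functionals"
  proof
    fix xy assume "xy \<in> set ps"
    then have "fst xy \<in> vcarrier W" "snd xy \<in> vcarrier W" using ps by auto
    then show "?g (fst xy) \<in> functionals \<and> ?g (snd xy) \<in> functionals"
      using psi_tree_closed[of "Gen (fst xy)"] psi_tree_closed[of "Gen (snd xy)"] by simp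
  qed
  have e: "psi (quadratic ps) w = (\<Sum>(x, y)\<leftarrow>ps. bracket (?g x) (?g y) w)"
    by (induction ps) (auto simp: psi_add)
  show "psi (quadratic ps) w = 0"
  proof (cases "w \<in> GM 1")
    case False
    then show ?thesis unfolding e by (induction ps) (auto simp: bracket_def)
  next
    case True
    have \<phi>2: "\<phi> z \<in> GA 2" if "z \<in> GM 2" for z using morphism_grade[OF that] .
    have \<alpha>: "\<And>a b. a \<in> GA 2 \<Longrightarrow> b \<in> GA 2 \<Longrightarrow> \<alpha> (a + b) = \<alpha> a + \<alpha> b"
      "\<And>a c. a \<in> GA 2 \<Longrightarrow> \<alpha> (sA c a) = c * \<alpha> a"
      using r unfolding quadratic_relation_def dual_GA_2_iff by auto
    let ?f = "\<lambda>z. \<Sum>(x, y)\<leftarrow>ps. pair (?g x) (?g y) z"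
    have "?f (d w) = \<alpha> (\<phi> (d w))"
    proof (rule GM_2_linear_eq[where f = ?f and g = "\<lambda>z. \<alpha> (\<phi> z)"])
      show "?f (x + y) = ?f x + ?f y" for x y
        using g by (induction ps) (auto simp: pair_add simp del: psi_tree.simps)
      show "?f (sM c x) = c * ?f x" for c x
        using g by (induction ps) (auto simp: pair_scale distrib_left simp del: psi_tree.simps)
      fix a b assume ab: "a \<in> GM 1" "b \<in> GM 1"
      have gv: "?g x a = x (\<phi> a)" "?g x b = x (\<phi> b)" for x using ab by simp_all
      have "?f (a * b) = (\<Sum>(x, y)\<leftarrow>ps. x (\<phi> a) * y (\<phi> b) - x (\<phi> b) * y (\<phi> a))"
        using g ab gv by (induction ps) (auto simp: pair_mult simp del: psi_tree.simps)
      also have "\<dots> = \<alpha> (\<phi> a * \<phi> b)"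
        using r ab \<phi>_1 unfolding quadratic_relation_def by blast
      finally show "?f (a * b) = \<alpha> (\<phi> (a * b))" by (simp add: morphism_mult)
    qed (use True d_GM_1 \<phi>2 \<alpha> in \<open>auto simp: \<phi>_add \<phi>_scale\<close>)
    also have "\<phi> (d w) = 0" using morphism_d by simp
    also have "\<alpha> 0 = 0"
      using \<alpha>(2)[of 0 0] D2.subspace_0[OF D2.subspace_grade] by simp
    finally have "?f (d w) = 0" .
    then show ?thesis unfolding e using True by (simp add: bracket_def)
  qed
qed

text \<open>The homomorphism to the dual Lie algebra respects all relations, so it factors through the
  holonomy Lie algebra.\<close>

lemma psi_hol_kernel:
  assumes p: "p \<in> hol_kernel"
  shows "psi p = (\<lambda>w. 0)"
proof -
  define K where "K = {p. keys p \<subseteq> trees \<and> psi p = (\<lambda>w. 0)}"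
  have K: "alg_ideal F K"
    unfolding alg_ideal_def vsubspace_def K_def
    by (intro conjI ballI allI)
      (simp_all add: F_closed psi_add psi_pscale psi_mprod psi_closed bracket_zero Collect_mono)
  have L: "lie_algebra dual_lie" by (rule lie_algebra_dual_lie)
  have "lie_relators \<subseteq> K"
  proof
    fix p assume p: "p \<in> lie_relators"
    then have "keys p \<subseteq> trees" using lie_relators_subset by auto
    moreover have "psi p = (\<lambda>w. 0)"
      using p unfolding lie_relators_def
    proof (elim UnE)
      assume "p \<in> linear_relators W (\<lambda>x. single (Gen x) 1)"
      then show ?thesis
        unfolding linear_relators_def W_simps pscale_def[symmetric] by (auto simp: psi_diff)
    next
      assume "p \<in> {aprod F p p | p. p \<in> vcarrier F}"
      then show ?thesis
        using psi_mprod psi_closed bracket_bilinear(5) zero_functional by auto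
    next
      assume "p \<in> {jacobiator F p q r | p q r. p \<in> vcarrier F \<and> q \<in> vcarrier F \<and> r \<in> vcarrier F}"
      then obtain a b c where abc: "a \<in> vcarrier F" "b \<in> vcarrier F" "c \<in> vcarrier F"
        and p: "p = jacobiator F a b c" by blast
      have "psi p = jacobiator dual_lie (psi a) (psi b) (psi c)"
        unfolding p jacobiator_F jacobiator_def using abc
        by (simp add: psi_add psi_mprod F_closed)
      also have "\<dots> = (\<lambda>w. 0)" using L abc psi_closed unfolding lie_algebra_def by simp
      finally show ?thesis .
    qed
    ultimately show "p \<in> K" unfolding K_def by simp
  qed
  then have 1: "lie_ideal W \<subseteq> K" unfolding lie_ideal_eq by (rule ideal_gen_least[OF K])
  have 2: "holonomy_relators sA GA \<subseteq> coset F (lie_ideal W) ` K"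
  proof
    fix C assume "C \<in> holonomy_relators sA GA"
    then obtain ps \<alpha> where ps: "C = coset F (lie_ideal W) (quadratic ps)" "quadratic_relation ps \<alpha>"
      unfolding holonomy_relators_eq by blast
    have "quadratic ps \<in> K"
      unfolding K_def using psi_quadratic[OF ps(2)] quadratic_closed ps(2) unfolding quadratic_relation_def by simp
    then show "C \<in> coset F (lie_ideal W) ` K" using ps by blast
  qed
  interpret L: carrier_vector_space "free_lie W" using algebra_free_lie by (rule algebra_on_vs)
  let ?c = "coset F (lie_ideal W)"
  have pF: "p \<in> vcarrier F" using p unfolding hol_kernel_def by simp
  have c: "?c p \<in> vcarrier (free_lie W)" "?c 0 = vzero (free_lie W)"
    using free_lie_epi pF unfolding alg_epi_def by auto
  have "hol 0 = vzero H" using hol_epi unfolding alg_epi_def by simp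
  then have "hol p = hol 0" using p unfolding hol_kernel_def by simp
  then have "vdiff (free_lie W) (?c p) (?c 0) \<in> holonomy_ideal sA GA"
    using L.coset_eq_iff[of "holonomy_ideal sA GA" "?c p" "?c 0"] holonomy_ideal_ideal c
    unfolding alg_ideal_def hol_def by simp
  then have "?c p \<in> ideal_gen (quotient_alg F (lie_ideal W)) (holonomy_relators sA GA)"
  proof -
    have "vdiff (free_lie W) (?c p) (?c 0) = ?c p" using c by (simp add: vdiff_def)
    moreover have "holonomy_ideal sA GA = ideal_gen (quotient_alg F (lie_ideal W)) (holonomy_relators sA GA)"
      unfolding holonomy_ideal_def W_def[symmetric] free_lie_def[of W] ..
    ultimately show ?thesis using \<open>vdiff (free_lie W) (?c p) (?c 0) \<in> holonomy_ideal sA GA\<close> by simp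
  qed
  then have "p \<in> K" by (rule quotient_kernel_least[OF algebra_F lie_ideal_ideal K 1 2 pF])
  then show ?thesis unfolding K_def by simp
qed

end

section \<open>Injectivity\<close>

context canonical_one_minimal_model
begin

lemma square_hol_kernel:
  assumes "keys p \<subseteq> trees"
  shows "mprod Br p p \<in> hol_kernel"
proof -
  have "aprod F p p \<in> lie_relators" unfolding lie_relators_def using assms by (simp, blast)
  then show ?thesis using lie_relators_hol_kernel by auto
qed

lemma jacobi_hol_kernel:
  assumes "keys p \<subseteq> trees" "keys q \<subseteq> trees" "keys r \<subseteq> trees"
  shows "mprod Br (mprod Br p q) r + mprod Br (mprod Br q r) p + mprod Br (mprod Br r p) q \<in> hol_kernel"
proof -
  have "jacobiator F p q r \<in> lie_relators" unfolding lie_relators_def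
    by (intro UnI2 CollectI exI[of _ p] exI[of _ q] exI[of _ r]) (use assms in simp)
  then show ?thesis using lie_relators_hol_kernel by (auto simp: jacobiator_F)
qed

lemma gen_add_kernel:
  assumes "x \<in> vcarrier W" "y \<in> vcarrier W"
  shows "single (Gen (\<lambda>a. x a + y a)) 1 - single (Gen x) 1 -
    single (Gen y) 1 \<in> hol_kernel"
proof -
  have "single (Gen (vadd W x y)) 1 - single (Gen x) 1 -
    single (Gen y) 1 \<in> lie_relators"
    unfolding lie_relators_def linear_relators_def using assms by blast
  then show ?thesis using lie_relators_hol_kernel by (auto simp: W_simps)
qed

lemma gen_scale_kernel:
  assumes "x \<in> vcarrier W"
  shows "single (Gen (\<lambda>a. c * x a)) 1 - single (Gen x) c \<in> hol_kernel"
proof -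
  have "single (Gen (vsmult W c x)) 1 - pscale c (single (Gen x) 1) \<in> lie_relators"
    unfolding lie_relators_def linear_relators_def pscale_def using assms by blast
  then show ?thesis using lie_relators_hol_kernel by (auto simp: W_simps)
qed

lemma hol_kernel_uminus: "p \<in> hol_kernel \<Longrightarrow> - p \<in> hol_kernel"
  using hol_kernel_diff[OF hol_kernel_zero] by simp

text \<open>The linear relations combine a sum of multiples of generators into a single generator.\<close>

lemma degree_1_generator:
  assumes "keys p \<subseteq> homogeneous_trees 1"
  shows "\<exists>x\<in>vcarrier W. p - single (Gen x) 1 \<in> hol_kernel"
  using assms
proof (induction rule: poly_mapping_carrier_induct)
  case zero
  have "single (Gen (\<lambda>a. 0)) 1 \<in> hol_kernel"
    using gen_scale_kernel[OF W_zero, of 0] by simp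
  then show ?case using W_zero hol_kernel_uminus by fastforce
next
  case (single t c)
  have "magma_degree s \<ge> 1" for s :: "('a \<Rightarrow> 'k) magma" by (induction s) auto
  then have ge: "magma_degree s > 0" for s :: "('a \<Rightarrow> 'k) magma" by (metis less_eq_Suc_le One_nat_def)
  obtain x where x: "t = Gen x" "x \<in> vcarrier W"
  proof (cases t)
    case (Gen x)
    then show ?thesis using that single by (auto simp: homogeneous_trees_def)
  next
    case (Br a b)
    then show ?thesis using single ge[of a] ge[of b] by (auto simp: homogeneous_trees_def)
  qed
  have "single t c - single (Gen (\<lambda>a. c * x a)) 1 =
      - (single (Gen (\<lambda>a. c * x a)) 1 - single (Gen x) c)"
    using x by simp
  then show ?case
    using hol_kernel_uminus[OF gen_scale_kernel[OF x(2), of c]] W_scale[OF x(2), of c] by fastforce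
next
  case (add p q)
  then obtain x y where x: "x \<in> vcarrier W" "p - single (Gen x) 1 \<in> hol_kernel"
    and y: "y \<in> vcarrier W" "q - single (Gen y) 1 \<in> hol_kernel" by blast
  let ?xy = "\<lambda>a. x a + y a"
  have "(p - single (Gen x) 1) + (q - single (Gen y) 1) -
      (single (Gen ?xy) 1 - single (Gen x) 1 - single (Gen y) 1)
      \<in> hol_kernel"
    by (intro hol_kernel_diff hol_kernel_add x y gen_add_kernel)
  moreover have "(p - single (Gen x) 1) + (q - single (Gen y) 1) -
      (single (Gen ?xy) 1 - single (Gen x) 1 - single (Gen y) 1)
      = p + q - single (Gen ?xy) 1" by simp
  ultimately show ?case using W_add[OF x(1) y(1)] by (intro bexI[of _ ?xy]) simp_all
qed

lemma psi_diff_kernel: "p - q \<in> hol_kernel \<Longrightarrow> psi p = psi q"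
  using psi_hol_kernel[of "p - q"] by (simp add: psi_diff fun_eq_iff)

lemma \<phi>_V_1_surj: "y \<in> GA 1 \<Longrightarrow> \<exists>w\<in>V 1. \<phi> w = y"
  using \<phi>_V_1 unfolding bij_betw_def by (metis imageE)

lemma psi_injective_1:
  assumes p: "keys p \<subseteq> homogeneous_trees 1" and 0: "psi p = (\<lambda>w. 0)"
  shows "p \<in> hol_kernel"
proof -
  obtain x where x: "x \<in> vcarrier W" "p - single (Gen x) 1 \<in> hol_kernel"
    using degree_1_generator[OF p] by blast
  have g: "psi_tree (Gen x) = (\<lambda>w. 0)" using psi_diff_kernel[OF x(2)] 0 by simp
  have "x = (\<lambda>a. 0)"
  proof
    fix a show "x a = 0"
    proof (cases "a \<in> GA 1")
      case True
      then obtain w where "w \<in> V 1" "\<phi> w = a" using \<phi>_V_1_surj by blast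
      moreover have "w \<in> GM 1" using calculation(1) V_subset by blast
      ultimately show ?thesis using fun_cong[OF g, of w] by simp
    next
      case False
      then show ?thesis using x(1) unfolding W_iff by blast
    qed
  qed
  then have "single (Gen x) 1 \<in> hol_kernel"
    using gen_scale_kernel[OF W_zero, of 0] by simp
  from hol_kernel_add[OF x(2) this] show ?thesis by simp
qed

lemma functional_words_span_1:
  assumes u: "u \<in> functionals" and Y: "Y \<subseteq> GM 1" "\<And>y. y \<in> Y \<Longrightarrow> u y = 0" and s: "s \<in> words_span Y 1"
  shows "u s = 0"
proof -
  have "s \<in> GM 1 \<and> u s = 0"
    using s unfolding words_span_def
  proof (induction rule: D1.span_induct_alt)
    case base
    then show ?case using functional_zero[OF u] GM_subspace by (simp add: D1.subspace_0)
  next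
    case (step c x y)
    then obtain a where a: "x = a" "a \<in> Y" by (auto simp: length_Suc_conv)
    then have "a \<in> GM 1" "u a = 0" using Y by auto
    moreover have "sM c a \<in> GM 1" using calculation GM_subspace by (simp add: D1.subspace_scale)
    ultimately show ?case
      using step a GM_subspace functional_add[OF u] functional_scale[OF u] by (simp add: D1.subspace_add)
  qed
  then show ?thesis by simp
qed

lemma subspace_words_span: "D1.subspace (words_span Y m)"
  unfolding words_span_def by simp

lemma d_words_span:
  assumes "1 \<le> j" "j \<le> m" "w \<in> V j"
  shows "d w \<in> words_span (gens m) 2"
proof (cases "j = 1")
  case True
  then show ?thesis using d_V_1 assms by (simp add: words_span_def D1.span_zero)
next
  case False
  then have "d w \<in> stage sM V (j - 1)" using d_V_stage assms by simp
  moreover have "d w \<in> GM 2" using d_GM_1 assms V_subset by blast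
  moreover have "stage sM V (j - 1) \<subseteq> stage sM V m" using assms by (intro stage_mono) simp
  ultimately show ?thesis by (intro stage_words_span) blast
qed

text \<open>The inductive step. In it, \<open>lam\<close> is an arbitrary functional on the free algebra which kills the
  relations. Its restriction to products of degree \<open>n\<close> is an alternating bilinear form on the part of
  the holonomy Lie algebra of degree below \<open>n\<close>, which is known by induction, hence a two-form
  \<open>cocycle\<close> on the model. The Jacobi identity makes it closed, and the holonomy relations make its
  image in the algebra zero.\<close>

context
  fixes n :: nat and N :: "nat \<Rightarrow> nat" and E :: "nat \<Rightarrow> nat \<Rightarrow> 'm"
    and T :: "nat \<Rightarrow> nat \<Rightarrow> ('a \<Rightarrow> 'k) magma \<Rightarrow>\<^sub>0 'k" and lam :: "(('a \<Rightarrow> 'k) magma \<Rightarrow>\<^sub>0 'k) \<Rightarrow> 'k"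
  assumes n: "n \<ge> 2"
    and fr: "\<And>j. 1 \<le> j \<Longrightarrow> j < n \<Longrightarrow> frame j (N j) (E j) (T j)"
    and IH: "\<And>m p. m < n \<Longrightarrow> keys p \<subseteq> homogeneous_trees m \<Longrightarrow> psi p = (\<lambda>w. 0) \<Longrightarrow> p \<in> hol_kernel"
    and lam_add: "\<And>p q. lam (p + q) = lam p + lam q"
    and lam_scale: "\<And>c p. lam (pscale c p) = c * lam p"
    and lam_kernel: "\<And>p. p \<in> hol_kernel \<Longrightarrow> lam p = 0"
begin

abbreviation (input) Ix where "Ix \<equiv> frame_index N n"
abbreviation (input) Tx where "Tx i \<equiv> T (fst i) (snd i)"
abbreviation (input) Ex where "Ex i \<equiv> E (fst i) (snd i)"
abbreviation (input) pairs where "pairs \<equiv> {(a, b) \<in> Ix \<times> Ix. fst a + fst b = n}"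

text \<open>Each unordered pair of distinct frame vectors occurs twice in the sum, which explains the factor.\<close>

definition cocycle :: 'm where
  "cocycle = sM (1 / 2) (\<Sum>(a, b)\<in>pairs. sM (lam (mprod Br (Tx a) (Tx b))) (Ex a * Ex b))"

lemma lam_zero: "lam 0 = 0"
  using lam_add[of 0 0] by simp

lemma lam_sum: "lam (sum g I) = (\<Sum>i\<in>I. lam (g i))"
  by (induction I rule: infinite_finite_induct) (simp_all add: lam_add lam_zero)

lemma finite_Ix: "finite Ix"
  unfolding frame_index_def by auto

lemma finite_pairs: "finite pairs"
  by (rule finite_subset[of _ "Ix \<times> Ix"]) (auto simp: finite_Ix)

lemmas Ix_props = frame_index_props[OF fr]

lemma Tx_trees: "i \<in> Ix \<Longrightarrow> keys (Tx i) \<subseteq> trees"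
  using Ix_props(1) homogeneous_trees_subset by blast

lemma lam_swap:
  assumes "keys p \<subseteq> trees" "keys q \<subseteq> trees"
  shows "lam (mprod Br q p) = - lam (mprod Br p q)"
proof -
  have "lam (mprod Br (p + q) (p + q)) = 0"
    by (intro lam_kernel square_hol_kernel F_add_closed assms)
  moreover have "lam (mprod Br p p) = 0" "lam (mprod Br q q) = 0"
    by (intro lam_kernel square_hol_kernel assms)+
  ultimately have "lam (mprod Br p q) + lam (mprod Br q p) = 0"
    by (simp add: mprod_linear lam_add add.commute)
  then show ?thesis by (simp add: eq_neg_iff_add_eq_0 add.commute)
qed

text \<open>Both sides have the same image under \<open>psi\<close>, so the induction hypothesis applies to their
  difference.\<close>

lemma expand_kernel:
  assumes m: "1 \<le> m" "m < n" and q: "keys q \<subseteq> homogeneous_trees m"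
  shows "q - (\<Sum>i\<in>Ix. pscale (psi q (Ex i)) (Tx i)) \<in> hol_kernel"
proof -
  let ?q = "\<Sum>i\<in>Ix. pscale (psi q (Ex i)) (Tx i)"
  have qf: "psi q \<in> functionals" using q psi_closed homogeneous_trees_subset by blast
  have "keys (pscale (psi q (Ex i)) (Tx i)) \<subseteq> homogeneous_trees m" if i: "i \<in> Ix" for i
  proof (cases "fst i = m")
    case True
    then show ?thesis using keys_pscale[of "psi q (Ex i)" "Tx i"] Ix_props(1)[OF _ _ i] by blast
  next
    case False
    then have "psi q (Ex i) = 0" using psi_weight[OF q Ix_props(2)[OF _ _ i]] by blast
    then have "pscale (psi q (Ex i)) (Tx i) = 0" by (intro poly_mapping_eqI) simp
    then show ?thesis by simp
  qed
  then have q': "keys ?q \<subseteq> homogeneous_trees m" by (rule keys_sum_subset)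
  have d: "keys (q - ?q) \<subseteq> homogeneous_trees m" using keys_diff[of q ?q] q q' by blast
  have "psi (q - ?q) = (\<lambda>w. 0)"
  proof (rule functionals_eqI)
    show "psi (q - ?q) \<in> functionals" using d psi_closed homogeneous_trees_subset by blast
    fix j w assume j: "1 \<le> j" and w: "w \<in> V j"
    show "psi (q - ?q) w = 0"
    proof (cases "j = m")
      case True
      have "w \<in> gens (n - 1)" using w True m by auto
      then have "w = (\<Sum>i\<in>Ix. sM (psi (Tx i) w) (Ex i))"
        using frames_reconstruct[OF fr, of n w] by (simp add: case_prod_beta)
      then have "psi q w = psi q (\<Sum>i\<in>Ix. sM (psi (Tx i) w) (Ex i))" by simp
      also have "\<dots> = (\<Sum>i\<in>Ix. psi q (sM (psi (Tx i) w) (Ex i)))"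
        using Ix_props(4) GM_subspace by (intro functional_sum[OF qf finite_Ix] D1.subspace_scale) auto
      also have "\<dots> = (\<Sum>i\<in>Ix. psi (Tx i) w * psi q (Ex i))"
        using Ix_props(4) by (intro sum.cong refl functional_scale[OF qf]) auto
      finally show ?thesis by (simp add: psi_diff psi_sum psi_pscale mult.commute)
    next
      case False
      then show ?thesis using psi_weight[OF d w] by simp
    qed
  qed (rule zero_functional)
  then show ?thesis using IH[OF m(2) d] by blast
qed

lemma pair_cocycle_sum:
  assumes u: "u \<in> functionals" and v: "v \<in> functionals"
  shows "pair u v cocycle = (\<Sum>(a, b)\<in>pairs. u (Ex a) * v (Ex b) * lam (mprod Br (Tx a) (Tx b)))"
proof -
  let ?l = "\<lambda>a b. lam (mprod Br (Tx a) (Tx b))"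
  have psum: "pair u v (sum g I) = (\<Sum>i\<in>I. pair u v (g i))" for g :: "'z \<Rightarrow> 'm" and I
    using u v by (induction I rule: infinite_finite_induct) (simp_all add: pair_add pair_zero)
  have "pair u v cocycle = (1 / 2) * (\<Sum>(a, b)\<in>pairs. ?l a b * (u (Ex a) * v (Ex b) - u (Ex b) * v (Ex a)))"
    unfolding cocycle_def pair_scale[OF u v] psum
    by (intro arg_cong[of _ _ "(*) (1 / 2)"] sum.cong refl)
      (use u v Ix_props(4) in \<open>auto simp: pair_scale pair_mult\<close>)
  also have "(\<Sum>(a, b)\<in>pairs. ?l a b * (u (Ex a) * v (Ex b) - u (Ex b) * v (Ex a))) =
      (\<Sum>(a, b)\<in>pairs. u (Ex a) * v (Ex b) * ?l a b) - (\<Sum>(a, b)\<in>pairs. u (Ex b) * v (Ex a) * ?l a b)"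
    unfolding sum_subtractf[symmetric]
    by (rule sum.cong[OF refl], clarify) (simp only: prod.case right_diff_distrib mult_ac)
  also have "(\<Sum>(a, b)\<in>pairs. u (Ex b) * v (Ex a) * ?l a b) = (\<Sum>(b, a)\<in>pairs. u (Ex b) * v (Ex a) * ?l a b)"
    by (rule sum.reindex_bij_witness[of _ prod.swap prod.swap]) auto
  also have "\<dots> = (\<Sum>(b, a)\<in>pairs. - (u (Ex b) * v (Ex a) * ?l b a))"
  proof (rule sum.cong[OF refl])
    fix ba assume "ba \<in> pairs"
    then have "fst ba \<in> Ix" "snd ba \<in> Ix" by auto
    then show "(case ba of (b, a) \<Rightarrow> u (Ex b) * v (Ex a) * ?l a b) =
        (case ba of (b, a) \<Rightarrow> - (u (Ex b) * v (Ex a) * ?l b a))"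
      unfolding case_prod_beta using lam_swap[OF Tx_trees Tx_trees, of "fst ba" "snd ba"] by simp
  qed
  also have "\<dots> = - (\<Sum>(a, b)\<in>pairs. u (Ex a) * v (Ex b) * ?l a b)"
    by (simp add: sum_negf case_prod_beta)
  finally show ?thesis by simp
qed

text \<open>The two-form represents the alternating form \<open>(q, r) \<mapsto> lam (q r)\<close> in total degree \<open>n\<close>: modulo
  the relations, \<open>q\<close> and \<open>r\<close> may be replaced by their expansions in the frames.\<close>

lemma pair_cocycle:
  assumes q: "1 \<le> m" "keys q \<subseteq> homogeneous_trees m"
    and r: "1 \<le> m'" "keys r \<subseteq> homogeneous_trees m'"
  shows "pair (psi q) (psi r) cocycle = (if m + m' = n then lam (mprod Br q r) else 0)"
proof -
  have trees: "keys q \<subseteq> trees" "keys r \<subseteq> trees"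
    using q r homogeneous_trees_subset by blast+
  have f: "psi q \<in> functionals" "psi r \<in> functionals" using trees psi_closed by auto
  have zero: "psi q (Ex a) * psi r (Ex b) = 0" if "a \<in> Ix" "b \<in> Ix" "\<not> (fst a = m \<and> fst b = m')" for a b
    using psi_weight[OF q(2) Ix_props(2)[OF _ _ that(1)]] psi_weight[OF r(2) Ix_props(2)[OF _ _ that(2)]] that
    by auto
  show ?thesis
  proof (cases "m + m' = n")
    case False
    then have "(\<Sum>(a, b)\<in>pairs. psi q (Ex a) * psi r (Ex b) * lam (mprod Br (Tx a) (Tx b))) = 0"
      using zero by (intro sum.neutral) auto
    then show ?thesis using pair_cocycle_sum[OF f] False by simp
  next
    case True
    let ?q = "\<Sum>i\<in>Ix. pscale (psi q (Ex i)) (Tx i)"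
    let ?r = "\<Sum>i\<in>Ix. pscale (psi r (Ex i)) (Tx i)"
    have kq: "q - ?q \<in> hol_kernel" and kr: "r - ?r \<in> hol_kernel"
      using expand_kernel q r True by auto
    have tq: "keys ?q \<subseteq> trees"
      by (rule keys_sum_subset, rule F_pscale_closed, rule Tx_trees)
    have bi: "mprod Br (sum g I) s = (\<Sum>i\<in>I. mprod Br (g i) s)"
      "mprod Br s (sum g I) = (\<Sum>i\<in>I. mprod Br s (g i))" for g :: "'z \<Rightarrow> ('a \<Rightarrow> 'k) magma \<Rightarrow>\<^sub>0 'k" and I s
      by (induction I rule: infinite_finite_induct) (simp_all add: mprod_linear, simp_all add: mprod_def)
    have "mprod Br (q - ?q) r + mprod Br ?q (r - ?r) \<in> hol_kernel"
      by (intro hol_kernel_add hol_kernel_mprod_left hol_kernel_mprod_right kq kr trees tq)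
    then have "lam (mprod Br (q - ?q) r + mprod Br ?q (r - ?r)) = 0" by (rule lam_kernel)
    moreover have "mprod Br (q - ?q + ?q) r = mprod Br (q - ?q) r + mprod Br ?q r"
      "mprod Br ?q (r - ?r + ?r) = mprod Br ?q (r - ?r) + mprod Br ?q ?r" by (simp_all only: mprod_linear)
    ultimately have "lam (mprod Br q r) = lam (mprod Br ?q ?r)" by (simp add: lam_add)
    also have "mprod Br ?q ?r =
        (\<Sum>a\<in>Ix. \<Sum>b\<in>Ix. pscale (psi r (Ex b)) (pscale (psi q (Ex a)) (mprod Br (Tx a) (Tx b))))"
      unfolding bi(1) unfolding bi(2) unfolding mprod_linear ..
    also have "lam \<dots> = (\<Sum>a\<in>Ix. \<Sum>b\<in>Ix. psi q (Ex a) * psi r (Ex b) * lam (mprod Br (Tx a) (Tx b)))"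
      unfolding lam_sum lam_scale by (simp only: mult_ac)
    also have "\<dots> = (\<Sum>(a, b)\<in>Ix \<times> Ix. psi q (Ex a) * psi r (Ex b) * lam (mprod Br (Tx a) (Tx b)))"
      by (rule sum.cartesian_product)
    also have "\<dots> = (\<Sum>(a, b)\<in>pairs. psi q (Ex a) * psi r (Ex b) * lam (mprod Br (Tx a) (Tx b)))"
    proof (rule sum.mono_neutral_right)
      show "\<forall>ab\<in>Ix \<times> Ix - pairs. (case ab of (a, b) \<Rightarrow>
          psi q (Ex a) * psi r (Ex b) * lam (mprod Br (Tx a) (Tx b))) = 0"
      proof
        fix ab assume ab: "ab \<in> Ix \<times> Ix - pairs"
        then have "\<not> (fst (fst ab) = m \<and> fst (snd ab) = m')"
          using True by (auto simp: mem_Times_iff)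
        then show "(case ab of (a, b) \<Rightarrow>
          psi q (Ex a) * psi r (Ex b) * lam (mprod Br (Tx a) (Tx b))) = 0"
          using zero[of "fst ab" "snd ab"] ab by (auto simp: case_prod_beta mem_Times_iff)
      qed
    qed (use finite_Ix in auto)
    finally show ?thesis using pair_cocycle_sum[OF f] True by simp
  qed
qed

lemma cocycle_words_span: "cocycle \<in> words_span (gens (n - 1)) 2"
proof -
  have "Ex a * Ex b \<in> words_span (gens (n - 1)) 2" if "a \<in> Ix" "b \<in> Ix" for a b
    unfolding words_span_def
    using Ix_props(2,5,6)[OF _ _ that(1)] Ix_props(2,5,6)[OF _ _ that(2)]
    by (intro D1.span_base CollectI exI[of _ "[Ex a, Ex b]"]) (auto intro!: bexI)
  then show ?thesis
    unfolding cocycle_def case_prod_beta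
    by (intro D1.subspace_scale D1.subspace_sum subspace_words_span) auto
qed

lemma cocycle_GM: "cocycle \<in> GM 2"
  using cocycle_words_span words_span_GM[OF gens_subset] by blast

text \<open>By the Chevalley--Eilenberg formula, pairing \<open>d cocycle\<close> with three dual vectors gives \<open>lam\<close> of
  a Jacobi relator.\<close>

lemma d_cocycle: "d cocycle = 0"
proof (rule nondegenerate_3[where I = Ix and t = "\<lambda>i. psi (Tx i)" and e = Ex and Y = "gens (n - 1)"])
  have dsum: "d (sum g I) = (\<Sum>i\<in>I. d (g i))" for g :: "'z \<Rightarrow> 'm" and I
    by (induction I rule: infinite_finite_induct) (simp_all add: d_add)
  have "d (Ex a * Ex b) \<in> words_span (gens (n - 1)) 3" if ab: "a \<in> Ix" "b \<in> Ix" for a b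
  proof -
    note A = Ix_props[OF _ _ ab(1)] and B = Ix_props[OF _ _ ab(2)]
    have "d (Ex a * Ex b) = d (Ex a) * Ex b - Ex a * d (Ex b)"
      using D1.leibniz[of "Ex a" 1 "Ex b"] A(4) by simp
    also have "d (Ex a) * Ex b = Ex b * d (Ex a)"
      using D1.graded_commute[of "Ex b" 1 "d (Ex a)" 2] B(4) d_GM_1[OF A(4)] by simp
    finally have e: "d (Ex a * Ex b) = Ex b * d (Ex a) - Ex a * d (Ex b)" .
    have g: "Ex a \<in> gens (n - 1)" "Ex b \<in> gens (n - 1)"
      using A(2,5,6) B(2,5,6) by (auto intro!: bexI)
    have "d (Ex a) \<in> words_span (gens (n - 1)) 2" "d (Ex b) \<in> words_span (gens (n - 1)) 2"
      using d_words_span[OF A(5) _ A(2), of "n - 1"] d_words_span[OF B(5) _ B(2), of "n - 1"] A(6) B(6)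
      by auto
    then have "Ex b * d (Ex a) \<in> words_span (gens (n - 1)) (Suc 2)" "Ex a * d (Ex b) \<in> words_span (gens (n - 1)) (Suc 2)"
      using words_span_mult g by blast+
    then show ?thesis unfolding e words_span_def by (simp add: numeral_3_eq_3 numeral_2_eq_2 D1.span_diff)
  qed
  then show "d cocycle \<in> words_span (gens (n - 1)) 3"
    unfolding cocycle_def d_scale dsum case_prod_beta
    by (intro D1.subspace_scale D1.subspace_sum subspace_words_span) auto
next
  fix i j k assume ijk: "i \<in> Ix" "j \<in> Ix" "k \<in> Ix"
  note I = Ix_props[OF _ _ ijk(1)] and J = Ix_props[OF _ _ ijk(2)] and K = Ix_props[OF _ _ ijk(3)]
  let ?P = "\<lambda>i j. mprod Br (Tx i) (Tx j)"
  have br: "pair (bracket (psi (Tx i)) (psi (Tx j))) (psi (Tx k)) cocycle =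
      (if fst i + fst j + fst k = n then lam (mprod Br (?P i j) (Tx k)) else 0)"
    if "i \<in> Ix" "j \<in> Ix" "k \<in> Ix" for i j k
  proof -
    have "bracket (psi (Tx i)) (psi (Tx j)) = psi (?P i j)"
      using psi_mprod Tx_trees that by simp
    then show ?thesis
      using pair_cocycle[OF _ mprod_homogeneous[OF Ix_props(1)[OF _ _ that(1)] Ix_props(1)[OF _ _ that(2)]]
          Ix_props(5)[OF _ _ that(3)] Ix_props(1)[OF _ _ that(3)]]
        Ix_props(5)[OF _ _ that(1)] by simp
  qed
  have "lam (mprod Br (?P i j) (Tx k) + mprod Br (?P j k) (Tx i) + mprod Br (?P k i) (Tx j)) = 0"
    by (intro lam_kernel jacobi_hol_kernel Tx_trees ijk)
  then have "lam (mprod Br (?P i j) (Tx k)) + lam (mprod Br (?P k i) (Tx j)) + lam (mprod Br (?P j k) (Tx i)) = 0"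
    by (simp add: lam_add algebra_simps)
  then show "aug (contract (psi (Tx k)) (contract (psi (Tx j)) (contract (psi (Tx i)) (d cocycle)))) = 0"
    using triple_contract_d[OF I(3) J(3) K(3) cocycle_GM] br[OF ijk] br[OF ijk(3,1,2)] br[OF ijk(2,3,1)]
    by (simp add: add.commute add.left_commute)
next
  show "(\<Sum>i\<in>Ix. sM (psi (Tx i) a) (Ex i)) = a" if "a \<in> gens (n - 1)" for a
    using frames_reconstruct[OF fr that] by (simp add: case_prod_beta)
qed (use gens_subset Ix_props in auto)

text \<open>Every summand of the two-form has a factor of weight at least two unless \<open>n = 2\<close>. In that case,
  for any functional \<open>\<alpha>\<close> on \<open>A\<^sup>2\<close>, expanding the form \<open>(y, y') \<mapsto> \<alpha> (y y')\<close> in the frame of \<open>V 1\<close> gives a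
  holonomy relator, and the value of \<open>lam\<close> on it is \<open>\<alpha> (\<phi> cocycle)\<close>.\<close>

lemma \<phi>_cocycle: "\<phi> cocycle = 0"
proof -
  let ?l = "\<lambda>a b. lam (mprod Br (Tx a) (Tx b))"
  have \<phi>c: "\<phi> cocycle = sA (1 / 2) (\<Sum>(a, b)\<in>pairs. sA (?l a b) (\<phi> (Ex a) * \<phi> (Ex b)))"
    unfolding cocycle_def by (simp add: \<phi>_scale \<phi>_sum morphism_mult case_prod_beta)
  show ?thesis
  proof (cases "n = 2")
    case False
    have "\<phi> (Ex a) * \<phi> (Ex b) = 0" if "a \<in> Ix" "b \<in> Ix" "fst a + fst b = n" for a b
    proof -
      have "fst a \<ge> 2 \<or> fst b \<ge> 2" using that n False by linarith
      then show ?thesis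
        using \<phi>_V_higher Ix_props(2)[OF _ _ that(1)] Ix_props(2)[OF _ _ that(2)] by fastforce
    qed
    then have "(\<Sum>(a, b)\<in>pairs. sA (?l a b) (\<phi> (Ex a) * \<phi> (Ex b))) = 0"
      by (intro sum.neutral) auto
    then show ?thesis unfolding \<phi>c by simp
  next
    case True
    show ?thesis
    proof (rule ccontr)
      assume "\<phi> cocycle \<noteq> 0"
      then obtain \<alpha>0 where \<alpha>0: "\<And>u v. \<alpha>0 (u + v) = \<alpha>0 u + \<alpha>0 v" "\<And>c u. \<alpha>0 (sA c u) = c * \<alpha>0 u"
        "\<alpha>0 (\<phi> cocycle) = 1"
        using A.separating_functional[of "{0}" "\<phi> cocycle"] by auto
      define \<alpha> where "\<alpha> a = (if a \<in> GA 2 then \<alpha>0 a else 0)" for a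
      have \<alpha>: "\<alpha> \<in> vcarrier (dual sA (GA 2))"
        unfolding dual_GA_2_iff \<alpha>_def using \<alpha>0 D2.subspace_grade[of 2]
        by (auto simp: D2.subspace_add D2.subspace_scale)
      have \<alpha>s: "\<alpha>0 (sum g I) = (\<Sum>i\<in>I. \<alpha>0 (g i))" for g :: "'z \<Rightarrow> 'a" and I
        using \<alpha>0(1)[of 0 0] by (induction I rule: infinite_finite_induct) (simp_all add: \<alpha>0)
      have mult2: "a * b \<in> GA 2" if "a \<in> GA 1" "b \<in> GA 1" for a b
        using D2.mult_grade[OF that] by (simp add: numeral_2_eq_2)
      have fst1: "fst a = 1" if "a \<in> Ix" for a using Ix_props(5,6)[OF _ _ that] True by linarith
      have "\<forall>a\<in>Ix. \<exists>x\<in>vcarrier W. Tx a - single (Gen x) 1 \<in> hol_kernel"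
        using degree_1_generator Ix_props(1) fst1 by metis
      then obtain x where x: "\<And>a. a \<in> Ix \<Longrightarrow> x a \<in> vcarrier W"
        and xk: "\<And>a. a \<in> Ix \<Longrightarrow> Tx a - single (Gen (x a)) 1 \<in> hol_kernel" by metis
      have xpsi: "psi (Tx a) = psi_tree (Gen (x a))" if "a \<in> Ix" for a
        using psi_diff_kernel[OF xk[OF that]] by simp
      define \<beta> where "\<beta> a b = \<alpha>0 (\<phi> (Ex a) * \<phi> (Ex b)) / 2" for a b
      obtain L where L: "set L = pairs" "distinct L" using finite_distinct_list[OF finite_pairs] by blast
      define ps where "ps = map (\<lambda>(a, b). ((\<lambda>y. \<beta> a b * x a y), x b)) L"
      have sumL: "(\<Sum>ab\<leftarrow>L. g ab) = (\<Sum>ab\<in>pairs. g ab)" for g :: "_ \<Rightarrow> 'k"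
        using sum.distinct_set_conv_list[OF L(2), of g] L(1) by simp
      have ps_sum: "(\<Sum>(x, z)\<leftarrow>ps. g x z) = (\<Sum>(a, b)\<in>pairs. g (\<lambda>y. \<beta> a b * x a y) (x b))"
        for g :: "('a \<Rightarrow> 'k) \<Rightarrow> ('a \<Rightarrow> 'k) \<Rightarrow> 'k"
        unfolding ps_def sumL[symmetric] map_map
        by (rule arg_cong[of _ _ sum_list], rule map_cong[OF refl]) (simp add: case_prod_beta)
      have pairs_eq: "pairs = Ix \<times> Ix"
      proof -
        have "fst (fst ab) + fst (snd ab) = n" if "ab \<in> Ix \<times> Ix" for ab
          using that fst1[of "fst ab"] fst1[of "snd ab"] True by (simp add: mem_Times_iff)
        then show ?thesis by auto
      qed
      have "quadratic_relation ps \<alpha>"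
        unfolding quadratic_relation_def
      proof (intro conjI ballI)
        show "set ps \<subseteq> vcarrier W \<times> vcarrier W"
          unfolding ps_def using L x W_scale by auto
        show "\<alpha> \<in> vcarrier (dual sA (GA 2))" by (rule \<alpha>)
        fix y y' assume y: "y \<in> GA 1" "y' \<in> GA 1"
        obtain w w' where w: "w \<in> V 1" "\<phi> w = y" "w' \<in> V 1" "\<phi> w' = y'" using \<phi>_V_1_surj y by blast
        have w1: "w \<in> GM 1" "w' \<in> GM 1" using w V_subset by auto
        have rec: "\<phi> v = (\<Sum>a\<in>Ix. sA (x a (\<phi> v)) (\<phi> (Ex a)))" if v: "v \<in> V 1" for v
        proof -
          have v1: "v \<in> GM 1" using v V_subset by auto
          have "v \<in> gens (n - 1)" using v True by auto
          then have "v = (\<Sum>i\<in>Ix. sM (psi (Tx i) v) (Ex i))"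
            using frames_reconstruct[OF fr, of n v] by (simp add: case_prod_beta)
          then have "\<phi> v = (\<Sum>i\<in>Ix. sA (psi (Tx i) v) (\<phi> (Ex i)))" by (metis (no_types, lifting) \<phi>_sum \<phi>_scale sum.cong)
          also have "\<dots> = (\<Sum>a\<in>Ix. sA (x a (\<phi> v)) (\<phi> (Ex a)))"
            using xpsi v1 by (intro sum.cong refl) simp
          finally show ?thesis .
        qed
        have prod: "\<alpha>0 (\<phi> v * \<phi> v') = (\<Sum>(a, b)\<in>pairs. 2 * \<beta> a b * (x a (\<phi> v) * x b (\<phi> v')))"
          if v: "v \<in> V 1" "v' \<in> V 1" for v v'
        proof -
          have "\<phi> v * \<phi> v' = (\<Sum>a\<in>Ix. \<Sum>b\<in>Ix. sA (x a (\<phi> v)) (\<phi> (Ex a)) * sA (x b (\<phi> v')) (\<phi> (Ex b)))"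
            by (subst rec[OF v(1)], subst rec[OF v(2)]) (rule sum_product)
          also have "\<dots> = (\<Sum>a\<in>Ix. \<Sum>b\<in>Ix. sA (x a (\<phi> v) * x b (\<phi> v')) (\<phi> (Ex a) * \<phi> (Ex b)))"
            by (simp add: D2.scale_mult_left[symmetric] D2.scale_mult_right[symmetric] mult.commute)
          finally have "\<alpha>0 (\<phi> v * \<phi> v') = (\<Sum>a\<in>Ix. \<Sum>b\<in>Ix. x a (\<phi> v) * x b (\<phi> v') * \<alpha>0 (\<phi> (Ex a) * \<phi> (Ex b)))"
            by (simp add: \<alpha>s \<alpha>0)
          also have "\<dots> = (\<Sum>a\<in>Ix. \<Sum>b\<in>Ix. 2 * \<beta> a b * (x a (\<phi> v) * x b (\<phi> v')))"
            by (simp add: \<beta>_def mult.commute)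
          finally show ?thesis unfolding pairs_eq sum.cartesian_product .
        qed
        have "(\<Sum>(x, z)\<leftarrow>ps. x y * z y' - x y' * z y) =
            (\<Sum>(a, b)\<in>pairs. \<beta> a b * (x a y * x b y') - \<beta> a b * (x a y' * x b y))"
          unfolding ps_sum by (simp only: mult.assoc)
        also have "\<dots> = (\<Sum>(a, b)\<in>pairs. 2 * \<beta> a b * (x a y * x b y')) / 2 -
            (\<Sum>(a, b)\<in>pairs. 2 * \<beta> a b * (x a y' * x b y)) / 2"
          by (simp add: sum_subtractf case_prod_beta sum_divide_distrib)
        also have "\<dots> = \<alpha>0 (y * y') / 2 - \<alpha>0 (y' * y) / 2" 
          by (simp only: prod[OF w(1,3), unfolded w(2,4)] prod[OF w(3,1), unfolded w(2,4)])
        also have "y' * y = - (y * y')" using D2.graded_commute[OF y] by simp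
        also have "\<alpha>0 (- (y * y')) = - \<alpha>0 (y * y')" using \<alpha>0(2)[of "- 1" "y * y'"] by simp
        also have "\<alpha>0 (y * y') / 2 - - \<alpha>0 (y * y') / 2 = \<alpha>0 (y * y')" by simp
        finally show "(\<Sum>(x, z)\<leftarrow>ps. x y * z y' - x y' * z y) = \<alpha> (y * y')"
          using mult2[OF y] by (simp add: \<alpha>_def)
      qed
      then have "lam (quadratic ps) = 0" by (intro lam_kernel quadratic_hol_kernel)
      moreover have "lam (quadratic ps) = (\<Sum>(x, y)\<leftarrow>ps. lam (single (Br (Gen x) (Gen y)) 1))"
        by (induction ps) (auto simp: lam_add lam_zero)
      moreover have "\<dots> = (\<Sum>(a, b)\<in>pairs. lam (single (Br (Gen (\<lambda>y. \<beta> a b * x a y)) (Gen (x b))) 1))"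
        by (rule ps_sum)
      moreover have "\<dots> = (\<Sum>(a, b)\<in>pairs. \<beta> a b * ?l a b)"
      proof (rule sum.cong[OF refl], clarify, goal_cases)
        case (1 a1 a2 b1 b2)
        define a b where "a = (a1, a2)" and "b = (b1, b2)"
        have ab: "a \<in> Ix" "b \<in> Ix" "fst a + fst b = n" using 1 by (auto simp: a_def b_def)
        let ?g = "single (Gen (\<lambda>y. \<beta> a b * x a y)) (1::'k)" and ?h = "single (Gen (x b)) (1::'k)"
        have gh: "keys ?g \<subseteq> homogeneous_trees 1" "keys ?h \<subseteq> homogeneous_trees 1"
          using x[OF ab(1)] x[OF ab(2)] W_scale by (auto simp: homogeneous_trees_def)
        have pg: "psi ?g = (\<lambda>w. \<beta> a b * psi (Tx a) w)" using xpsi[OF ab(1)] by auto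
        have ph: "psi ?h = psi (Tx b)" using xpsi[OF ab(2)] by simp
        have f: "psi (Tx a) \<in> functionals" "psi (Tx b) \<in> functionals" using Ix_props(3) ab by auto
        have "lam (mprod Br ?g ?h) = pair (psi ?g) (psi ?h) cocycle"
          using pair_cocycle[OF _ gh(1) _ gh(2)] True by simp
        also have "\<dots> = \<beta> a b * pair (psi (Tx a)) (psi (Tx b)) cocycle"
          unfolding pg ph by (rule pair_bilinear(3)[OF f(1) f(1) f(2) cocycle_GM])
        also have "pair (psi (Tx a)) (psi (Tx b)) cocycle = ?l a b"
          using pair_cocycle[OF Ix_props(5)[OF _ _ ab(1)] Ix_props(1)[OF _ _ ab(1)]
              Ix_props(5)[OF _ _ ab(2)] Ix_props(1)[OF _ _ ab(2)]] ab(3) by simp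
        finally show ?case by (simp add: a_def b_def)
      qed
      moreover have "\<dots> = \<alpha>0 (\<phi> cocycle)"
        unfolding \<phi>c \<beta>_def by (simp add: \<alpha>0 \<alpha>s case_prod_beta sum_divide_distrib mult.commute)
      ultimately show False using \<alpha>0(3) by simp
    qed
  qed
qed

text \<open>This is where \<open>V n\<close> is used as the whole kernel of the map from the cohomology of the previous
  stage.\<close>

lemma cocycle_class:
  "\<exists>v\<in>V n. \<exists>s\<in>stage sM V (n - 1) \<inter> GM 1. cocycle = d v + d s"
proof -
  let ?S = "stage sM V (n - 1)"
  let ?cl = "cohomology_class sM GM d ?S 1"
  have cl: "?cl z = (\<lambda>s. z + d s) ` (?S \<inter> GM 1)" for z
    unfolding cohomology_class_def coset_def coboundaries_def sub_alg_simps image_image ..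
  have S0: "0 \<in> ?S \<inter> GM 1" using GM_subspace[of 1] by (simp add: stage_def D1.span_zero D1.subspace_0)
  have "cocycle \<in> ?S"
  proof -
    have "words_span (gens (n - 1)) 2 \<subseteq> ?S" unfolding words_span_def stage_def by (rule D1.span_mono) blast
    then show ?thesis using cocycle_words_span by blast
  qed
  then have "?cl cocycle \<in> cohomology_Suc sM GM d ?S 1"
    unfolding cohomology_Suc_def using cocycle_GM d_cocycle by (simp add: numeral_2_eq_2)
  moreover have "\<phi> ` ?cl cocycle = {0}"
    unfolding cl using S0 \<phi>_cocycle morphism_d by (auto simp: image_image \<phi>_add)
  ultimately have "?cl cocycle \<in> (\<lambda>v. ?cl (d v)) ` V n"
    using V_kernel[OF n] unfolding bij_betw_def by blast
  then obtain v where v: "v \<in> V n" "?cl cocycle = ?cl (d v)" by blast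
  have "cocycle \<in> ?cl cocycle" unfolding cl using S0 by force
  then show ?thesis using v unfolding cl by blast
qed

text \<open>On products, \<open>lam\<close> is the pairing with \<open>d v + d s\<close>, that is, evaluation of \<open>psi\<close> at \<open>v\<close>, since
  functionals of degree \<open>n\<close> vanish at \<open>s\<close>. As \<open>n \<ge> 2\<close>, products span degree \<open>n\<close>.\<close>

lemma lam_evaluation:
  assumes p: "keys p \<subseteq> homogeneous_trees n" and 0: "psi p = (\<lambda>w. 0)"
  shows "lam p = 0"
proof -
  obtain v s where v: "v \<in> V n" and s: "s \<in> stage sM V (n - 1) \<inter> GM 1" and c: "cocycle = d v + d s"
    using cocycle_class by blast
  have v1: "v \<in> GM 1" using v V_subset by auto
  have deg: "magma_degree s \<ge> 1" for s :: "('a \<Rightarrow> 'k) magma" by (induction s) auto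
  have "lam p = psi p v"
    using p
  proof (induction rule: poly_mapping_carrier_induct)
    case (single t b)
    then obtain t1 t2 where t: "t = Br t1 t2" using n by (cases t) (auto simp: homogeneous_trees_def)
    let ?q = "single t1 (1::'k)" and ?r = "single t2 (1::'k)"
    have q: "keys ?q \<subseteq> homogeneous_trees (magma_degree t1)"
      "keys ?r \<subseteq> homogeneous_trees (magma_degree t2)"
      and d12: "magma_degree t1 + magma_degree t2 = n"
      using single t by (auto simp: homogeneous_trees_def)
    have qt: "keys ?q \<subseteq> trees" "keys ?r \<subseteq> trees"
      using q homogeneous_trees_subset by blast+
    have f: "psi ?q \<in> functionals" "psi ?r \<in> functionals" by (rule psi_closed, rule qt)+
    have m: "psi (mprod Br ?q ?r) = bracket (psi ?q) (psi ?r)" by (rule psi_mprod[OF qt])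
    have h: "keys (mprod Br ?q ?r) \<subseteq> homogeneous_trees n"
      using mprod_homogeneous[OF q] d12 by simp
    have "psi (mprod Br ?q ?r) s = 0"
    proof (rule functional_words_span_1[OF _ gens_subset])
      show "psi (mprod Br ?q ?r) \<in> functionals" unfolding m by (rule bracket_closed[OF f])
      show "s \<in> words_span (gens (n - 1)) 1" by (rule stage_words_span[OF s])
      fix y assume "y \<in> gens (n - 1)"
      then obtain j where "j \<in> {1..n - 1}" "y \<in> V j" by blast
      then show "psi (mprod Br ?q ?r) y = 0" using psi_weight[OF h, of y j] n by auto
    qed
    then have "pair (psi ?q) (psi ?r) (d s) = 0" using m s by (simp add: bracket_def)
    moreover have "pair (psi ?q) (psi ?r) (d v) = psi (mprod Br ?q ?r) v" using m v1 by (simp add: bracket_def)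
    moreover have "pair (psi ?q) (psi ?r) cocycle = lam (mprod Br ?q ?r)"
      using pair_cocycle[OF deg q(1) deg q(2)] d12 by simp
    ultimately have "lam (mprod Br ?q ?r) = psi (mprod Br ?q ?r) v"
      using c f by (simp add: pair_add)
    moreover have "single t b = pscale b (mprod Br ?q ?r)" by (simp add: t)
    ultimately show ?case by (simp only: lam_scale psi_pscale)
  qed (simp_all add: lam_zero lam_add psi_add)
  then show ?thesis using 0 by simp
qed

end

text \<open>An element outside the kernel would be separated from it by a functional, which the inductive step
  excludes.\<close>

theorem psi_injective:
  assumes fr: "\<And>j. 1 \<le> j \<Longrightarrow> frame j (N j) (E j) (T j)"
    and p: "keys p \<subseteq> homogeneous_trees n" and 0: "psi p = (\<lambda>w. 0)"
  shows "p \<in> hol_kernel"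
  using p 0
proof (induction n arbitrary: p rule: less_induct)
  case (less n)
  have deg: "magma_degree s \<ge> 1" for s :: "('a \<Rightarrow> 'k) magma" by (induction s) auto
  consider "n = 0" | "n = 1" | "n \<ge> 2" by linarith
  then show ?case
  proof cases
    case 1
    have "t \<notin> homogeneous_trees 0" for t using deg[of t] unfolding homogeneous_trees_def by auto
    then have "homogeneous_trees n = {}" using 1 by blast
    then show ?thesis using less.prems hol_kernel_zero by simp
  next
    case 2
    then show ?thesis using psi_injective_1 less.prems by simp
  next
    case 3
    show ?thesis
    proof (rule ccontr)
      assume np: "p \<notin> hol_kernel"
      interpret P: free_extension "pscale :: 'k \<Rightarrow> (('a \<Rightarrow> 'k) magma \<Rightarrow>\<^sub>0 'k) \<Rightarrow> _"
        by (rule free_extension_pscale)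
      have "P.subspace hol_kernel"
        unfolding P.subspace_def using hol_kernel_zero hol_kernel_add hol_kernel_pscale by blast
      from P.separating_functional[OF this np]
      obtain lam where lam: "\<And>u v. lam (u + v) = lam u + lam v" "\<And>c u. lam (pscale c u) = c * lam u"
        "\<And>u. u \<in> hol_kernel \<Longrightarrow> lam u = 0" "lam p = 1" by blast
      have "lam p = 0"
        by (rule lam_evaluation[OF 3 fr less.IH lam(1-3) less.prems])
      then show False using lam(4) by simp
    qed
  qed
qed

end

section \<open>The two isomorphisms\<close>

context canonical_one_minimal_model
begin

subsection \<open>From the dual Lie algebra to the completed holonomy Lie algebra\<close>

lemma holonomy_degree_eq:
  "holonomy_degree sA GA n = hol ` {p. keys p \<subseteq> homogeneous_trees n}"
proof -
  have "{p \<in> vcarrier F. \<forall>t\<in>keys p. magma_degree t = n} =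
      {p. keys p \<subseteq> homogeneous_trees n}"
    unfolding homogeneous_trees_def by auto
  then show ?thesis
    unfolding holonomy_degree_def free_lie_degree_def W_def[symmetric] image_image hol_def by simp
qed

lemma hol_zero: "hol 0 = vzero H"
  using hol_epi unfolding alg_epi_def by simp

lemma completed_simps:
  "vcarrier (completed_holonomy sA GA) = PiE {1..} (holonomy_degree sA GA)"
  "vadd (completed_holonomy sA GA) = (\<lambda>x y. \<lambda>n\<in>{1..}. vadd H (x n) (y n))"
  "vzero (completed_holonomy sA GA) = (\<lambda>n\<in>{1..}. vzero H)"
  "vsmult (completed_holonomy sA GA) = (\<lambda>c x. \<lambda>n\<in>{1..}. vsmult H c (x n))"
  "aprod (completed_holonomy sA GA) =
     (\<lambda>x y. \<lambda>n\<in>{1..}. vsum H (map (\<lambda>p. aprod H (x p) (y (n - p))) [1..<n]))"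
  "filt (completed_holonomy sA GA) =
     (\<lambda>k. {x \<in> PiE {1..} (holonomy_degree sA GA). \<forall>i\<in>{1..<k}. x i = vzero H})"
  unfolding completed_holonomy_def degree_completion_def by simp_all

context
  fixes N :: "nat \<Rightarrow> nat" and E :: "nat \<Rightarrow> nat \<Rightarrow> 'm"
    and T :: "nat \<Rightarrow> nat \<Rightarrow> ('a \<Rightarrow> 'k) magma \<Rightarrow>\<^sub>0 'k"
  assumes fr: "\<And>j. 1 \<le> j \<Longrightarrow> frame j (N j) (E j) (T j)"
begin

text \<open>A preimage under \<open>psi\<close> of the part of degree \<open>n\<close> of a functional, written down with a frame so that
  it depends linearly on the functional.\<close>

definition lift_part :: "nat \<Rightarrow> ('m \<Rightarrow> 'k) \<Rightarrow> ('a \<Rightarrow> 'k) magma \<Rightarrow>\<^sub>0 'k" where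
  "lift_part n u = (\<Sum>k<N n. pscale (u (E n k)) (T n k))"

definition to_holonomy :: "('m \<Rightarrow> 'k) \<Rightarrow> nat \<Rightarrow> (('a \<Rightarrow> 'k) magma \<Rightarrow>\<^sub>0 'k) set set" where
  "to_holonomy u = (\<lambda>n\<in>{1..}. hol (lift_part n u))"

lemma frame_props:
  assumes "1 \<le> n" "k < N n"
  shows "E n k \<in> V n" "E n k \<in> GM 1" "keys (T n k) \<subseteq> homogeneous_trees n"
  using fr[OF assms(1)] assms(2) V_subset[of n] unfolding frame_def by auto

lemma lift_part_homogeneous: "1 \<le> n \<Longrightarrow> keys (lift_part n u) \<subseteq> homogeneous_trees n"
  unfolding lift_part_def
  by (rule keys_sum_subset, rule subset_trans[OF keys_pscale], rule frame_props(3)) auto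

lemma lift_part_trees: "1 \<le> n \<Longrightarrow> keys (lift_part n u) \<subseteq> trees"
  using lift_part_homogeneous homogeneous_trees_subset by blast

lemma lift_part_add: "lift_part n (\<lambda>x. u x + v x) = lift_part n u + lift_part n v"
proof -
  interpret P: free_extension "pscale :: 'k \<Rightarrow> (('a \<Rightarrow> 'k) magma \<Rightarrow>\<^sub>0 'k) \<Rightarrow> _"
    by (rule free_extension_pscale)
  show ?thesis unfolding lift_part_def P.scale_left_distrib sum.distrib ..
qed

lemma lift_part_scale: "lift_part n (\<lambda>x. c * u x) = pscale c (lift_part n u)"
proof -
  interpret P: free_extension "pscale :: 'k \<Rightarrow> (('a \<Rightarrow> 'k) magma \<Rightarrow>\<^sub>0 'k) \<Rightarrow> _"
    by (rule free_extension_pscale)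
  show ?thesis unfolding lift_part_def P.scale_sum_right P.scale_scale ..
qed

lemma psi_lift_part:
  assumes n: "1 \<le> n" and u: "u \<in> functionals" and w: "w \<in> V n"
  shows "psi (lift_part n u) w = u w"
proof -
  have "w = (\<Sum>k<N n. sM (psi (T n k) w) (E n k))" using fr[OF n] w unfolding frame_def by blast
  then have "u w = u (\<Sum>k<N n. sM (psi (T n k) w) (E n k))" by simp
  also have "\<dots> = (\<Sum>k<N n. u (sM (psi (T n k) w) (E n k)))"
    using frame_props(2)[OF n] GM_subspace by (intro functional_sum[OF u] D1.subspace_scale) auto
  also have "\<dots> = (\<Sum>k<N n. psi (T n k) w * u (E n k))"
    using frame_props(2)[OF n] by (intro sum.cong refl functional_scale[OF u]) auto
  finally show ?thesis by (simp add: lift_part_def psi_sum psi_pscale mult.commute)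
qed

lemma homogeneous_hol_eq:
  assumes n: "1 \<le> n" and p: "keys p \<subseteq> homogeneous_trees n"
    and q: "keys q \<subseteq> homogeneous_trees n"
  shows "hol p = hol q \<longleftrightarrow> (\<forall>w\<in>V n. psi p w = psi q w)"
proof -
  have t: "keys p \<subseteq> trees" "keys q \<subseteq> trees"
    using p q homogeneous_trees_subset by blast+
  have pq: "keys (p - q) \<subseteq> homogeneous_trees n" using keys_diff[of p q] p q by blast
  have f: "psi (p - q) \<in> functionals" using psi_closed F_diff_closed[OF t] by blast
  show ?thesis
    unfolding hol_eq_iff[OF t]
  proof
    assume "p - q \<in> hol_kernel"
    then show "\<forall>w\<in>V n. psi p w = psi q w" using psi_diff_kernel by simp
  next
    assume eq: "\<forall>w\<in>V n. psi p w = psi q w"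
    have "psi (p - q) = (\<lambda>w. 0)"
    proof (rule functionals_eqI[OF f zero_functional])
      fix j w assume "w \<in> V j"
      then show "psi (p - q) w = 0"
        using eq psi_weight[OF pq, of w j] by (cases "j = n") (auto simp: psi_diff)
    qed
    then show "p - q \<in> hol_kernel" using psi_injective[OF fr pq] by simp
  qed
qed

lemma hol_ops:
  "keys p \<subseteq> trees \<Longrightarrow> keys q \<subseteq> trees \<Longrightarrow> hol (p + q) = vadd H (hol p) (hol q)"
  "keys p \<subseteq> trees \<Longrightarrow> hol (pscale c p) = vsmult H c (hol p)"
  "keys p \<subseteq> trees \<Longrightarrow> keys q \<subseteq> trees \<Longrightarrow> hol (mprod Br p q) = aprod H (hol p) (hol q)"
  using hol_epi unfolding alg_epi_def by simp_all

text \<open>The difference of the two sides is a sum of \<open>n\<close> brackets, indexed by \<open>0\<close> and \<open>{1..<n}\<close>, to which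
  \<open>bracket_weight_zero\<close> applies.\<close>

lemma bracket_parts:
  assumes u: "u \<in> functionals" and v: "v \<in> functionals" and w: "w \<in> V n"
  shows "bracket u v w = (\<Sum>p\<in>{1..<n}. bracket (psi (lift_part p u)) (psi (lift_part (n - p) v)) w)"
proof -
  let ?u = "\<lambda>p. psi (lift_part p u)" and ?v = "\<lambda>p. psi (lift_part (n - p) v)"
  have f: "?u p \<in> functionals" "?v p \<in> functionals" if "p \<in> {1..<n}" for p
    using that lift_part_trees psi_closed by auto
  let ?I = "insert 0 {1..<n}"
  let ?u' = "\<lambda>p. if p = 0 then u else (\<lambda>x. - 1 * ?u p x)" and ?v' = "\<lambda>p. if p = 0 then v else ?v p"
  have "(\<Sum>p\<in>?I. bracket (?u' p) (?v' p) w) = 0"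
  proof (rule bracket_weight_zero[OF _ _ _ w])
    show "?u' p \<in> functionals" "?v' p \<in> functionals" if "p \<in> ?I" for p
      using that u v f functionals_scale[OF f(1), of p "- 1"] by auto
    fix i j a b assume ab: "a \<in> V i" "b \<in> V j" "i + j = n"
    have uz: "?u p x = (if p = l then u x else 0)" if "p \<in> {1..<n}" "x \<in> V l" for p x l
      using psi_lift_part[OF _ u] psi_weight[OF lift_part_homogeneous] that by auto
    have vz: "?v p x = (if n - p = l then v x else 0)" if "p \<in> {1..<n}" "x \<in> V l" for p x l
      using psi_lift_part[OF _ v] psi_weight[OF lift_part_homogeneous] that by auto
    have s: "(\<Sum>p\<in>{1..<n}. ?u p x * ?v p y) = u x * v y"
      if xy: "x \<in> V i" "y \<in> V j" "i + j = n" for x y i j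
    proof (cases "i = 0 \<or> j = 0")
      case True
      then have "x = 0 \<or> y = 0" using xy V_0 by auto
      moreover have "u 0 = 0" "v 0 = 0" using u v functional_zero by auto
      moreover have "?u p 0 = 0" "?v p 0 = 0" if "p \<in> {1..<n}" for p
        using functional_zero f that by auto
      ultimately show ?thesis by auto
    next
      case False
      have "(\<Sum>p\<in>{1..<n}. ?u p x * ?v p y) = (\<Sum>p\<in>{1..<n}. if p = i then u x * v y else 0)"
        by (rule sum.cong[OF refl]) (use uz vz xy False in auto)
      then show ?thesis using False xy by simp
    qed
    have "(\<Sum>p\<in>?I. ?u' p a * ?v' p b - ?u' p b * ?v' p a) =
        u a * v b - u b * v a - ((\<Sum>p\<in>{1..<n}. ?u p a * ?v p b) - (\<Sum>p\<in>{1..<n}. ?u p b * ?v p a))"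
    proof -
      have "(\<Sum>p\<in>{1..<n}. ?u' p a * ?v' p b - ?u' p b * ?v' p a) =
          (\<Sum>p\<in>{1..<n}. ?u p b * ?v p a - ?u p a * ?v p b)"
        by (rule sum.cong) auto
      then show ?thesis by (simp add: sum_subtractf sum_negf)
    qed
    also have "\<dots> = 0" using s[OF ab] s[OF ab(2,1)] ab(3) by simp
    finally show "(\<Sum>p\<in>?I. ?u' p a * ?v' p b - ?u' p b * ?v' p a) = 0" .
  qed simp
  moreover have "bracket (?u' p) (?v' p) w = - bracket (?u p) (?v p) w" if "p \<in> {1..<n}" for p
    using that bracket_bilinear(3)[OF f(1)[OF that] f(1)[OF that] f(2)[OF that], of "- 1"] by simp
  ultimately show ?thesis by (simp add: sum_negf)
qed

lemma hol_lift_part_bracket: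
  assumes n: "1 \<le> n" and u: "u \<in> functionals" and v: "v \<in> functionals"
  shows "hol (lift_part n (bracket u v)) =
    vsum H (map (\<lambda>p. aprod H (hol (lift_part p u)) (hol (lift_part (n - p) v))) [1..<n])"
proof -
  let ?m = "\<lambda>p. mprod Br (lift_part p u) (lift_part (n - p) v)"
  have m: "keys (?m p) \<subseteq> homogeneous_trees n" if "p \<in> {1..<n}" for p
  proof -
    have "p + (n - p) = n" "1 \<le> p" "1 \<le> n - p" using that by auto
    then show ?thesis
      using mprod_homogeneous[OF lift_part_homogeneous lift_part_homogeneous, of p "n - p" u v] by metis
  qed
  have "vsum H (map (\<lambda>p. aprod H (hol (lift_part p u)) (hol (lift_part (n - p) v))) [1..<n]) =
      vsum H (map hol (map ?m [1..<n]))"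
    by (rule arg_cong[of _ _ "vsum H"]) (auto simp: hol_ops lift_part_trees)
  also have "\<dots> = hol (vsum F (map ?m [1..<n]))"
    by (rule alg_epi_vsum[OF algebra_F hol_epi, symmetric])
      (use m homogeneous_trees_subset in fastforce)
  also have "vsum F (map ?m [1..<n]) = (\<Sum>p\<in>{1..<n}. ?m p)"
  proof -
    have "vsum F ps = sum_list ps" for ps by (induction ps) (simp_all add: vsum_def)
    then show ?thesis by (simp add: interv_sum_list_conv_sum_set_nat)
  qed
  also have "hol \<dots> = hol (lift_part n (bracket u v))"
  proof (rule homogeneous_hol_eq[OF n, THEN iffD2])
    show "keys (sum ?m {1..<n}) \<subseteq> homogeneous_trees n"
      by (rule keys_sum_subset[OF m])
    show "\<forall>w\<in>V n. psi (sum ?m {1..<n}) w = psi (lift_part n (bracket u v)) w"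
    proof
      fix w assume w: "w \<in> V n"
      have "psi (sum ?m {1..<n}) w = (\<Sum>p\<in>{1..<n}. bracket (psi (lift_part p u)) (psi (lift_part (n - p) v)) w)"
        unfolding psi_sum by (rule sum.cong) (auto simp: psi_mprod lift_part_trees)
      then show "psi (sum ?m {1..<n}) w = psi (lift_part n (bracket u v)) w"
        using bracket_parts[OF u v w] psi_lift_part[OF n bracket_closed[OF u v] w] by simp
    qed
  qed (rule lift_part_homogeneous[OF n])
  finally show ?thesis by simp
qed

text \<open>Injectivity holds since \<open>psi\<close> recovers the homogeneous parts of a functional. For surjectivity,
  the images under \<open>psi\<close> of representatives in all degrees are glued to one functional.\<close>

lemma to_holonomy_iso: "alg_iso dual_lie (completed_holonomy sA GA) to_holonomy"
  unfolding alg_iso_def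
proof (intro conjI ballI allI)
  show "bij_betw to_holonomy (vcarrier dual_lie) (vcarrier (completed_holonomy sA GA))"
    unfolding bij_betw_def
  proof
    show "inj_on to_holonomy (vcarrier dual_lie)"
    proof (rule inj_onI)
      fix u v assume uv: "u \<in> vcarrier dual_lie" "v \<in> vcarrier dual_lie" and e: "to_holonomy u = to_holonomy v"
      show "u = v"
      proof (rule functionals_eqI)
        fix j w assume j: "1 \<le> j" and w: "w \<in> V j"
        have "hol (lift_part j u) = hol (lift_part j v)"
          using fun_cong[OF e, of j] j by (simp add: to_holonomy_def)
        then have "psi (lift_part j u) w = psi (lift_part j v) w"
          using homogeneous_hol_eq[OF j lift_part_homogeneous[OF j] lift_part_homogeneous[OF j]] w by blast
        then show "u w = v w" using psi_lift_part[OF j _ w] uv by simp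
      qed (use uv in auto)
    qed
    show "to_holonomy ` vcarrier dual_lie = vcarrier (completed_holonomy sA GA)"
    proof
      show "to_holonomy ` vcarrier dual_lie \<subseteq> vcarrier (completed_holonomy sA GA)"
        unfolding completed_simps to_holonomy_def holonomy_degree_eq
        using lift_part_homogeneous by auto
      show "vcarrier (completed_holonomy sA GA) \<subseteq> to_holonomy ` vcarrier dual_lie"
      proof
        fix x assume "x \<in> vcarrier (completed_holonomy sA GA)"
        then have x: "x \<in> PiE {1..} (holonomy_degree sA GA)" by (simp add: completed_simps)
        then have "\<forall>n. \<exists>p. n \<ge> 1 \<longrightarrow> keys p \<subseteq> homogeneous_trees n \<and> x n = hol p"
          unfolding holonomy_degree_eq by (auto simp: PiE_iff image_iff)
        then obtain p where p: "\<And>n. n \<ge> 1 \<Longrightarrow> keys (p n) \<subseteq> homogeneous_trees n"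
          "\<And>n. n \<ge> 1 \<Longrightarrow> x n = hol (p n)" by metis
        define h where "h n = (if n \<ge> 1 then psi (p n) else (\<lambda>w. 0))" for n
        have "h n \<in> functionals" for n
          unfolding h_def using p(1)[of n] homogeneous_trees_subset[of n] psi_closed[of "p n"] zero_functional by auto
        then obtain u where u: "u \<in> functionals" "\<And>j w. w \<in> V j \<Longrightarrow> u w = h j w"
          using functional_glue[of h] by blast
        have "x = to_holonomy u"
        proof
          fix n show "x n = to_holonomy u n"
          proof (cases "n \<ge> 1")
            case True
            have "hol (p n) = hol (lift_part n u)"
              unfolding homogeneous_hol_eq[OF True p(1)[OF True] lift_part_homogeneous[OF True]]
              using psi_lift_part[OF True u(1)] u(2) True by (simp add: h_def)
            then show ?thesis using p(2)[OF True] True by (simp add: to_holonomy_def)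
          next
            case False
            then show ?thesis using x by (auto simp: to_holonomy_def PiE_def extensional_def)
          qed
        qed
        then show "x \<in> to_holonomy ` vcarrier dual_lie" using u(1) by auto
      qed
    qed
  qed
next
  fix u v assume uv: "u \<in> vcarrier dual_lie" "v \<in> vcarrier dual_lie"
  show "to_holonomy (vadd dual_lie u v) = vadd (completed_holonomy sA GA) (to_holonomy u) (to_holonomy v)"
    by (auto simp: completed_simps to_holonomy_def fun_eq_iff lift_part_add hol_ops lift_part_trees)
  show "to_holonomy (aprod dual_lie u v) = aprod (completed_holonomy sA GA) (to_holonomy u) (to_holonomy v)"
  proof
    fix n
    show "to_holonomy (aprod dual_lie u v) n =
        aprod (completed_holonomy sA GA) (to_holonomy u) (to_holonomy v) n"
    proof (cases "n \<ge> 1")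
      case True
      have "aprod (completed_holonomy sA GA) (to_holonomy u) (to_holonomy v) n =
          vsum H (map (\<lambda>p. aprod H (to_holonomy u p) (to_holonomy v (n - p))) [1..<n])"
        using True by (simp add: completed_simps)
      also have "map (\<lambda>p. aprod H (to_holonomy u p) (to_holonomy v (n - p))) [1..<n] =
          map (\<lambda>p. aprod H (hol (lift_part p u)) (hol (lift_part (n - p) v))) [1..<n]"
        by (auto simp: to_holonomy_def)
      also have "vsum H \<dots> = to_holonomy (aprod dual_lie u v) n"
        using hol_lift_part_bracket[OF True, of u v] uv True by (simp add: to_holonomy_def)
      finally show ?thesis by simp
    qed (simp add: completed_simps to_holonomy_def)
  qed
next
  fix c u
  show "to_holonomy (vsmult dual_lie c u) = vsmult (completed_holonomy sA GA) c (to_holonomy u)"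
    by (auto simp: completed_simps to_holonomy_def fun_eq_iff lift_part_scale hol_ops lift_part_trees)
qed

lemma to_holonomy_zero: "to_holonomy (vzero dual_lie) = vzero (completed_holonomy sA GA)"
proof -
  have "lift_part n (\<lambda>x. 0) = 0" for n
    by (rule poly_mapping_eqI) (simp add: lift_part_def lookup_sum)
  then show ?thesis by (simp add: completed_simps to_holonomy_def hol_zero)
qed

lemma hol_lift_part_zero_iff:
  assumes j: "1 \<le> j" and u: "u \<in> functionals"
  shows "hol (lift_part j u) = vzero H \<longleftrightarrow> (\<forall>w\<in>V j. u w = 0)"
  using homogeneous_hol_eq[OF j lift_part_homogeneous[OF j], of 0 u] psi_lift_part[OF j u]
  by (simp add: hol_zero)

lemma to_holonomy_filt:
  assumes k: "1 \<le> k"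
  shows "to_holonomy ` filt dual_lie k = filt (completed_holonomy sA GA) k"
proof -
  have im: "to_holonomy ` functionals = PiE {1..} (holonomy_degree sA GA)"
    using to_holonomy_iso unfolding alg_iso_def bij_betw_def by (simp add: completed_simps)
  have "u \<in> filt dual_lie k \<longleftrightarrow> (\<forall>i\<in>{1..<k}. to_holonomy u i = vzero H)" if u: "u \<in> functionals" for u
  proof -
    have "(\<forall>i\<in>{1..<k}. to_holonomy u i = vzero H) \<longleftrightarrow> (\<forall>i\<in>{1..<k}. \<forall>w\<in>V i. u w = 0)"
      using hol_lift_part_zero_iff[OF _ u] by (auto simp: to_holonomy_def)
    also have "\<dots> \<longleftrightarrow> (\<forall>i<k. \<forall>w\<in>V i. u w = 0)"
    proof -
      have "\<forall>w\<in>V 0. u w = 0" using V_0 functional_zero[OF u] by simp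
      then show ?thesis by (metis One_nat_def Suc_leI atLeastLessThan_iff bot_nat_0.not_eq_extremum)
    qed
    finally show ?thesis using u by simp
  qed
  then show ?thesis
    unfolding completed_simps im[symmetric] by auto
qed

end

subsection \<open>From the dual Lie algebra to the inverse limit\<close>

abbreviation stage_1 :: "nat \<Rightarrow> 'm set" where
  "stage_1 i \<equiv> stage sM V i \<inter> GM 1"

abbreviation stage_lie :: "nat \<Rightarrow> ('k, 'm \<Rightarrow> 'k) alg" where
  "stage_lie \<equiv> model_lie_stage sM GM d V"

abbreviation model_lie :: "('k, nat \<Rightarrow> 'm \<Rightarrow> 'k) filtered_alg" where
  "model_lie \<equiv> model_lie_algebra sM GM d V"

definition restrict_stage :: "nat \<Rightarrow> ('m \<Rightarrow> 'k) \<Rightarrow> 'm \<Rightarrow> 'k" where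
  "restrict_stage i u x = (if x \<in> stage_1 i then u x else 0)"

definition to_model :: "('m \<Rightarrow> 'k) \<Rightarrow> nat \<Rightarrow> 'm \<Rightarrow> 'k" where
  "to_model u = (\<lambda>i\<in>{1..}. restrict_stage i u)"

lemma stage_lie_simps:
  "vcarrier (stage_lie i) = vcarrier (dual sM (stage_1 i))"
  "vadd (stage_lie i) = (\<lambda>f g x. f x + g x)" "vzero (stage_lie i) = (\<lambda>x. 0)"
  "vsmult (stage_lie i) = (\<lambda>c f x. c * f x)"
  "aprod (stage_lie i) = (\<lambda>u v w. if w \<in> stage_1 i then wedge_functional sM GM V i u v (d w) else 0)"
  unfolding model_lie_stage_def by (simp_all add: vspace.defs alg.defs dual_def)

lemma stage_subspace: "D1.subspace (stage sM V i)"
  unfolding stage_def by simp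

lemma stage_1_subspace: "D1.subspace (stage_1 i)"
  by (intro D1.subspace_inter stage_subspace GM_subspace)

lemma stage_1_mono: "i \<le> j \<Longrightarrow> stage_1 i \<subseteq> stage_1 j"
  using stage_mono by blast

lemma gens_stage_1: "gens i \<subseteq> stage_1 i"
proof -
  have "v \<in> stage sM V i" if "v \<in> gens i" for v
    unfolding stage_def by (rule D1.span_base) (use that in \<open>intro CollectI exI[of _ "[v]"], auto\<close>)
  then show ?thesis using gens_subset by blast
qed

lemma GM_1_stage: "x \<in> GM 1 \<Longrightarrow> \<exists>i\<ge>1. x \<in> stage_1 i"
proof -
  assume "x \<in> GM 1"
  then obtain i where i: "i \<ge> 1" "x \<in> generators_upto sM V i" using GM_1_generators by blast
  have "generators_upto sM V i \<subseteq> stage_1 i"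
    unfolding generators_upto_def by (rule D1.span_minimal[OF gens_stage_1 stage_1_subspace])
  then show ?thesis using i by blast
qed

lemma d_stage_1:
  assumes w: "w \<in> stage_1 i"
  shows "d w \<in> stage sM V i \<inter> GM 2"
proof -
  have "w \<in> words_span (gens i) 1" by (rule stage_words_span[OF w])
  then have "d w \<in> stage sM V i"
    unfolding words_span_def
  proof (induction rule: D1.span_induct_alt)
    case base
    then show ?case using stage_subspace by (simp add: D1.subspace_0)
  next
    case (step c x y)
    then obtain j where j: "j \<in> {1..i}" "x \<in> V j" by (auto simp: length_Suc_conv)
    then have "d x \<in> words_span (gens i) 2" using d_words_span[of j i x] by simp
    moreover have "words_span (gens i) 2 \<subseteq> stage sM V i"
      unfolding words_span_def stage_def by (rule D1.span_mono) blast
    ultimately have "d x \<in> stage sM V i" by blast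
    then show ?case using step stage_subspace
      by (simp add: d_add d_scale D1.subspace_add D1.subspace_scale)
  qed
  then show ?thesis using w d_GM_1 by blast
qed

lemma words_span_mult_1:
  assumes a: "a \<in> words_span Y 1" and b: "b \<in> words_span Y n"
  shows "a * b \<in> words_span Y (Suc n)"
  using a unfolding words_span_def[of Y 1]
proof (induction rule: D1.span_induct_alt)
  case base
  then show ?case using subspace_words_span by (simp add: D1.subspace_0)
next
  case (step c x y)
  then have "x \<in> Y" by (auto simp: length_Suc_conv)
  then have "x * b \<in> words_span Y (Suc n)" by (rule words_span_mult[OF _ b])
  then show ?case
    using step subspace_words_span
    by (simp add: distrib_right D1.scale_mult_left[symmetric] D1.subspace_add D1.subspace_scale)
qed

text \<open>On each stage the wedge of two functionals is the restricted pairing; it is determined by its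
  values on products, because these span the part of degree two.\<close>

lemma wedge_functional_eq:
  assumes u: "u \<in> functionals" and v: "v \<in> functionals"
  shows "wedge_functional sM GM V i (restrict_stage i u) (restrict_stage i v) =
    (\<lambda>z. if z \<in> stage sM V i \<inter> GM 2 then pair u v z else 0)" (is "_ = ?g")
  unfolding wedge_functional_def
proof (rule the_equality)
  let ?S = "stage sM V i \<inter> GM 2"
  have S: "D1.subspace ?S" by (intro D1.subspace_inter stage_subspace GM_subspace)
  have words: "words_span (gens i) 2 \<subseteq> ?S"
  proof (rule Int_greatest)
    show "words_span (gens i) 2 \<subseteq> stage sM V i"
      unfolding words_span_def stage_def by (rule D1.span_mono) blast
  qed (rule words_span_GM[OF gens_subset])
  show "?g \<in> vcarrier (dual sM ?S) \<and> (\<forall>a\<in>stage_1 i. \<forall>b\<in>stage_1 i.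
      ?g (a * b) = restrict_stage i u a * restrict_stage i v b - restrict_stage i u b * restrict_stage i v a)"
  proof (intro conjI ballI)
    show "?g \<in> vcarrier (dual sM ?S)"
      unfolding dual_def
      by (simp add: u v pair_add pair_scale D1.subspace_add[OF S] D1.subspace_scale[OF S] del: Int_iff)
    fix a b assume ab: "a \<in> stage_1 i" "b \<in> stage_1 i"
    have "a * b \<in> words_span (gens i) (Suc 1)"
      by (intro words_span_mult_1) (use ab stage_words_span in blast)+
    then have "a * b \<in> ?S" using words by (auto simp: numeral_2_eq_2)
    then show "?g (a * b) = restrict_stage i u a * restrict_stage i v b - restrict_stage i u b * restrict_stage i v a"
      using ab u v by (simp add: pair_mult restrict_stage_def)
  qed
  fix g assume g: "g \<in> vcarrier (dual sM ?S) \<and> (\<forall>a\<in>stage_1 i. \<forall>b\<in>stage_1 i.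
      g (a * b) = restrict_stage i u a * restrict_stage i v b - restrict_stage i u b * restrict_stage i v a)"
  have glin: "g (x + y) = g x + g y" "g (sM c x) = c * g x" if "x \<in> ?S" "y \<in> ?S" for x y c
    using g that unfolding dual_def by auto
  show "g = ?g"
  proof
    fix z
    show "g z = ?g z"
    proof (cases "z \<in> ?S")
      case True
      have "z \<in> words_span (gens i) 2" by (rule stage_words_span[OF True])
      then have "z \<in> ?S \<and> g z = pair u v z"
        unfolding words_span_def
      proof (induction rule: D1.span_induct_alt)
        case base
        have z0: "0 \<in> ?S" using S by (rule D1.subspace_0)
        show ?case using z0 glin(2)[OF z0 z0, of 0] u v by (simp add: pair_zero)
      next
        case (step c x y)
        then obtain xs where xs: "x = prod_list xs" "set xs \<subseteq> gens i" "length xs = 2" by blast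
        then obtain a b where ab: "xs = [a, b]" by (metis (no_types) length_0_conv length_Suc_conv numeral_2_eq_2)
        have abi: "a \<in> stage_1 i" "b \<in> stage_1 i" using xs ab gens_stage_1[of i] by auto
        have "x \<in> words_span (gens i) 2" unfolding words_span_def by (rule D1.span_base) (use step in blast)
        then have xS: "x \<in> ?S" using words by blast
        have cS: "sM c x \<in> ?S" by (rule D1.subspace_scale[OF S xS])
        have "g x = u a * v b - u b * v a" using g abi xs(1) ab by (simp add: restrict_stage_def)
        then have "g x = pair u v x" using pair_mult[OF u v, of a b] abi xs(1) ab by simp
        moreover have "sM c x + y \<in> ?S" using step cS by (intro D1.subspace_add[OF S]) auto
        ultimately show ?case
          using step glin(1)[OF cS, of y] glin(2)[OF xS xS, of c] u v by (simp add: pair_add pair_scale)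
      qed
      then show ?thesis using True by simp
    next
      case False
      then show ?thesis using g unfolding dual_def by auto
    qed
  qed
qed

lemma restrict_stage_dual:
  assumes "u \<in> functionals"
  shows "restrict_stage i u \<in> vcarrier (dual sM (stage_1 i))"
proof -
  have "u (x + y) = u x + u y" "u (sM c x) = c * u x" if "x \<in> stage_1 i" "y \<in> stage_1 i" for x y c
    using functional_add[OF assms] functional_scale[OF assms] that by auto
  then show ?thesis
    unfolding dual_def restrict_stage_def
    by (simp add: D1.subspace_add[OF stage_1_subspace] D1.subspace_scale[OF stage_1_subspace]
        del: Int_iff One_nat_def)
qed

lemma model_lie_simps:
  "vcarrier model_lie = lim_carrier (\<lambda>i. vcarrier (dual sM (stage_1 i))) (\<lambda>i f x. if x \<in> stage_1 i then f x else 0)"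
  "vadd model_lie = (\<lambda>x y. \<lambda>i\<in>{1..}. (\<lambda>w. x i w + y i w))"
  "vzero model_lie = (\<lambda>i\<in>{1..}. (\<lambda>x. 0))"
  "vsmult model_lie = (\<lambda>c x. \<lambda>i\<in>{1..}. (\<lambda>w. c * x i w))"
  "aprod model_lie = (\<lambda>x y. \<lambda>i\<in>{1..}. aprod (stage_lie i) (x i) (y i))"
  "filt model_lie = (\<lambda>k. {x \<in> vcarrier model_lie. k \<ge> 2 \<longrightarrow> x (k - 1) = (\<lambda>x. 0)})"
  unfolding model_lie_algebra_def inverse_limit_def by (simp_all add: stage_lie_simps)

lemma to_model_carrier:
  assumes u: "u \<in> functionals"
  shows "to_model u \<in> vcarrier model_lie"
proof -
  have mono: "x \<in> stage_1 (Suc i)" if "x \<in> stage_1 i" for x and i :: nat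
    using stage_1_mono[of i "Suc i"] that by auto
  show ?thesis
    unfolding model_lie_simps lim_carrier_def
  proof (intro CollectI conjI allI impI ext)
    show "to_model u \<in> PiE {1..} (\<lambda>i. vcarrier (dual sM (stage_1 i)))"
      using restrict_stage_dual[OF u] unfolding to_model_def by auto
    fix i :: nat and x assume "1 \<le> i"
    then show "(if x \<in> stage_1 i then to_model u (Suc i) x else 0) = to_model u i x"
      using mono[of x i]
      by (cases "x \<in> stage_1 i") (simp_all add: to_model_def restrict_stage_def del: Int_iff One_nat_def)
  qed
qed

text \<open>A compatible sequence defines a functional on the union of the stages; its value at \<open>w\<close> is read
  off at the first stage which contains \<open>w\<close>.\<close>

lemma to_model_surj:
  assumes "x \<in> vcarrier model_lie"
  shows "\<exists>u\<in>functionals. x = to_model u"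
proof -
  have xP: "x \<in> PiE {1..} (\<lambda>i. vcarrier (dual sM (stage_1 i)))"
    and x\<pi>: "\<And>i. i \<ge> 1 \<Longrightarrow> (\<lambda>w. if w \<in> stage_1 i then x (Suc i) w else 0) = x i"
    using assms unfolding model_lie_simps lim_carrier_def by auto
  have xi: "x i \<in> vcarrier (dual sM (stage_1 i))" if "i \<ge> 1" for i using xP that by auto
  have coh: "x j w = x i w" if "1 \<le> i" "i \<le> j" "w \<in> stage_1 i" for i j w
    using that(2)
  proof (induction j rule: dec_induct)
    case (step j)
    then show ?case using fun_cong[OF x\<pi>[of j], of w] that stage_1_mono[of i j] by auto
  qed simp
  define ix where "ix w = (LEAST i. i \<ge> 1 \<and> w \<in> stage_1 i)" for w
  define u where "u w = (if w \<in> GM 1 then x (ix w) w else 0)" for w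
  have ux: "u w = x i w" if "i \<ge> 1" "w \<in> stage_1 i" for i w
  proof -
    have "1 \<le> ix w \<and> w \<in> stage_1 (ix w)" "ix w \<le> i"
      unfolding ix_def using that by (auto intro: LeastI2 Least_le)
    then show ?thesis using coh[of "ix w" i w] that unfolding u_def by auto
  qed
  have "u \<in> functionals"
    unfolding functionals_iff
  proof (intro conjI ballI allI impI)
    fix a b assume a: "a \<in> GM 1" and b: "b \<in> GM 1"
    obtain i j where "i \<ge> 1" "a \<in> stage_1 i" "j \<ge> 1" "b \<in> stage_1 j" using GM_1_stage a b by blast
    then have ij: "max i j \<ge> 1" "a \<in> stage_1 (max i j)" "b \<in> stage_1 (max i j)"
      using stage_1_mono[of i "max i j"] stage_1_mono[of j "max i j"] by auto
    then have "a + b \<in> stage_1 (max i j)" by (intro D1.subspace_add[OF stage_1_subspace])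
    then show "u (a + b) = u a + u b"
      using ux[OF ij(1)] ij xi[OF ij(1)] unfolding dual_def by auto
  next
    fix c a assume a: "a \<in> GM 1"
    then obtain i where i: "i \<ge> 1" "a \<in> stage_1 i" using GM_1_stage by blast
    then have "sM c a \<in> stage_1 i" by (intro D1.subspace_scale[OF stage_1_subspace])
    then show "u (sM c a) = c * u a"
      using ux[OF i(1)] i xi[OF i(1)] unfolding dual_def by auto
  qed (simp add: u_def)
  moreover have "x = to_model u"
  proof
    fix i show "x i = to_model u i"
    proof (cases "i \<ge> 1")
      case True
      have "x i w = 0" if "w \<notin> stage_1 i" for w using xi[OF True] that unfolding dual_def by auto
      then show ?thesis using True ux[OF True] by (auto simp: to_model_def restrict_stage_def fun_eq_iff)
    next
      case False
      then show ?thesis using xP by (auto simp: to_model_def PiE_def extensional_def)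
    qed
  qed
  ultimately show ?thesis by blast
qed

lemma to_model_iso: "alg_iso dual_lie model_lie to_model"
  unfolding alg_iso_def
proof (intro conjI ballI allI)
  show "bij_betw to_model (vcarrier dual_lie) (vcarrier model_lie)"
    unfolding bij_betw_def
  proof
    show "inj_on to_model (vcarrier dual_lie)"
    proof (rule inj_onI)
      fix u v assume uv: "u \<in> vcarrier dual_lie" "v \<in> vcarrier dual_lie" and e: "to_model u = to_model v"
      show "u = v"
      proof (rule functionals_eqI)
        fix j w assume j: "1 \<le> j" and w: "w \<in> V j"
        have "w \<in> gens j" using w j by auto
        then have "w \<in> stage_1 j" by (rule subsetD[OF gens_stage_1])
        then show "u w = v w"
          using fun_cong[OF fun_cong[OF e, of j], of w] j by (simp add: to_model_def restrict_stage_def)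
      qed (use uv in auto)
    qed
    show "to_model ` vcarrier dual_lie = vcarrier model_lie"
      using to_model_carrier to_model_surj by auto
  qed
next
  fix u v assume uv: "u \<in> vcarrier dual_lie" "v \<in> vcarrier dual_lie"
  show "to_model (vadd dual_lie u v) = vadd model_lie (to_model u) (to_model v)"
    by (auto simp: model_lie_simps to_model_def restrict_stage_def fun_eq_iff)
  show "to_model (aprod dual_lie u v) = aprod model_lie (to_model u) (to_model v)"
  proof (intro ext)
    fix i w
    show "to_model (aprod dual_lie u v) i w = aprod model_lie (to_model u) (to_model v) i w"
    proof (cases "i \<ge> 1 \<and> w \<in> stage_1 i")
      case True
      then have "d w \<in> stage sM V i \<inter> GM 2" by (intro d_stage_1) simp
      then show ?thesis
        using True uv
        by (simp add: model_lie_simps stage_lie_simps to_model_def wedge_functional_eq)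
          (simp add: restrict_stage_def bracket_def)
    qed (auto simp: model_lie_simps stage_lie_simps to_model_def restrict_stage_def)
  qed
next
  fix c u
  show "to_model (vsmult dual_lie c u) = vsmult model_lie c (to_model u)"
    by (auto simp: model_lie_simps to_model_def restrict_stage_def fun_eq_iff)
qed

lemma to_model_zero: "to_model (vzero dual_lie) = vzero model_lie"
  by (auto simp: model_lie_simps to_model_def restrict_stage_def fun_eq_iff)

lemma to_model_filt:
  assumes k: "1 \<le> k"
  shows "to_model ` filt dual_lie k = filt model_lie k"
proof -
  have im: "to_model ` functionals = vcarrier model_lie"
    using to_model_iso unfolding alg_iso_def bij_betw_def by simp
  have "(\<forall>j<k. \<forall>w\<in>V j. u w = 0) \<longleftrightarrow> (k \<ge> 2 \<longrightarrow> to_model u (k - 1) = (\<lambda>x. 0))"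
    if u: "u \<in> functionals" for u
  proof
    assume 0: "\<forall>j<k. \<forall>w\<in>V j. u w = 0"
    show "k \<ge> 2 \<longrightarrow> to_model u (k - 1) = (\<lambda>x. 0)"
    proof
      assume k2: "k \<ge> 2"
      have "u w = 0" if w: "w \<in> stage_1 (k - 1)" for w
      proof (rule functional_words_span_1[OF u gens_subset _ stage_words_span[OF w]])
        fix y assume "y \<in> gens (k - 1)"
        then obtain j where "j \<in> {1..k - 1}" "y \<in> V j" by blast
        then show "u y = 0" using 0[rule_format, of j y] k2 by auto
      qed
      then show "to_model u (k - 1) = (\<lambda>x. 0)"
        using k2 by (auto simp: to_model_def restrict_stage_def)
    qed
  next
    assume 0: "k \<ge> 2 \<longrightarrow> to_model u (k - 1) = (\<lambda>x. 0)"
    show "\<forall>j<k. \<forall>w\<in>V j. u w = 0"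
    proof (intro allI impI ballI)
      fix j w assume j: "j < k" and w: "w \<in> V j"
      show "u w = 0"
      proof (cases "j = 0")
        case True
        then show ?thesis using w V_0 functional_zero[OF u] by simp
      next
        case False
        then have "w \<in> gens (k - 1)" using w j by auto
        then have "w \<in> stage_1 (k - 1)" by (rule subsetD[OF gens_stage_1])
        moreover have "1 \<le> k - 1" "to_model u (k - 1) w = 0" using 0 False j by auto
        ultimately show ?thesis by (simp add: to_model_def restrict_stage_def)
      qed
    qed
  qed
  then show ?thesis
    unfolding model_lie_simps(6) im[symmetric] by auto
qed

theorem model_lie_iso_completed_holonomy:
  assumes "\<exists>B. finite B \<and> D2.span B = GA 1"
  shows "\<exists>f. complete_filtered_lie_iso model_lie (completed_holonomy sA GA) f"
proof -
  obtain N E T where fr: "\<And>j. 1 \<le> j \<Longrightarrow> frame j (N j) (E j) (T j)"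
    using frames_exist[OF assms] by blast
  let ?h = "to_holonomy N E T"
  have h1: "alg_iso dual_lie (completed_holonomy sA GA) ?h" by (rule to_holonomy_iso[OF fr])
  have h2: "?h (vzero dual_lie) = vzero (completed_holonomy sA GA)" by (rule to_holonomy_zero[OF fr])
  have h3: "?h ` filt dual_lie k = filt (completed_holonomy sA GA) k" if "k \<ge> 1" for k
    by (rule to_holonomy_filt[OF fr that])
  note D = filtered_lie_dual_lie cauchy_complete_dual_lie
  have alg: "algebra_on dual_lie" using lie_algebra_dual_lie unfolding lie_algebra_def by simp
  let ?f = "\<lambda>x. ?h (inv_into (vcarrier dual_lie) to_model x)"
  have inj: "inj_on to_model (vcarrier dual_lie)"
    using to_model_iso unfolding alg_iso_def bij_betw_def by simp
  have "?f ` filt model_lie k = filt (completed_holonomy sA GA) k" if k: "k \<ge> 1" for k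
  proof -
    have "filt dual_lie k \<subseteq> vcarrier dual_lie" by auto
    then have "inv_into (vcarrier dual_lie) to_model ` (to_model ` filt dual_lie k) = filt dual_lie k"
      using inj by (rule inv_into_image_cancel[rotated])
    moreover have "?f ` filt model_lie k = ?h ` inv_into (vcarrier dual_lie) to_model ` filt model_lie k"
      by (rule image_image[symmetric])
    ultimately show ?thesis by (simp only: to_model_filt[OF k, symmetric] h3[OF k, symmetric])
  qed
  moreover have "alg_iso model_lie (completed_holonomy sA GA) ?f"
    by (rule alg_iso_via[OF alg to_model_iso h1])
  moreover have "complete_filtered_lie_algebra model_lie"
    by (rule complete_filtered_lie_transport[OF D to_model_iso to_model_zero to_model_filt])
  moreover have "complete_filtered_lie_algebra (completed_holonomy sA GA)"
    by (rule complete_filtered_lie_transport[OF D h1 h2 h3])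
  ultimately show ?thesis unfolding complete_filtered_lie_iso_def by blast
qed

end

theorem theorem4p10:
  fixes sA :: "'k::field_char_0 \<Rightarrow> 'a::ring_1 \<Rightarrow> 'a" and GA :: "nat \<Rightarrow> 'a set"
    and sM :: "'k \<Rightarrow> 'm::ring_1 \<Rightarrow> 'm" and GM :: "nat \<Rightarrow> 'm set" and d :: "'m \<Rightarrow> 'm"
    and \<phi> :: "'m \<Rightarrow> 'a" and V :: "nat \<Rightarrow> 'm set"
  assumes "graded_commutative_algebra sA GA"
    and "connected_grading sA GA"
    and "\<exists>B. finite B \<and> module.span sA B = GA 1"
    and "canonical_one_minimal_model sA GA sM GM d \<phi> V"
  shows "\<exists>f. complete_filtered_lie_iso (model_lie_algebra sM GM d V) (completed_holonomy sA GA) f"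
  using canonical_one_minimal_model.model_lie_iso_completed_holonomy[OF assms(4,3)] .

end
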